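(* Fix $l\in(0,1/2)$ and $-1<\eta<1$, and let $$D_N(\eta):=\sup\Big\{a\in\mathbb N:\ \exists x\in V_N^l\text{ such that }\min_{y\in B(x,a)}\Phi_y\ge 2\eta\sqrt g\log N\Big\}.$$ Then $$\lim_{N\to\infty}\frac{\log D_N(\eta)}{\log N}=\frac12-\frac\eta2\quad\text{in probability.}$$
   Context: For an integer $N\ge1$ let $V_N=\{1,\dots,N\}^2\subset\mathbb Z^2$, let $\partial V_N$ be the set of points of $V_N$ having a nearest neighbour outside $V_N$, and $\mathrm{int}(V_N)=V_N\setminus\partial V_N$. The two-dimensional discrete Gaussian free field (GFF) on $V_N$ is the centered Gaussian family $\Phi=(\Phi_x)_{x\in V_N}$ (under a probability $\mathbf P$) with $\Phi_x=0$ for $x\in\partial V_N$ and covariance $\mathrm{Cov}(\Phi_x,\Phi_y)=G_N(x,y)=\mathbb E_x\big(\sum_{i=0}^{\tau_{\partial V_N}}\mathbf 1_{\{\eta_i=y\}}\big)$ for $x,y\in\mathrm{int}(V_N)$, where $(\eta_i)_{i\ge0}$ is simple random walk on $\mathbb Z^2$ started at $x$ and $\tau_{\partial V_N}=\inf\{i\ge0:\eta_i\in\partial V_N\}$. Let $g=2/\pi$ and $\log$ the natural logarithm. For $l\in(0,1/2)$, $V_N^l:=\{x\in V_N:\mathrm{dist}(x,V_N^c)\ge lN\}$. $B(x,a)$ denotes the box (set of lattice points of the axis-parallel square) with center $x$ and edge length $a$. *)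

theory Defs
  imports "HOL-Probability.Probability"
begin

type_synonym site = "int \<times> int"

definition VN :: "nat \<Rightarrow> site set" where
  "VN N = {1..int N} \<times> {1..int N}"

definition nbrs :: "site \<Rightarrow> site set" where
  "nbrs x = {(fst x + 1, snd x), (fst x - 1, snd x), (fst x, snd x + 1), (fst x, snd x - 1)}"

definition bdryVN :: "nat \<Rightarrow> site set" where
  "bdryVN N = {x \<in> VN N. \<exists>z \<in> nbrs x. z \<notin> VN N}"

definition intVN :: "nat \<Rightarrow> site set" where
  "intVN N = VN N - bdryVN N"

text \<open>killed_walk N n x y: probability that simple random walk started at x has
  eta_0,...,eta_n all in int(V_N) and eta_n = y (each nearest-neighbour step has
  probability 1/4).\<close>
fun killed_walk :: "nat \<Rightarrow> nat \<Rightarrow> site \<Rightarrow> site \<Rightarrow> real" where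
  "killed_walk N 0 x y = (if x \<in> intVN N \<and> x = y then 1 else 0)"
| "killed_walk N (Suc n) x y =
     (if x \<in> intVN N then (\<Sum>z\<in>nbrs x. killed_walk N n z y) / 4 else 0)"

text \<open>Green function: G_N(x,y) = E_x (sum_{i=0}^{tau} 1{eta_i = y}), for y in int(V_N),
  written as sum over i of P_x(i <= tau, eta_i = y).\<close>
definition greenN :: "nat \<Rightarrow> site \<Rightarrow> site \<Rightarrow> real" where
  "greenN N x y = (\<Sum>n. killed_walk N n x y)"

text \<open>Phi (a family indexed by the sites) is a 2D discrete GFF on V_N under M:
  measurable, zero on the boundary, and a centered Gaussian family on int(V_N) with
  covariance G_N (every linear combination is centered normal with the right variance,
  expressed via its characteristic function, which also covers variance 0).\<close>
definition is_dgff :: "'a measure \<Rightarrow> nat \<Rightarrow> ('a \<Rightarrow> site \<Rightarrow> real) \<Rightarrow> bool" where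
  "is_dgff M N Phi \<longleftrightarrow>
     (\<forall>x. (\<lambda>\<omega>. Phi \<omega> x) \<in> borel_measurable M) \<and>
     (\<forall>\<omega>\<in>space M. \<forall>x\<in>bdryVN N. Phi \<omega> x = 0) \<and>
     (\<forall>c :: site \<Rightarrow> real. \<forall>t::real.
        char (distr M borel (\<lambda>\<omega>. \<Sum>x\<in>intVN N. c x * Phi \<omega> x)) t =
        complex_of_real (exp (- ((\<Sum>x\<in>intVN N. \<Sum>y\<in>intVN N. c x * c y * greenN N x y) * t\<^sup>2) / 2)))"

definition VNl :: "real \<Rightarrow> nat \<Rightarrow> site set" where
  "VNl l N = {x \<in> VN N. \<forall>z. z \<notin> VN N \<longrightarrow>
      sqrt (real_of_int ((fst x - fst z)\<^sup>2 + (snd x - snd z)\<^sup>2)) \<ge> l * real N}"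

definition box :: "site \<Rightarrow> nat \<Rightarrow> site set" where
  "box x a = {y. \<bar>real_of_int (fst y - fst x)\<bar> \<le> real a / 2 \<and> \<bar>real_of_int (snd y - snd x)\<bar> \<le> real a / 2}"

definition g_const :: real where "g_const = 2 / pi"

text \<open>D_N(eta) as an extended natural (sup of the empty set is 0; may be infinite).
  Field values outside V_N are taken to be 0 (zero boundary condition).\<close>
definition DN :: "real \<Rightarrow> real \<Rightarrow> nat \<Rightarrow> (site \<Rightarrow> real) \<Rightarrow> enat" where
  "DN l \<eta> N phi = Sup {enat a | a. \<exists>x\<in>VNl l N. \<forall>y\<in>box x a.
      (if y \<in> VN N then phi y else 0) \<ge> 2 * \<eta> * sqrt g_const * ln (real N)}"

end

theory Submission
  imports Defs "HOL-Real_Asymp.Real_Asymp"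
begin

text \<open>
  Decompose the field in a block of side \<open>N^c\<close> as an independent field of the block plus the harmonic
  extension of its boundary values, which has variance about \<open>g (1 - c) ln N\<close>.

  Upper bound: if \<open>c > (1 - \<eta>) / 2\<close>, a box of side slightly larger than \<open>N^c\<close> contains
  polynomially many such blocks, so one of them has a point where its own field is about
  \<open>- 2 sqrt g c ln N\<close>. The harmonic part at that point is at most about
  \<open>2 sqrt g (1 - c) ln N\<close> by a union bound over the \<open>N^(2 (1 - c))\<close> blocks, and
  \<open>2 (1 - c) - 2 c < 2 \<eta>\<close>.

  Lower bound: with \<open>b < (1 - \<eta>) / 2\<close>, a truncated second moment computation shows that the field on
  a box of side \<open>n\<close> exceeds \<open>2 sqrt g (1 - 2 b) ln n\<close> (up to \<open>o (ln n)\<close>) on some sub-box of side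
  \<open>n^b\<close> with probability at least \<open>n^(-\<epsilon>)\<close>: the field smoothed at scale \<open>n^b\<close> reaches
  \<open>2 sqrt g (1 - b) ln n\<close>, and the fluctuations below that scale cost \<open>2 sqrt g b ln n\<close>. Using
  independent blocks of side \<open>N^(1 - \<kappa>)\<close> with small \<open>\<kappa>\<close> raises this probability to one. The case of
  small \<open>b\<close>, applied to the negative of the field, gives the low points needed above.

  All covariances are tails of the sum of the killed heat kernel, and only their leading logarithmic
  order is used.
\<close>

section \<open>The heat kernel of simple random walk\<close>

text \<open>Everything is needed only up to factors \<open>N^o(1)\<close>, and this fixes the tools.
  The killed heat kernels form a semigroup, so smoothing never leads out of one family of
  covariances, and Wallis and Chernoff bounds estimate that family without any potential kernel.
  Events enter through exponential weights, so each moment is a Gaussian moment generating function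
  and no density has to be bounded. At the tilt \<open>2 / sqrt g\<close> the moment
  \<open>E exp (gam Phi)\<close> has order \<open>N^2\<close>, the number of sites. The untruncated
  second moment at this tilt is dominated by nearby pairs that share one exceptionally high coarse
  field; the constraints at the intermediate scales cut the resulting excess down to what the
  entropy of pairs can pay. The finite number of scales still costs a factor
  \<open>n^(-\<epsilon>)\<close>, and the Markov property removes it by repetition. In the upper
  bound a union over all sites for the harmonic part would be too expensive; selecting one low point
  per block by the block field alone reduces it to a union over blocks.\<close>

fun rw1 :: "nat \<Rightarrow> int \<Rightarrow> real" where
  "rw1 0 m = (if m = 0 then 1 else 0)"
| "rw1 (Suc n) m = (rw1 n (m - 1) + rw1 n (m + 1)) / 2"

lemma rw1_nonneg: "0 \<le> rw1 n m"
  by (induction n arbitrary: m) auto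

lemma rw1_uminus: "rw1 n (- m) = rw1 n m"
proof (induction n arbitrary: m)
  case (Suc n)
  have "rw1 n (- m - 1) = rw1 n (m + 1)" "rw1 n (- m + 1) = rw1 n (m - 1)"
    using Suc[of "m + 1"] Suc[of "m - 1"] by simp_all
  then show ?case by simp
qed simp

lemma rw1_abs: "rw1 n \<bar>m\<bar> = rw1 n m"
  by (simp add: abs_if rw1_uminus)

lemma rw1_odd: "odd (int n + m) \<Longrightarrow> rw1 n m = 0"
proof (induction n arbitrary: m)
  case (Suc n)
  have "odd (int n + (m - 1))" "odd (int n + (m + 1))"
    using Suc.prems by auto
  with Suc.IH show ?case by simp
qed auto

text \<open>Exchangeability of the \<open>n + 1\<close> steps: the mean of the position on the event
  of ending at \<open>m\<close> is \<open>n + 1\<close> times the mean of one step on that event.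
  The identity plays the role of the derivative of the Gaussian kernel; monotonicity, the recursion
  for return probabilities and the quadratic lower bound all come from it.\<close>

lemma rw1_ballot:
  "real_of_int m * rw1 (Suc n) m = (real n + 1) / 2 * (rw1 n (m - 1) - rw1 n (m + 1))"
proof (induction n arbitrary: m)
  case 0
  show ?case by auto
next
  case (Suc n)
  let ?D = "rw1 n (m - 2) - rw1 n (m + 2)"
  have "real_of_int (m - 1) * rw1 (Suc n) (m - 1) = (real n + 1) / 2 * (rw1 n (m - 2) - rw1 n m)"
    "real_of_int (m + 1) * rw1 (Suc n) (m + 1) = (real n + 1) / 2 * (rw1 n m - rw1 n (m + 2))"
    using Suc[of "m - 1"] Suc[of "m + 1"] by (simp_all add: algebra_simps)
  then have 1: "real_of_int (m - 1) * rw1 (Suc n) (m - 1) + real_of_int (m + 1) * rw1 (Suc n) (m + 1)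
      = (real n + 1) / 2 * ?D"
    by (simp only: flip: distrib_left) simp
  have 2: "rw1 (Suc n) (m - 1) - rw1 (Suc n) (m + 1) = ?D / 2"
    by (simp add: field_simps)
  have "real_of_int m * rw1 (Suc (Suc n)) m
      = (real_of_int (m - 1) * rw1 (Suc n) (m - 1) + real_of_int (m + 1) * rw1 (Suc n) (m + 1)) / 2
        + (rw1 (Suc n) (m - 1) - rw1 (Suc n) (m + 1)) / 2"
    unfolding rw1.simps(2)[of "Suc n"]
    by (simp add: field_simps del: rw1.simps)
  also have "\<dots> = (real n + 2) / 4 * ?D"
    unfolding 1 2 by (simp add: field_simps)
  also have "\<dots> = (real (Suc n) + 1) / 2 * (rw1 (Suc n) (m - 1) - rw1 (Suc n) (m + 1))"
    unfolding 2 by (simp add: field_simps)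
  finally show ?case .
qed

lemma rw1_antimono_step: "0 \<le> m \<Longrightarrow> rw1 n (m + 2) \<le> rw1 n m"
proof -
  assume m: "0 \<le> m"
  have "0 \<le> real_of_int (m + 1) * rw1 (Suc n) (m + 1)"
    using m by (intro mult_nonneg_nonneg rw1_nonneg) auto
  also have "\<dots> = (real n + 1) / 2 * (rw1 n m - rw1 n (m + 2))"
    using rw1_ballot[of "m + 1" n] by (simp add: algebra_simps)
  finally show ?thesis
    by (simp add: zero_le_mult_iff)
qed

text \<open>The central binomial probability \<open>binom (2 k) k / 4^k\<close>.\<close>

definition cbin :: "nat \<Rightarrow> real" where "cbin k = rw1 (2 * k) 0"

lemma cbin_nonneg: "0 \<le> cbin k"
  by (simp add: cbin_def rw1_nonneg)

text \<open>At position 1 the ballot identity and the one-step recursion are two linear equations in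
  the time-\<open>2 k\<close> values at 0 and 2; eliminating the value at 2 leaves the
  ratio.\<close>

lemma cbin_Suc: "cbin (Suc k) = (2 * real k + 1) / (2 * real k + 2) * cbin k"
proof -
  have "rw1 (Suc (2 * k)) 1 = (2 * real k + 1) / 2 * (rw1 (2 * k) 0 - rw1 (2 * k) 2)"
    using rw1_ballot[of 1 "2 * k"] by simp
  moreover have "rw1 (Suc (2 * k)) 1 = (rw1 (2 * k) 0 + rw1 (2 * k) 2) / 2"
    by simp
  moreover have "cbin (Suc k) = rw1 (Suc (2 * k)) 1"
    using rw1_uminus[of "Suc (2 * k)" 1] by (simp add: cbin_def del: rw1.simps(2)) (simp add: rw1_uminus)
  ultimately show ?thesis
    unfolding cbin_def by (simp add: field_simps)
qed

lemma rw1_even_le: "even n \<Longrightarrow> rw1 n m \<le> rw1 n 0"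
proof -
  assume n: "even n"
  have "rw1 n (2 * int j) \<le> rw1 n 0" for j
  proof (induction j)
    case (Suc j)
    then show ?case using rw1_antimono_step[of "2 * int j" n] by (simp add: algebra_simps)
  qed simp
  moreover have "\<exists>j. \<bar>m\<bar> = 2 * int j" if "even m"
    using that by (metis abs_ge_zero dvd_abs_iff dvdE int_nat_eq zero_le_mult_iff zero_less_numeral nat_0_le not_less)
  ultimately show ?thesis
    using rw1_abs[of n m] rw1_odd[of n m] n rw1_nonneg[of n 0]
    by (metis even_add even_of_nat)
qed

lemma rw1_le_cbin: "rw1 n m \<le> cbin (n div 2)"
proof (cases "even n")
  case True
  then show ?thesis using rw1_even_le[of n m] by (simp add: cbin_def)
next
  case False
  then obtain k where n: "n = Suc (2 * k)" by (auto elim: oddE)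
  show ?thesis
    using rw1_even_le[of "2 * k" "m - 1"] rw1_even_le[of "2 * k" "m + 1"] by (simp add: n cbin_def)
qed

text \<open>A fair sign is sub-Gaussian. This is Hoeffding's estimate with probability 1/2, after
  factoring \<open>exp (- y)\<close> out of \<open>cosh y\<close>; the estimate covers
  \<open>y \<ge> 0\<close> and evenness does the rest.\<close>

lemma cosh_le_exp_sq: "cosh (x::real) \<le> exp (x\<^sup>2 / 2)"
proof -
  have *: "cosh y \<le> exp (y\<^sup>2 / 2)" if "0 \<le> y" for y :: real
  proof -
    have "cosh y > 0" by simp
    have eq: "cosh y = exp (- y) * (1 + (exp (2 * y) - 1) / 2)"
      by (simp add: cosh_def field_simps flip: exp_add)
    have "ln (cosh y) = - y + ln (1 + (exp (2 * y) - 1) / 2)"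
      unfolding eq using that by (subst ln_mult) (auto simp: add_nonneg_eq_0_iff intro!: add_pos_nonneg)
    also have "\<dots> \<le> y\<^sup>2 / 2"
      using Hoeffdings_lemma_aux[of "2 * y" "1 / 2"] that by (simp add: power_mult_distrib)
    finally show ?thesis
      using \<open>cosh y > 0\<close> by (metis exp_le_cancel_iff exp_ln)
  qed
  show ?thesis
    using *[of "\<bar>x\<bar>"] by simp
qed

lemma rw1_chernoff: "rw1 n m \<le> exp (- (a * m)) * cosh a ^ n"
proof (induction n arbitrary: m)
  case (Suc n)
  have "rw1 (Suc n) m \<le> (exp (- (a * (m - 1))) * cosh a ^ n + exp (- (a * (m + 1))) * cosh a ^ n) / 2"
    using Suc[of "m - 1"] Suc[of "m + 1"] by simp
  also have "\<dots> = exp (- (a * m)) * cosh a ^ n * ((exp a + exp (- a)) / 2)"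
    by (simp add: algebra_simps exp_add exp_diff exp_minus divide_simps)
  also have "(exp a + exp (- a)) / 2 = cosh a"
    by (simp add: cosh_def)
  finally show ?case by (simp add: mult_ac)
qed simp

lemma rw1_tail:
  assumes "0 < n"
  shows "rw1 n m \<le> exp (- ((real_of_int m)\<^sup>2 / (2 * real n)))"
proof -
  \<comment> \<open>The minimiser of \<open>- l m + n l^2 / 2\<close>; it also serves negative
    \<open>m\<close>.\<close>
  let ?l = "real_of_int m / real n"
  have "rw1 n m \<le> exp (- (?l * m)) * cosh ?l ^ n"
    by (rule rw1_chernoff)
  also have "\<dots> \<le> exp (- (?l * m)) * exp (?l\<^sup>2 / 2) ^ n"
    by (intro mult_left_mono power_mono cosh_le_exp_sq) auto
  also have "\<dots> = exp (- (?l * m) + real n * (?l\<^sup>2 / 2))"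
    by (simp only: exp_add exp_of_nat_mult)
  also have "- (?l * m) + real n * (?l\<^sup>2 / 2) = - ((real_of_int m)\<^sup>2 / (2 * real n))"
    using assms by (simp add: field_simps power2_eq_square)
  finally show ?thesis .
qed

text \<open>Both sides obey the same recursion, so \<open>(2 k + 1) (cbin k)^2\<close> is the
  inverse of a partial Wallis product. This is the only source of \<open>pi\<close>, hence of
  \<open>g = 2 / pi\<close>.\<close>

lemma cbin_sq_wallis: "(2 * real k + 1) * (cbin k)\<^sup>2 = inverse (\<Prod>i=1..k. (4 * real i ^ 2) / (4 * real i ^ 2 - 1))"
proof (induction k)
  case 0
  then show ?case by (simp add: cbin_def)
next
  case (Suc k)
  let ?i = "real k + 1"
  have nz: "4 * ?i\<^sup>2 - 1 = (2 * real k + 1) * (2 * real k + 3)"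
    by (simp add: power2_eq_square algebra_simps)
  have "(2 * real (Suc k) + 1) * (cbin (Suc k))\<^sup>2
      = (2 * real k + 3) * ((2 * real k + 1) / (2 * real k + 2))\<^sup>2 * (cbin k)\<^sup>2"
    unfolding cbin_Suc power_mult_distrib by simp
  also have "\<dots> = ((2 * real k + 1) * (2 * real k + 3) / (4 * ?i\<^sup>2)) * ((2 * real k + 1) * (cbin k)\<^sup>2)"
    by (simp add: field_simps power2_eq_square)
  also have "\<dots> = inverse ((4 * ?i\<^sup>2) / (4 * ?i\<^sup>2 - 1)) * ((2 * real k + 1) * (cbin k)\<^sup>2)"
    unfolding nz by (simp add: field_simps)
  finally show ?case
    unfolding Suc inverse_mult_distrib[symmetric] by (simp add: mult.commute add.commute)
qed

lemma cbin_sq_tendsto: "(\<lambda>k. (2 * real k + 1) * (cbin k)\<^sup>2) \<longlonglongrightarrow> 2 / pi"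
proof -
  have "(\<lambda>n. inverse (\<Prod>k=1..n. (4*real k^2) / (4*real k^2 - 1))) \<longlonglongrightarrow> inverse (pi / 2)"
    by (intro tendsto_inverse wallis) simp
  then show ?thesis by (simp add: cbin_sq_wallis)
qed

text \<open>The sequence decreases to its Wallis limit, so the limit bounds every term. With the
  factor \<open>k\<close> in place of \<open>2 k + 1\<close> the sequence increases instead, which
  gives the matching upper bound next; both hold for every \<open>k\<close>, not only
  asymptotically.\<close>

lemma cbin_sq_lower: "2 / pi \<le> (2 * real k + 1) * (cbin k)\<^sup>2"
proof (rule decseq_ge[OF _ cbin_sq_tendsto])
  show "decseq (\<lambda>k. (2 * real k + 1) * (cbin k)\<^sup>2)"
  proof (rule decseq_SucI)
    fix k
    have "(2 * real (Suc k) + 1) * (cbin (Suc k))\<^sup>2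
        = (2 * real k + 3) * (2 * real k + 1) / (2 * real k + 2)\<^sup>2 * ((2 * real k + 1) * (cbin k)\<^sup>2)"
      by (simp add: cbin_Suc power_mult_distrib field_simps power2_eq_square)
    moreover have "(2 * real k + 3) * (2 * real k + 1) \<le> (2 * real k + 2)\<^sup>2"
      by (simp add: power2_eq_square algebra_simps)
    then have "(2 * real k + 3) * (2 * real k + 1) / (2 * real k + 2)\<^sup>2 * ((2 * real k + 1) * (cbin k)\<^sup>2)
        \<le> 1 * ((2 * real k + 1) * (cbin k)\<^sup>2)"
      by (intro mult_right_mono) (simp_all add: add_nonneg_eq_0_iff)
    ultimately show "(2 * real (Suc k) + 1) * (cbin (Suc k))\<^sup>2 \<le> (2 * real k + 1) * (cbin k)\<^sup>2"
      by simp
  qed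
qed

lemma cbin_sq_upper: "real k * (cbin k)\<^sup>2 \<le> 1 / pi"
proof (rule incseq_le[where X = "\<lambda>k. real k * (cbin k)\<^sup>2"])
  show "incseq (\<lambda>k. real k * (cbin k)\<^sup>2)"
  proof (rule incseq_SucI)
    fix k
    have "real k * (2 * real k + 2)\<^sup>2 \<le> real (Suc k) * (2 * real k + 1)\<^sup>2"
      by (simp add: power2_eq_square algebra_simps)
    then have "real k \<le> real (Suc k) * ((2 * real k + 1) / (2 * real k + 2))\<^sup>2"
      by (simp add: power_divide divide_simps)
    then have "real k * (cbin k)\<^sup>2 \<le> real (Suc k) * ((2 * real k + 1) / (2 * real k + 2))\<^sup>2 * (cbin k)\<^sup>2"
      by (intro mult_right_mono) auto
    then show "real k * (cbin k)\<^sup>2 \<le> real (Suc k) * (cbin (Suc k))\<^sup>2"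
      unfolding cbin_Suc power_mult_distrib by (simp only: mult.assoc)
  qed
  have "(\<lambda>k. (real k / (2 * real k + 1)) * ((2 * real k + 1) * (cbin k)\<^sup>2)) \<longlonglongrightarrow> 1 / 2 * (2 / pi)"
    by (intro tendsto_mult cbin_sq_tendsto) real_asymp
  moreover have "(real k / (2 * real k + 1)) * ((2 * real k + 1) * (cbin k)\<^sup>2) = real k * (cbin k)\<^sup>2" for k
    by (simp add: add_nonneg_eq_0_iff)
  ultimately show "(\<lambda>k. real k * (cbin k)\<^sup>2) \<longlonglongrightarrow> 1 / pi"
    by simp
qed

text \<open>By the ballot identity a move from \<open>2 j\<close> to \<open>2 j + 2\<close> lowers
  the kernel by at most \<open>2 (2 j + 1) / (n + 1)\<close> times its maximum, and the odd numbers
  add up to \<open>j^2\<close>.\<close>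

lemma rw1_lower_even:
  assumes "even n"
  shows "cbin (n div 2) * (1 - 2 * (real j)\<^sup>2 / (real n + 1)) \<le> rw1 n (2 * int j)"
proof (induction j)
  case 0
  show ?case using assms by (simp add: cbin_def)
next
  case (Suc j)
  have "(2 * real j + 1) * rw1 (Suc n) (2 * int j + 1)
      = (real n + 1) / 2 * (rw1 n (2 * int j) - rw1 n (2 * int (Suc j)))"
    using rw1_ballot[of "2 * int j + 1" n] by (simp add: algebra_simps)
  then have "rw1 n (2 * int j) - rw1 n (2 * int (Suc j))
      = 2 * (2 * real j + 1) / (real n + 1) * rw1 (Suc n) (2 * int j + 1)"
    by (simp add: field_simps del: rw1.simps)
  also have "\<dots> \<le> 2 * (2 * real j + 1) / (real n + 1) * cbin (n div 2)"
    using rw1_le_cbin[of "Suc n" "2 * int j + 1"] assms by (intro mult_left_mono) auto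
  finally have "rw1 n (2 * int (Suc j)) \<ge> cbin (n div 2) * (1 - 2 * (real j)\<^sup>2 / (real n + 1))
      - 2 * (2 * real j + 1) / (real n + 1) * cbin (n div 2)"
    using Suc by linarith
  also have "cbin (n div 2) * (1 - 2 * (real j)\<^sup>2 / (real n + 1))
      - 2 * (2 * real j + 1) / (real n + 1) * cbin (n div 2)
      = cbin (n div 2) * (1 - 2 * (real (Suc j))\<^sup>2 / (real n + 1))"
    by (simp add: right_diff_distrib power2_eq_square add_divide_distrib algebra_simps)
  finally show ?case .
qed

lemma rw1_lower_even':
  assumes "even n" "even m"
  shows "cbin (n div 2) * (1 - (real_of_int m)\<^sup>2 / (2 * (real n + 1))) \<le> rw1 n m"
proof -
  obtain j where j: "\<bar>m\<bar> = 2 * int j"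
    using assms by (metis abs_ge_zero dvd_abs_iff dvdE zero_le_mult_iff zero_less_numeral nat_0_le not_less)
  have "(real_of_int m)\<^sup>2 = (real_of_int \<bar>m\<bar>)\<^sup>2" by simp
  also have "\<dots> = 4 * (real j)\<^sup>2" by (simp add: j power_mult_distrib)
  finally show ?thesis
    using rw1_lower_even[OF assms(1), of j] rw1_abs[of n m] by (simp add: j mult.commute[of 2] del: distrib_right_numeral distrib_left_numeral flip: mult.assoc)
qed

text \<open>At odd times the kernel is the mean of two even-time values at positions shifted by one;
  this is why \<open>s + 1\<close> appears in the bound for both parities.\<close>

lemma rw1_lower:
  assumes "even (int n + m)" "0 < n" "\<bar>real_of_int m\<bar> \<le> s"
  shows "cbin (n div 2) * (1 - (s + 1)\<^sup>2 / (2 * real n)) \<le> rw1 n m"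
proof (cases "even n")
  case True
  have "cbin (n div 2) * (1 - (s + 1)\<^sup>2 / (2 * real n))
      \<le> cbin (n div 2) * (1 - (real_of_int m)\<^sup>2 / (2 * (real n + 1)))"
    using assms(2,3)
    by (intro mult_left_mono diff_left_mono frac_le abs_le_square_iff[THEN iffD1] cbin_nonneg) auto
  also have "\<dots> \<le> rw1 n m"
    using assms(1) True by (intro rw1_lower_even') auto
  finally show ?thesis .
next
  case False
  then obtain k where n: "n = Suc (2 * k)" by (auto elim: oddE)
  have sq: "(real_of_int (m + i))\<^sup>2 \<le> (s + 1)\<^sup>2" if "\<bar>i\<bar> = 1" for i
    using assms(3) that by (intro abs_le_square_iff[THEN iffD1]) auto
  have "cbin k * (1 - (s + 1)\<^sup>2 / (2 * real n)) \<le> rw1 (2 * k) (m + i)" if "\<bar>i\<bar> = 1" for i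
  proof -
    have "odd m" using assms(1) n by auto
    moreover have "odd i" using that by presburger
    ultimately have "even (m + i)" by auto
    have "cbin k * (1 - (s + 1)\<^sup>2 / (2 * real n)) \<le> cbin k * (1 - (real_of_int (m + i))\<^sup>2 / (2 * (real (2 * k) + 1)))"
      using sq[OF that] by (intro mult_left_mono diff_left_mono frac_le cbin_nonneg) (auto simp: n)
    also have "\<dots> \<le> rw1 (2 * k) (m + i)"
      using rw1_lower_even'[of "2 * k" "m + i"] \<open>even (m + i)\<close> by simp
    finally show ?thesis .
  qed
  from this[of 1] this[of "- 1"] have "2 * (cbin k * (1 - (s + 1)\<^sup>2 / (2 * real n))) \<le> 2 * rw1 n m"
    by (simp add: n)
  then show ?thesis by (simp add: n del: rw1.simps)
qed

text \<open>In the rotated coordinates \<open>x_1 + x_2\<close> and \<open>x_1 - x_2\<close> planar simple random walk is a pair of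
  independent one-dimensional walks.\<close>

definition rw2 :: "nat \<Rightarrow> site \<Rightarrow> site \<Rightarrow> real" where
  "rw2 n x y = rw1 n ((fst x - fst y) + (snd x - snd y)) * rw1 n ((fst x - fst y) - (snd x - snd y))"

lemma sum_nbrs:
  "(\<Sum>z\<in>nbrs x. f z) = f (fst x + 1, snd x) + f (fst x - 1, snd x) + f (fst x, snd x + 1) + f (fst x, snd x - 1)"
  for f :: "site \<Rightarrow> 'b::comm_monoid_add"
  unfolding nbrs_def by (simp add: add.assoc)

lemma finite_nbrs [simp]: "finite (nbrs x)"
  by (simp add: nbrs_def)

lemma nbrs_sym: "z \<in> nbrs x \<longleftrightarrow> x \<in> nbrs z"
  by (cases x; cases z) (auto simp: nbrs_def)

lemma rw2_Suc: "rw2 (Suc n) x y = (\<Sum>z\<in>nbrs x. rw2 n z y) / 4"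
  by (simp add: rw2_def sum_nbrs algebra_simps)

lemma rw2_nonneg: "0 \<le> rw2 n x y"
  by (simp add: rw2_def rw1_nonneg)

lemma rw2_0: "rw2 0 x y = (if x = y then 1 else 0)"
  by (cases x; cases y) (auto simp: rw2_def)

definition sdist :: "site \<Rightarrow> site \<Rightarrow> real" where
  "sdist x y = real_of_int (max \<bar>fst x - fst y\<bar> \<bar>snd x - snd y\<bar>)"

lemma rw1_le_1: "rw1 n m \<le> 1"
proof (induction n arbitrary: m)
  case (Suc n)
  have "rw1 n (m - 1) \<le> 1" "rw1 n (m + 1) \<le> 1" by (rule Suc)+
  then show ?case by simp
qed simp

lemma rw2_le_cbin:
  "rw2 n x y \<le> (if even (int n + (fst x - fst y) + (snd x - snd y)) then (cbin (n div 2))\<^sup>2 else 0)"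
proof (cases "even (int n + (fst x - fst y) + (snd x - snd y))")
  case True
  then show ?thesis
    unfolding rw2_def power2_eq_square
    by (auto intro!: mult_mono rw1_le_cbin rw1_nonneg cbin_nonneg)
next
  case False
  then show ?thesis
    unfolding rw2_def by (auto simp: rw1_odd algebra_simps)
qed

text \<open>One of the rotated coordinates is at least as large in modulus as the sup-norm distance;
  that factor carries the tail, and the other is at most 1.\<close>

lemma rw2_tail:
  assumes "0 < n" "d \<le> sdist x y" "0 \<le> d"
  shows "rw2 n x y \<le> exp (- (d\<^sup>2 / (2 * real n)))"
proof -
  let ?a = "fst x - fst y" and ?b = "snd x - snd y"
  have *: "rw1 n m \<le> exp (- (d\<^sup>2 / (2 * real n)))" if "d \<le> \<bar>real_of_int m\<bar>" for m
  proof -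
    have "rw1 n m \<le> exp (- ((real_of_int m)\<^sup>2 / (2 * real n)))"
      using assms(1) by (rule rw1_tail)
    also have "\<dots> \<le> exp (- (d\<^sup>2 / (2 * real n)))"
      using that assms by (auto intro!: divide_right_mono abs_le_square_iff[THEN iffD1])
    finally show ?thesis .
  qed
  have "d \<le> \<bar>real_of_int (?a + ?b)\<bar> \<or> d \<le> \<bar>real_of_int (?a - ?b)\<bar>"
    using assms(2) unfolding sdist_def by (auto simp: max_def abs_if split: if_splits)
  then show ?thesis
  proof
    assume "d \<le> \<bar>real_of_int (?a + ?b)\<bar>"
    then have "rw2 n x y \<le> exp (- (d\<^sup>2 / (2 * real n))) * 1"
      unfolding rw2_def by (intro mult_mono * rw1_le_1 rw1_nonneg) auto
    then show ?thesis by simp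
  next
    assume "d \<le> \<bar>real_of_int (?a - ?b)\<bar>"
    then have "rw2 n x y \<le> 1 * exp (- (d\<^sup>2 / (2 * real n)))"
      unfolding rw2_def by (intro mult_mono * rw1_le_1 rw1_nonneg) auto
    then show ?thesis by simp
  qed
qed

text \<open>The product of the two one-dimensional bounds, using
  \<open>1 - 2 z \<le> (1 - z)^2\<close>. For \<open>z > 1\<close> the factors could both be
  negative, but then the claimed bound is negative as well.\<close>

lemma rw2_lower:
  assumes "even (int n + (fst x - fst y) + (snd x - snd y))" "0 < n" "sdist x y \<le> r"
  shows "(cbin (n div 2))\<^sup>2 * (1 - (2 * r + 1)\<^sup>2 / real n) \<le> rw2 n x y"
proof -
  let ?a = "fst x - fst y" and ?b = "snd x - snd y"
  let ?z = "(2 * r + 1)\<^sup>2 / (2 * real n)"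
  have r: "\<bar>real_of_int (?a + ?b)\<bar> \<le> 2 * r" "\<bar>real_of_int (?a - ?b)\<bar> \<le> 2 * r"
    using assms(3) unfolding sdist_def by (auto simp: max_def abs_if split: if_splits)
  have 1: "cbin (n div 2) * (1 - ?z) \<le> rw1 n (?a + ?b)"
    using assms r by (intro rw1_lower) (auto simp: add.assoc)
  have "even (int n + (?a - ?b))"
    using assms(1) by presburger
  then have 2: "cbin (n div 2) * (1 - ?z) \<le> rw1 n (?a - ?b)"
    using assms r by (intro rw1_lower) auto
  have z: "(2 * r + 1)\<^sup>2 / real n = 2 * ?z" by simp
  show ?thesis
  proof (cases "?z \<le> 1")
    case True
    have "1 - 2 * ?z \<le> (1 - ?z)\<^sup>2"
      by (simp add: power2_diff)
    then have "(cbin (n div 2))\<^sup>2 * (1 - 2 * ?z) \<le> (cbin (n div 2))\<^sup>2 * (1 - ?z)\<^sup>2"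
      by (intro mult_left_mono) auto
    also have "\<dots> = (cbin (n div 2) * (1 - ?z)) * (cbin (n div 2) * (1 - ?z))"
      by (simp add: power2_eq_square)
    also have "\<dots> \<le> rw2 n x y"
      unfolding rw2_def using True by (intro mult_mono 1 2 mult_nonneg_nonneg cbin_nonneg rw1_nonneg) auto
    finally show ?thesis by (simp only: z)
  next
    case False
    then have "(cbin (n div 2))\<^sup>2 * (1 - 2 * ?z) \<le> 0"
      by (intro mult_nonneg_nonpos) auto
    also have "0 \<le> rw2 n x y" by (rule rw2_nonneg)
    finally show ?thesis by (simp only: z)
  qed
qed

section \<open>The walk killed on leaving the interior\<close>

abbreviation "kw \<equiv> killed_walk"

lemma kw_nonneg: "0 \<le> kw N n x y"
  by (induction n arbitrary: x) (auto intro!: sum_nonneg)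

lemma kw_le_rw2: "kw N n x y \<le> rw2 n x y"
proof (induction n arbitrary: x)
  case (Suc n)
  have "(\<Sum>z\<in>nbrs x. kw N n z y) \<le> (\<Sum>z\<in>nbrs x. rw2 n z y)"
    by (intro sum_mono Suc)
  then show ?case
    using rw2_nonneg[of "Suc n" x y] by (simp add: rw2_Suc)
qed (simp add: rw2_0)

lemma kw_outside1: "x \<notin> intVN N \<Longrightarrow> kw N n x y = 0"
  by (cases n) auto

lemma kw_outside2: "y \<notin> intVN N \<Longrightarrow> kw N n x y = 0"
  by (induction n arbitrary: x) auto

lemma intVN_eq: "intVN N = {2..int N - 1} \<times> {2..int N - 1}"
  unfolding intVN_def bdryVN_def VN_def nbrs_def by auto

lemma finite_intVN [simp]: "finite (intVN N)"
  by (simp add: intVN_eq)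

text \<open>The definition decomposes at the first step; decomposing at the last one gives symmetry,
  and later the equation that the Green function solves in its second argument.\<close>

lemma kw_Suc2: "kw N (Suc n) x y = (if y \<in> intVN N then (\<Sum>z\<in>nbrs y. kw N n x z) / 4 else 0)"
proof (induction n arbitrary: x)
  case 0
  show ?case
    by (cases x; cases y) (auto simp: sum_nbrs)
next
  case (Suc n)
  show ?case
  proof (cases "x \<in> intVN N \<and> y \<in> intVN N")
    case True
    have "kw N (Suc (Suc n)) x y = (\<Sum>w\<in>nbrs x. \<Sum>z\<in>nbrs y. kw N n w z) / 16"
      using True by (subst killed_walk.simps(2), subst Suc) (simp add: sum_divide_distrib)
    also have "\<dots> = (\<Sum>z\<in>nbrs y. kw N (Suc n) x z) / 4"
      using True by (subst sum.swap) (simp add: sum_divide_distrib)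
    finally show ?thesis using True by simp
  next
    case False
    then show ?thesis
      using kw_outside2[of y N "Suc (Suc n)" x] kw_outside1[of x N] by auto
  qed
qed

lemma kw_sym: "kw N n x y = kw N n y x"
proof (induction n arbitrary: x)
  case (Suc n)
  show ?case
    by (subst kw_Suc2) (simp add: Suc)
qed auto

lemma kw_add: "(\<Sum>z\<in>intVN N. kw N m x z * kw N n z y) = kw N (m + n) x y"
proof (induction m arbitrary: x)
  case 0
  have "(\<Sum>z\<in>intVN N. kw N 0 x z * kw N n z y) = (\<Sum>z\<in>intVN N. if x = z then kw N n z y else 0)"
    by (intro sum.cong) auto
  then show ?case by (simp add: kw_outside1)
next
  case (Suc m)
  have "(\<Sum>z\<in>intVN N. kw N (Suc m) x z * kw N n z y)
     = (if x \<in> intVN N then (\<Sum>w\<in>nbrs x. \<Sum>z\<in>intVN N. kw N m w z * kw N n z y) / 4 else 0)"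
    by (subst sum.swap) (simp add: sum_distrib_right sum_divide_distrib)
  then show ?case by (simp add: Suc)
qed

text \<open>A walk from \<open>x\<close> leaves the box through one of its four sides; \<open>bar\<close> adds up the corresponding
  Chernoff bounds and dominates the mass lost by killing.\<close>

definition bar :: "real \<Rightarrow> nat \<Rightarrow> site \<Rightarrow> real" where
  "bar a N x = exp (- (a * (real_of_int (fst x) - 1))) + exp (- (a * (real N - real_of_int (fst x))))
      + exp (- (a * (real_of_int (snd x) - 1))) + exp (- (a * (real N - real_of_int (snd x))))"

text \<open>Each of the four exponentials depends on one coordinate only: half of the neighbours
  leave it unchanged and the other half multiply it by \<open>cosh a\<close> on average.\<close>

lemma bar_avg: "(\<Sum>z\<in>nbrs x. bar a N z) / 4 \<le> cosh a * bar a N x"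
proof -
  have e1: "exp (- (a * (d + 1 - 1))) + exp (- (a * (d - 1 - 1))) = 2 * cosh a * exp (- (a * (d - 1)))"
    and e2: "exp (- (a * (M - (d + 1)))) + exp (- (a * (M - (d - 1)))) = 2 * cosh a * exp (- (a * (M - d)))"
    for d M :: real
    by (simp_all add: cosh_def algebra_simps flip: exp_add)
  have "(\<Sum>z\<in>nbrs x. bar a N z) / 4 = (cosh a + 1) / 2 * bar a N x"
    unfolding sum_nbrs bar_def fst_conv snd_conv of_int_add of_int_diff of_int_1
    using e1[of "real_of_int (fst x)"] e1[of "real_of_int (snd x)"]
      e2[of "real N" "real_of_int (fst x)"] e2[of "real N" "real_of_int (snd x)"]
    by argo
  also have "\<dots> \<le> cosh a * bar a N x"
  proof (rule mult_right_mono)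
    show "(cosh a + 1) / 2 \<le> cosh a"
      using cosh_real_ge_1[of a] by simp
  qed (simp add: bar_def)
  finally show ?thesis .
qed

lemma bar_outside:
  assumes "x \<notin> intVN N" "0 \<le> a"
  shows "1 \<le> bar a N x"
proof -
  have 1: "1 \<le> exp (- (a * d))" if "d \<le> 0" for d
    using that assms(2) by (simp add: mult_nonneg_nonpos)
  have pos: "0 \<le> exp (t::real)" for t by simp
  consider "real_of_int (fst x) - 1 \<le> 0" | "real N - real_of_int (fst x) \<le> 0"
    | "real_of_int (snd x) - 1 \<le> 0" | "real N - real_of_int (snd x) \<le> 0"
    using assms(1) unfolding intVN_eq by (cases x) force
  then show ?thesis
    unfolding bar_def by cases (use 1 in \<open>(smt (verit) pos)+\<close>)
qed

text \<open>A maximum principle in space-time: \<open>bar * cosh^n\<close> is a supersolution of the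
  free heat equation and is at least 1 off the interior, so it dominates the difference of the free
  and the killed kernel.\<close>

lemma rw2_le_kw_bar:
  assumes a: "0 \<le> a"
  shows "rw2 n x y \<le> kw N n x y + bar a N x * cosh a ^ n"
proof (induction n arbitrary: x)
  case 0
  show ?case
    using bar_outside[OF _ a, of x N] by (auto simp: rw2_0 bar_def)
next
  case (Suc n)
  show ?case
  proof (cases "x \<in> intVN N")
    case True
    have "rw2 (Suc n) x y \<le> (\<Sum>z\<in>nbrs x. kw N n z y + bar a N z * cosh a ^ n) / 4"
      unfolding rw2_Suc by (intro divide_right_mono sum_mono Suc) auto
    also have "\<dots> = kw N (Suc n) x y + (\<Sum>z\<in>nbrs x. bar a N z) / 4 * cosh a ^ n"
      using True by (simp add: sum.distrib sum_distrib_right add_divide_distrib)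
    also have "\<dots> \<le> kw N (Suc n) x y + cosh a * bar a N x * cosh a ^ n"
      by (intro add_left_mono mult_right_mono bar_avg) auto
    finally show ?thesis by (simp add: mult_ac)
  next
    case False
    have "rw2 (Suc n) x y \<le> 1 * 1"
      unfolding rw2_def by (intro mult_mono rw1_le_1 rw1_nonneg) auto
    also have "\<dots> \<le> bar a N x * cosh a ^ Suc n"
      using bar_outside[OF False a] cosh_real_ge_1[of a] by (intro mult_mono one_le_power) (auto simp: bar_def)
    finally show ?thesis
      using kw_nonneg[of N "Suc n" x y] by linarith
  qed
qed

text \<open>Sup-norm distance to the boundary for points of \<open>VN N\<close>, and negative off
  \<open>VN N\<close>, so a nonnegative lower bound on it also confines the point to the
  box.\<close>

definition depth :: "nat \<Rightarrow> site \<Rightarrow> real" where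
  "depth N x = min (min (real_of_int (fst x) - 1) (real N - real_of_int (fst x)))
     (min (real_of_int (snd x) - 1) (real N - real_of_int (snd x)))"

lemma kw_lower:
  assumes "R \<le> depth N x" "0 \<le> R" "0 < n"
  shows "rw2 n x y - 4 * exp (- (R\<^sup>2 / (2 * real n))) \<le> kw N n x y"
proof -
  \<comment> \<open>The minimiser of the Chernoff exponent \<open>- a R + n a^2 / 2\<close>.\<close>
  let ?a = "R / real n"
  have a: "0 \<le> ?a" using assms by simp
  have *: "exp (- (?a * d)) \<le> exp (- (?a * R))" if "R \<le> d" for d
    using mult_left_mono[OF that a] by simp
  have "bar ?a N x \<le> 4 * exp (- (?a * R))"
    using *[of "real_of_int (fst x) - 1"] *[of "real N - real_of_int (fst x)"]
      *[of "real_of_int (snd x) - 1"] *[of "real N - real_of_int (snd x)"] assms(1)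
    unfolding bar_def depth_def by linarith
  moreover have "cosh ?a ^ n \<le> exp (?a\<^sup>2 / 2) ^ n"
    by (intro power_mono cosh_le_exp_sq) auto
  ultimately have "bar ?a N x * cosh ?a ^ n \<le> 4 * exp (- (?a * R)) * exp (?a\<^sup>2 / 2) ^ n"
    by (intro mult_mono) auto
  also have "\<dots> = 4 * exp (- (?a * R) + real n * (?a\<^sup>2 / 2))"
    by (simp only: exp_add exp_of_nat_mult mult.assoc)
  also have "- (?a * R) + real n * (?a\<^sup>2 / 2) = - (R\<^sup>2 / (2 * real n))"
    using assms by (simp add: field_simps power2_eq_square)
  finally show ?thesis
    using rw2_le_kw_bar[OF a, of n x y N] by linarith
qed

text \<open>The one-step decay rate: a barrier of size at most \<open>2 N^2\<close> that drops by
  1/2 loses at least the fraction \<open>1 / (4 N^2)\<close>.\<close>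

definition rho :: "nat \<Rightarrow> real" where "rho N = 1 - 1 / (4 * (real N)\<^sup>2)"

lemma rho_nonneg: "0 \<le> rho N"
proof (cases "N = 0")
  case False
  then have "1 \<le> (real N)\<^sup>2" by simp
  then show ?thesis by (simp add: rho_def divide_le_eq)
qed (simp add: rho_def)

text \<open>The barrier is \<open>2 N^2 - x_1^2\<close>, whose average over the neighbours drops by 1/2.\<close>

lemma kw_decay: "kw N n x y \<le> 2 * rho N ^ n"
proof (cases "x \<in> intVN N")
  case x: True
  then have N: "3 \<le> N" by (auto simp: intVN_eq)
  let ?f = "\<lambda>x::site. 2 * (real N)\<^sup>2 - (real_of_int (fst x))\<^sup>2"
  note rho = rho_nonneg[of N]
  have f: "(real N)\<^sup>2 \<le> ?f z" if "1 \<le> fst z" "fst z \<le> int N" for z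
    using that by (simp add: power_mono)
  have "x \<in> intVN N \<Longrightarrow> kw N n x y \<le> ?f x / (real N)\<^sup>2 * rho N ^ n"
  proof (induction n arbitrary: x)
    case 0
    then have "(real N)\<^sup>2 \<le> ?f x" using f[of x] by (auto simp: intVN_eq)
    then have "1 \<le> ?f x / (real N)\<^sup>2" using N by (simp add: le_divide_eq)
    moreover have "kw N 0 x y \<le> 1" by simp
    ultimately show ?case unfolding power_0 mult_1_right by (rule order.trans[rotated])
  next
    case (Suc n)
    \<comment> \<open>A neighbour outside the interior is still in \<open>VN N\<close>; there the
      killed kernel is 0 and the barrier is nonnegative, so the bound persists.\<close>
    have *: "kw N n z y \<le> ?f z / (real N)\<^sup>2 * rho N ^ n" if "z \<in> nbrs x" for z
    proof (cases "z \<in> intVN N")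
      case False
      have "1 \<le> fst z" "fst z \<le> int N"
        using that Suc.prems by (auto simp: nbrs_def intVN_eq)
      then have "0 \<le> ?f z" using f[of z] by (smt (verit) zero_le_power2)
      then show ?thesis using rho False by (simp add: kw_outside1)
    qed (rule Suc.IH)
    have "kw N (Suc n) x y \<le> (\<Sum>z\<in>nbrs x. ?f z / (real N)\<^sup>2 * rho N ^ n) / 4"
    proof -
      have "(\<Sum>z\<in>nbrs x. kw N n z y) \<le> (\<Sum>z\<in>nbrs x. ?f z / (real N)\<^sup>2 * rho N ^ n)"
        by (rule sum_mono[OF *])
      then show ?thesis using Suc.prems by simp
    qed
    also have "\<dots> = (\<Sum>z\<in>nbrs x. ?f z) / 4 / (real N)\<^sup>2 * rho N ^ n"
      by (simp only: sum_distrib_right[symmetric] sum_divide_distrib[symmetric]) simp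
    also have "(\<Sum>z\<in>nbrs x. ?f z) / 4 = ?f x - 1 / 2"
      unfolding sum_nbrs by (simp add: power2_eq_square field_simps)
    also have "(?f x - 1 / 2) / (real N)\<^sup>2 * rho N ^ n \<le> (?f x * rho N) / (real N)\<^sup>2 * rho N ^ n"
    proof (intro mult_right_mono divide_right_mono)
      have "?f x / (4 * (real N)\<^sup>2) \<le> 1 / 2"
        using N by (simp add: divide_le_eq)
      then show "?f x - 1 / 2 \<le> ?f x * rho N"
        unfolding rho_def by (simp add: algebra_simps)
    qed (use rho in auto)
    finally show ?case by simp
  qed
  then have "kw N n x y \<le> ?f x / (real N)\<^sup>2 * rho N ^ n" using x by simp
  also have "\<dots> \<le> 2 * rho N ^ n"
    using N rho by (intro mult_right_mono) (auto simp: divide_le_eq)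
  finally show ?thesis .
next
  case False
  then show ?thesis by (simp add: kw_outside1 rho_nonneg)
qed

section \<open>Logarithmic asymptotics of the Green function and its tails\<close>

lemma rho_less_1: "1 \<le> N \<Longrightarrow> rho N < 1"
  by (simp add: rho_def)

lemma summable_kw: "summable (\<lambda>n. kw N n x y)"
proof (cases "1 \<le> N")
  case True
  have "summable (\<lambda>n. 2 * rho N ^ n)"
    using rho_less_1[OF True] rho_nonneg[of N] by (intro summable_mult summable_geometric) auto
  then show ?thesis
    by (rule summable_comparison_test'[where N = 0]) (simp add: kw_nonneg kw_decay)
next
  case False
  then have "kw N n x y = 0" for n by (intro kw_outside1) (auto simp: intVN_eq)
  then show ?thesis by simp
qed

lemma summable_kw_shift: "summable (\<lambda>n. kw N (n + m) x y)"
  using summable_kw by (subst summable_iff_shift)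

text \<open>\<open>tailG N m\<close> is the covariance of the field smoothed by the killed kernel at two times adding up
  to \<open>m\<close>; only its leading order \<open>g (1 - a) ln N\<close> for \<open>m = N^(2 a)\<close> will matter.\<close>

definition tailG :: "nat \<Rightarrow> nat \<Rightarrow> site \<Rightarrow> site \<Rightarrow> real" where
  "tailG N m x y = (\<Sum>n. kw N (n + m) x y)"

lemma greenN_tailG: "greenN N x y = tailG N 0 x y"
  by (simp add: greenN_def tailG_def)

lemma tailG_nonneg: "0 \<le> tailG N m x y"
  unfolding tailG_def by (intro suminf_nonneg summable_kw_shift kw_nonneg)

lemma tailG_sym: "tailG N m x y = tailG N m y x"
  unfolding tailG_def by (subst kw_sym) simp

lemma tailG_outside2: "y \<notin> intVN N \<Longrightarrow> tailG N m x y = 0"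
  by (simp add: tailG_def kw_outside2)

lemma tailG_split: "tailG N m x y = (\<Sum>n\<in>{m..<m + k}. kw N n x y) + tailG N (m + k) x y"
proof -
  have "tailG N m x y = (\<Sum>n. kw N (n + k + m) x y) + (\<Sum>n<k. kw N (n + m) x y)"
    unfolding tailG_def by (rule suminf_split_initial_segment[OF summable_kw_shift])
  moreover have "(\<Sum>n<k. kw N (n + m) x y) = (\<Sum>n\<in>{m..<m + k}. kw N n x y)"
    using sum.shift_bounds_nat_ivl[of "\<lambda>n. kw N n x y" 0 m k] by (simp add: atLeast0LessThan add.commute)
  ultimately show ?thesis
    by (simp add: tailG_def add_ac)
qed

lemma tailG_antimono: "m \<le> n \<Longrightarrow> tailG N n x y \<le> tailG N m x y"
  using tailG_split[of N m x y "n - m"] by (simp add: sum_nonneg kw_nonneg)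

lemma tailG_Suc: "tailG N m x y = kw N m x y + tailG N (Suc m) x y"
  using tailG_split[of N m x y 1] by simp

text \<open>Chapman-Kolmogorov summed over the later time. This identity turns covariances of
  smoothed fields into tails of the Green sum.\<close>

lemma kw_tailG: "(\<Sum>z\<in>intVN N. kw N m x z * tailG N n z y) = tailG N (m + n) x y"
proof -
  have "(\<Sum>z\<in>intVN N. kw N m x z * tailG N n z y) = (\<Sum>z\<in>intVN N. \<Sum>j. kw N m x z * kw N (j + n) z y)"
    unfolding tailG_def by (intro sum.cong refl suminf_mult[symmetric] summable_kw_shift)
  also have "\<dots> = (\<Sum>j. \<Sum>z\<in>intVN N. kw N m x z * kw N (j + n) z y)"
    by (intro suminf_sum[symmetric] summable_mult summable_kw_shift)
  also have "\<dots> = tailG N (m + n) x y"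
    by (simp add: kw_add tailG_def add_ac)
  finally show ?thesis .
qed

lemma tailG_tail:
  assumes "1 \<le> N"
  shows "tailG N m x y \<le> 8 * (real N)\<^sup>2 * exp (- (real m / (4 * (real N)\<^sup>2)))"
proof -
  have r: "rho N < 1" "0 \<le> rho N" using rho_less_1[OF assms] rho_nonneg by auto
  have s: "summable (\<lambda>n. 2 * rho N ^ (n + m))"
    unfolding power_add using r by (intro summable_mult summable_mult2 summable_geometric) auto
  have "tailG N m x y \<le> (\<Sum>n. 2 * rho N ^ (n + m))"
    unfolding tailG_def by (intro suminf_le summable_kw_shift kw_decay s)
  also have "\<dots> = 2 * rho N ^ m * (\<Sum>n. rho N ^ n)"
    using r by (subst suminf_mult[symmetric]) (auto simp: power_add mult_ac intro!: summable_geometric)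
  also have "\<dots> = 2 * rho N ^ m * (1 / (1 - rho N))"
    using r by (subst suminf_geometric) auto
  also have "\<dots> = 8 * (real N)\<^sup>2 * rho N ^ m"
    by (simp add: rho_def)
  also have "rho N ^ m \<le> exp (- (1 / (4 * (real N)\<^sup>2))) ^ m"
    using exp_ge_add_one_self[of "- (1 / (4 * (real N)\<^sup>2))"] r by (intro power_mono) (auto simp: rho_def)
  also have "\<dots> = exp (- (real m / (4 * (real N)\<^sup>2)))"
    by (simp flip: exp_of_nat_mult)
  finally show ?thesis by (simp add: mult_left_mono)
qed

text \<open>Exactly one of the times \<open>2 k\<close> and \<open>2 k + 1\<close> has the parity
  that the walk needs, so each \<open>k\<close> is counted once and the planar kernel sums to
  squares of return probabilities.\<close>

lemma sum_parity:
  fixes g :: "nat \<Rightarrow> real"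
  assumes "a \<le> b"
  shows "(\<Sum>n\<in>{2 * a..<2 * b}. if even (int n + u) then g (n div 2) else 0) = (\<Sum>k\<in>{a..<b}. g k)"
  using assms
proof (induction b rule: dec_induct)
  case (step b)
  have "(\<Sum>n\<in>{2 * a..<2 * Suc b}. if even (int n + u) then g (n div 2) else 0)
      = (\<Sum>n\<in>{2 * a..<2 * b}. if even (int n + u) then g (n div 2) else 0)
        + (if even (int (2 * b) + u) then g b else 0) + (if even (int (2 * b + 1) + u) then g b else 0)"
    using step by (simp add: sum.atLeastLessThan_Suc)
  also have "\<dots> = (\<Sum>k\<in>{a..<Suc b}. g k)"
    unfolding step.IH using step(1) by auto
  finally show ?case .
qed simp

section \<open>Logarithmic growth of sums of squared return probabilities\<close>

definition sumC :: "nat \<Rightarrow> nat \<Rightarrow> real" where "sumC a b = (\<Sum>k\<in>{a..<b}. (cbin k)\<^sup>2)"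

lemma sumC_upper_aux:
  assumes "1 \<le> a" "a \<le> b"
  shows "sumC a (Suc b) \<le> (1 + ln (real b) - ln (real a)) / pi"
  using assms(2)
proof (induction b rule: dec_induct)
  case base
  have "(cbin a)\<^sup>2 \<le> 1 / pi / real a"
    using cbin_sq_upper[of a] assms(1) by (simp add: le_divide_eq mult.commute)
  also have "\<dots> \<le> 1 / pi / 1"
    using assms(1) by (intro divide_left_mono) auto
  finally show ?case by (simp add: sumC_def)
next
  case (step b)
  have b: "0 < real b" using step(1) assms(1) by simp
  have "(cbin (Suc b))\<^sup>2 \<le> 1 / real (Suc b) / pi"
    using cbin_sq_upper[of "Suc b"] by (simp add: le_divide_eq divide_le_eq mult_ac)
  also have "1 / real (Suc b) \<le> ln (real (Suc b)) - ln (real b)"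
  proof -
    have "ln (real b / real (Suc b)) \<le> real b / real (Suc b) - 1"
      using b by (intro ln_le_minus_one) auto
    moreover have "ln (real b / real (Suc b)) = ln (real b) - ln (real (Suc b))"
      using b by (intro ln_divide_pos) auto
    moreover have "real b / real (Suc b) - 1 = - (1 / real (Suc b))"
      by (simp add: field_simps)
    ultimately show ?thesis by linarith
  qed
  finally have "(cbin (Suc b))\<^sup>2 \<le> (ln (real (Suc b)) - ln (real b)) / pi"
    by (simp add: divide_right_mono)
  with step show ?case
    by (simp add: sumC_def add_divide_distrib diff_divide_distrib)
qed

text \<open>The constant 2 covers the term \<open>k = 0\<close>, which equals 1, and the
  \<open>1 / pi\<close> from the first remaining term.\<close>

lemma sumC_upper:
  assumes "1 \<le> b" "a \<le> b"
  shows "sumC a b \<le> 2 + (ln (real b) - ln (real (max 1 a))) / pi"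
proof -
  have *: "sumC a' b \<le> 1 + (ln (real b) - ln (real a')) / pi" if "1 \<le> a'" "a' \<le> b" for a'
  proof -
    have "sumC a' b \<le> sumC a' (Suc b)"
      unfolding sumC_def using that by simp
    also have "\<dots> \<le> (1 + ln (real b) - ln (real a')) / pi"
      by (rule sumC_upper_aux[OF that])
    also have "\<dots> \<le> 1 + (ln (real b) - ln (real a')) / pi"
      using pi_gt3 by (simp add: add_divide_distrib diff_divide_distrib)
    finally show ?thesis .
  qed
  show ?thesis
  proof (cases "a = 0")
    case True
    have "sumC 0 b = 1 + sumC 1 b"
      unfolding sumC_def using assms(1) by (subst sum.atLeast_Suc_lessThan) (auto simp: cbin_def)
    then show ?thesis using *[of 1] assms True by simp
  next
    case False
    then show ?thesis using *[of a] assms by (simp add: max_def)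
  qed
qed

lemma sumC_lower: "(ln (real b + 1) - ln (real a + 1)) / pi \<le> sumC a b"
proof (cases "a \<le> b")
  case True
  then show ?thesis
  proof (induction b rule: dec_induct)
    case (step b)
    have "ln (real b + 2) - ln (real b + 1) = ln (1 + 1 / (real b + 1))"
      by (subst ln_divide_pos[symmetric]) (auto simp: field_simps)
    also have "\<dots> \<le> 1 / (real b + 1)"
      by (rule ln_add_one_self_le_self) simp
    also have "1 / (real b + 1) / pi \<le> (cbin b)\<^sup>2"
    proof -
      have "1 / (real b + 1) \<le> 2 / (2 * real b + 1)"
        by (simp add: field_simps)
      then have "1 / (real b + 1) / pi \<le> 2 / (2 * real b + 1) / pi"
        by (rule divide_right_mono) simp
      then have "1 / (real b + 1) / pi \<le> 2 / pi / (2 * real b + 1)"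
        by (simp only: divide_divide_eq_left mult.commute)
      also have "\<dots> \<le> (cbin b)\<^sup>2"
        using cbin_sq_lower[of b] by (simp add: divide_le_eq mult_ac)
      finally show ?thesis .
    qed
    finally have "(ln (real b + 2) - ln (real b + 1)) / pi \<le> (cbin b)\<^sup>2"
      by (simp add: divide_right_mono)
    with step show ?case
      by (simp add: sumC_def diff_divide_distrib add.commute)
  qed (simp add: sumC_def)
next
  case False
  then have "(ln (real b + 1) - ln (real a + 1)) / pi \<le> 0"
    by (simp add: divide_le_0_iff)
  also have "0 \<le> sumC a b" by (simp add: sumC_def sum_nonneg)
  finally show ?thesis .
qed

lemma tailG_upper:
  assumes N: "1 \<le> N" and b: "1 \<le> b" "m div 2 \<le> b"
  shows "tailG N m x y \<le> 2 + (ln (real b) - ln (real (max 1 (m div 2)))) / pi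
    + 8 * (real N)\<^sup>2 * exp (- (real b / (2 * (real N)\<^sup>2)))"
proof -
  let ?a = "m div 2"
  let ?u = "(fst x - fst y) + (snd x - snd y)"
  have "tailG N m x y \<le> tailG N (2 * ?a) x y"
    by (rule tailG_antimono) simp
  also have "\<dots> = (\<Sum>n\<in>{2 * ?a..<2 * b}. kw N n x y) + tailG N (2 * b) x y"
    using tailG_split[of N "2 * ?a" x y "2 * b - 2 * ?a"] b by simp
  also have "(\<Sum>n\<in>{2 * ?a..<2 * b}. kw N n x y)
      \<le> (\<Sum>n\<in>{2 * ?a..<2 * b}. if even (int n + ?u) then (cbin (n div 2))\<^sup>2 else 0)"
  proof (rule sum_mono)
    fix n
    show "kw N n x y \<le> (if even (int n + ?u) then (cbin (n div 2))\<^sup>2 else 0)"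
      using kw_le_rw2[of N n x y] rw2_le_cbin[of n x y] by (simp add: add.assoc)
  qed
  also have "\<dots> = sumC ?a b"
    unfolding sumC_def by (rule sum_parity) (rule b(2))
  also have "\<dots> \<le> 2 + (ln (real b) - ln (real (max 1 ?a))) / pi"
    by (rule sumC_upper[OF b])
  also have "tailG N (2 * b) x y \<le> 8 * (real N)\<^sup>2 * exp (- (real (2 * b) / (4 * (real N)\<^sup>2)))"
    by (rule tailG_tail[OF N])
  also have "real (2 * b) / (4 * (real N)\<^sup>2) = real b / (2 * (real N)\<^sup>2)"
    by simp
  finally show ?thesis by simp
qed

text \<open>Times between \<open>N^(2 a)\<close> and \<open>N^2\<close> contribute
  \<open>(2 - 2 a) ln N / pi = g (1 - a) ln N\<close>. The hypothesis is on \<open>m + 1\<close>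
  because \<open>m\<close> will be a sum containing a rounded-down power; this form also admits
  \<open>m = 0\<close> with \<open>a = 0\<close>.\<close>

lemma tailG_upper_asymp:
  assumes e: "0 < e" and a: "a \<le> 1"
  shows "\<forall>\<^sub>F N in sequentially. \<forall>x y m. real N powr (2 * a) \<le> real m + 1 \<longrightarrow>
    tailG N m x y \<le> (g_const * (1 - a) + e) * ln (real N)"
proof -
  have e3: "0 < e - e / pi"
    using e pi_gt3 by (simp add: divide_less_eq)
  have "\<forall>\<^sub>F N in sequentially. 8 * (real N)\<^sup>2 * exp (- (real N powr e / 2)) \<le> 1"
    using e by real_asymp
  moreover have "\<forall>\<^sub>F N in sequentially. (3 + ln 8) \<le> (e - e / pi) * ln (real N)"
    using e3 by real_asymp
  moreover have "\<forall>\<^sub>F N in sequentially. 1 \<le> e * ln (real N)"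
    using e by real_asymp
  moreover have "\<forall>\<^sub>F N in sequentially. (2::nat) \<le> N"
    by (rule eventually_ge_at_top)
  ultimately show ?thesis
  proof eventually_elim
    case (elim N)
    \<comment> \<open>Time cutoff slightly beyond \<open>N^2\<close>: killing makes the rest of the
      sum bounded, and the extra exponent costs only \<open>e / pi\<close> of the slack
      \<open>e\<close>.\<close>
    define b where "b = nat \<lceil>real N powr (2 + e)\<rceil>"
    let ?L = "ln (real N)"
    have N: "1 \<le> N" "1 \<le> real N" "0 \<le> ?L" using elim(4) by auto
    have p1: "1 \<le> real N powr (2 + e)"
      using N e by (intro ge_one_powr_ge_zero) auto
    have b1: "real N powr (2 + e) \<le> real b" "real b \<le> 2 * real N powr (2 + e)" "1 \<le> b"
      using p1 unfolding b_def by linarith+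
    have lnb: "ln (real b) \<le> ln 2 + (2 + e) * ?L"
    proof -
      have "ln (real b) \<le> ln (2 * real N powr (2 + e))"
        using b1 by (intro ln_mono) auto
      also have "\<dots> = ln 2 + (2 + e) * ?L"
        using N p1 by (simp add: ln_mult ln_powr)
      finally show ?thesis .
    qed
    have tl: "8 * (real N)\<^sup>2 * exp (- (real b / (2 * (real N)\<^sup>2))) \<le> 1"
    proof -
      have "real N powr e / 2 = real N powr (2 + e) / (2 * (real N)\<^sup>2)"
        using N by (simp add: powr_add powr_numeral)
      also have "\<dots> \<le> real b / (2 * (real N)\<^sup>2)"
        using b1 by (intro divide_right_mono) auto
      finally have "8 * (real N)\<^sup>2 * exp (- (real b / (2 * (real N)\<^sup>2))) \<le> 8 * (real N)\<^sup>2 * exp (- (real N powr e / 2))"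
        by (intro mult_left_mono) auto
      with elim(1) show ?thesis by simp
    qed
    show ?case
    proof (intro allI impI)
      fix x y m
      assume m: "real N powr (2 * a) \<le> real m + 1"
      have ga: "0 \<le> g_const * (1 - a)" using a by (simp add: g_const_def)
      show "tailG N m x y \<le> (g_const * (1 - a) + e) * ?L"
      proof (cases "m div 2 \<le> b")
        case True
        have "2 * a * ?L = ln (real N powr (2 * a))"
          using N by (simp add: ln_powr)
        also have "\<dots> \<le> ln (real m + 1)"
          using m N by (subst ln_le_cancel_iff) auto
        also have "\<dots> \<le> ln (4 * real (max 1 (m div 2)))"
        proof -
          have "m + 1 \<le> 4 * max 1 (m div 2)" by (simp add: max_def) presburger
          then have "real (m + 1) \<le> real (4 * max 1 (m div 2))" by (rule of_nat_mono)
          then show ?thesis by (subst ln_le_cancel_iff) auto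
        qed
        also have "\<dots> = ln 4 + ln (real (max 1 (m div 2)))"
          by (subst ln_mult) auto
        finally have "ln (real b) - ln (real (max 1 (m div 2))) \<le> ln 8 + (2 + e - 2 * a) * ?L"
          using lnb ln_mult[of 2 "4::real"] by (simp add: algebra_simps)
        then have "(ln (real b) - ln (real (max 1 (m div 2)))) / pi \<le> (ln 8 + (2 + e - 2 * a) * ?L) / pi"
          by (rule divide_right_mono) simp
        also have "\<dots> = ln 8 / pi + g_const * (1 - a) * ?L + e / pi * ?L"
          by (simp add: g_const_def field_simps)
        also have "ln 8 / pi \<le> ln 8"
          using pi_gt3 by (simp add: divide_le_eq)
        finally have "tailG N m x y \<le> 3 + ln 8 + g_const * (1 - a) * ?L + e / pi * ?L"
          using tailG_upper[OF N(1) b1(3) True, of x y] tl by linarith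
        then show ?thesis using elim(2) by (simp add: algebra_simps)
      next
        case False
        then have "tailG N m x y \<le> tailG N (2 * b) x y"
          by (intro tailG_antimono) auto
        also have "\<dots> \<le> 8 * (real N)\<^sup>2 * exp (- (real (2 * b) / (4 * (real N)\<^sup>2)))"
          by (rule tailG_tail[OF N(1)])
        also have "\<dots> \<le> 1" using tl by simp
        also have "1 \<le> e * ?L" by (rule elim(3))
        also have "\<dots> \<le> (g_const * (1 - a) + e) * ?L"
          using ga N by (intro mult_right_mono) auto
        finally show ?thesis .
      qed
    qed
  qed
qed

text \<open>A walk needs time about \<open>N^(2 a)\<close> to cover distance \<open>N^a\<close>, so
  earlier terms are negligible and even the full Green sum behaves like a tail; the bound therefore
  holds for every \<open>m\<close>.\<close>

lemma tailG_upper_far: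
  assumes e: "0 < e" and a: "a \<le> 1"
  shows "\<forall>\<^sub>F N in sequentially. \<forall>x y m. real N powr a \<le> sdist x y \<longrightarrow>
    tailG N m x y \<le> (g_const * (1 - a) + e) * ln (real N)"
proof -
  have g: "0 < g_const" "g_const < 1" using pi_gt3 by (auto simp: g_const_def)
  \<comment> \<open>A time exponent just below the diffusive one makes the early terms
    stretched-exponentially small. If it is not positive, then \<open>a \<le> e / 4\<close> and the
    bound with \<open>a = 0\<close> already lies within the slack.\<close>
  define c where "c = 2 * a - e / 2"
  show ?thesis
  proof (cases "0 < c")
    case False
    have "\<forall>\<^sub>F N in sequentially. \<forall>x y m. real N powr (2 * 0) \<le> real m + 1 \<longrightarrow>
      tailG N m x y \<le> (g_const * (1 - 0) + e / 2) * ln (real N)"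
      using e by (intro tailG_upper_asymp) auto
    moreover have "\<forall>\<^sub>F N in sequentially. (2::nat) \<le> N"
      by (rule eventually_ge_at_top)
    ultimately show ?thesis
    proof eventually_elim
      case (elim N)
      have "g_const * a \<le> e / 2"
      proof -
        have "a \<le> e / 4" using False by (simp add: c_def)
        then have "g_const * a \<le> g_const * (e / 4)" using g by (intro mult_left_mono) auto
        also have "\<dots> \<le> 1 * (e / 4)" using g e by (intro mult_right_mono) auto
        finally show ?thesis using e by linarith
      qed
      then have "(g_const * (1 - 0) + e / 2) * ln (real N) \<le> (g_const * (1 - a) + e) * ln (real N)"
        using elim(2) by (intro mult_right_mono) (auto simp: algebra_simps)
      moreover have "real N powr (2 * 0) \<le> real m + 1" for m
        using elim(2) by simp
      ultimately show ?case using elim(1) by (meson order.trans)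
    qed
  next
    case True
    have "c / 2 \<le> 1" using a e by (simp add: c_def)
    then have "\<forall>\<^sub>F N in sequentially. \<forall>x y m. real N powr (2 * (c / 2)) \<le> real m + 1 \<longrightarrow>
      tailG N m x y \<le> (g_const * (1 - c / 2) + e / 2) * ln (real N)"
      using e by (intro tailG_upper_asymp) auto
    moreover have "\<forall>\<^sub>F N in sequentially. 2 * (real N)\<^sup>2 * exp (- (real N powr (e / 2) / 4)) \<le> 1"
      using e by real_asymp
    moreover have "\<forall>\<^sub>F N in sequentially. 1 \<le> e / 4 * ln (real N)"
      using e by real_asymp
    moreover have "\<forall>\<^sub>F N in sequentially. (2::nat) \<le> N"
      by (rule eventually_ge_at_top)
    ultimately show ?thesis
    proof eventually_elim
      case (elim N)
      define M where "M = nat \<lceil>real N powr c\<rceil>"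
      have N: "1 \<le> real N" using elim(4) by simp
      have p1: "1 \<le> real N powr c" using N True by (intro ge_one_powr_ge_zero) auto
      have M: "real N powr c \<le> real M" "real M \<le> 2 * real N powr c"
        using p1 unfolding M_def by linarith+
      show ?case
      proof (intro allI impI)
        fix x y m
        assume d: "real N powr a \<le> sdist x y"
        have kw: "kw N n x y \<le> exp (- (real N powr (e / 2) / 4))" if "n < M" for n
        proof (cases "n = 0")
          case True
          have "0 < real N powr a" using N by simp
          then have "x \<noteq> y" using d by (auto simp: sdist_def)
          then show ?thesis using True by simp
        next
          case False
          have "kw N n x y \<le> exp (- ((real N powr a)\<^sup>2 / (2 * real n)))"
            using False d kw_le_rw2[of N n x y] rw2_tail[of n "real N powr a" x y] by force
          also have "\<dots> \<le> exp (- (real N powr (e / 2) / 4))"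
          proof -
            have "(real N powr a)\<^sup>2 = real N powr (e / 2) * real N powr c"
              by (simp add: c_def power2_eq_square flip: powr_add)
            then have "real N powr (e / 2) / 4 = (real N powr a)\<^sup>2 / (2 * (2 * real N powr c))"
              using N by simp
            also have "\<dots> \<le> (real N powr a)\<^sup>2 / (2 * real n)"
              using that M False p1 N by (intro divide_left_mono mult_left_mono mult_pos_pos) auto
            finally show ?thesis by simp
          qed
          finally show ?thesis .
        qed
        have "tailG N m x y \<le> tailG N 0 x y" by (rule tailG_antimono) simp
        also have "\<dots> = (\<Sum>n\<in>{0..<M}. kw N n x y) + tailG N M x y"
          using tailG_split[of N 0 x y M] by simp
        also have "(\<Sum>n\<in>{0..<M}. kw N n x y) \<le> real (card {0..<M}) * exp (- (real N powr (e / 2) / 4))"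
          by (rule sum_bounded_above) (use kw in auto)
        also have "\<dots> \<le> 2 * (real N)\<^sup>2 * exp (- (real N powr (e / 2) / 4))"
        proof -
          have "real N powr c \<le> real N powr 2"
            using N a e by (intro powr_mono) (auto simp: c_def)
          then have "real M \<le> 2 * (real N)\<^sup>2" using M N by (simp add: powr_numeral)
          then show ?thesis by (intro mult_right_mono) auto
        qed
        also have "\<dots> \<le> e / 4 * ln (real N)" using elim(2,3) by linarith
        also have "tailG N M x y \<le> (g_const * (1 - c / 2) + e / 2) * ln (real N)"
          using M by (intro elim(1)[rule_format]) auto
        also have "e / 4 * ln (real N) + (g_const * (1 - c / 2) + e / 2) * ln (real N)
            = (g_const * (1 - a) + g_const * (e / 4) + 3 / 4 * e) * ln (real N)"
          by (simp add: c_def field_simps)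
        also have "\<dots> \<le> (g_const * (1 - a) + e) * ln (real N)"
        proof (rule mult_right_mono)
          have "g_const * (e / 4) \<le> 1 * (e / 4)"
            using g e by (intro mult_right_mono) auto
          then show "g_const * (1 - a) + g_const * (e / 4) + 3 / 4 * e \<le> g_const * (1 - a) + e"
            by linarith
        qed (use N in auto)
        finally show "tailG N m x y \<le> (g_const * (1 - a) + e) * ln (real N)" by simp
      qed
    qed
  qed
qed

text \<open>Only times between \<open>N^(2 a + e1)\<close> and \<open>N^(2 - e1)\<close> are kept:
  late enough that a displacement \<open>N^a\<close> is invisible, early enough that a boundary at
  distance \<open>N / 6\<close> is. The depth \<open>N / 6\<close> leaves room for neighbourhoods of
  points of depth \<open>N / 4\<close>.\<close>

lemma tailG_lower_asymp:
  assumes e: "0 < e" and a: "0 \<le> a"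
  shows "\<forall>\<^sub>F N in sequentially. \<forall>x y m. real N / 6 \<le> depth N x \<longrightarrow> sdist x y \<le> real N powr a \<longrightarrow>
    real m \<le> 5 * real N powr (2 * a) \<longrightarrow> (g_const * (1 - a) - e) * ln (real N) \<le> tailG N m x y"
proof -
  define e1 where "e1 = e / 2"
  have e1: "0 < e1" using e by (simp add: e1_def)
  have e3: "0 < e - e / pi"
    using e pi_gt3 by (simp add: divide_less_eq)
  have "\<forall>\<^sub>F N in sequentially. 4 * (real N)\<^sup>2 * exp (- (real N powr e1 / 72)) \<le> 1"
    using e1 by real_asymp
  moreover have "\<forall>\<^sub>F N in sequentially. 3 / 2 * real N powr (- e1) * (2 + ln (real N)) \<le> 1"
    using e1 by real_asymp
  moreover have "\<forall>\<^sub>F N in sequentially. 2 + ln 10 \<le> (e - e / pi) * ln (real N)"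
    using e3 by real_asymp
  moreover have "\<forall>\<^sub>F N in sequentially. (2::nat) \<le> N"
    by (rule eventually_ge_at_top)
  ultimately show ?thesis
  proof eventually_elim
    case (elim N)
    let ?L = "ln (real N)"
    \<comment> \<open>The factor 3 makes \<open>2 * A\<close> exceed every admissible
      \<open>m\<close>, which is at most \<open>5 * N powr (2 * a)\<close>, and bounds the relative
      kernel error by \<open>3 / 2 * N powr (- e1)\<close>. If the window from \<open>A\<close> to
      \<open>B\<close> is empty, the bound holds because tails are nonnegative.\<close>
    define A where "A = nat \<lceil>3 * real N powr (2 * a + e1)\<rceil>"
    define B where "B = nat \<lfloor>real N powr (2 - e1) / 2\<rfloor>"
    have N: "1 \<le> real N" using elim(4) by simp
    have p1: "1 \<le> real N powr (2 * a + e1)" using N e1 a by (intro ge_one_powr_ge_zero) auto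
    have A: "3 * real N powr (2 * a + e1) \<le> real A" "real A \<le> 3 * real N powr (2 * a + e1) + 1"
      using p1 unfolding A_def by linarith+
    have B: "real B \<le> real N powr (2 - e1) / 2" "real N powr (2 - e1) / 2 \<le> real B + 1"
      unfolding B_def by (auto simp: le_floor_iff) linarith
    show ?case
    proof (intro allI impI)
      fix x y m
      assume x: "real N / 6 \<le> depth N x" and d: "sdist x y \<le> real N powr a"
        and m: "real m \<le> 5 * real N powr (2 * a)"
      let ?u = "(fst x - fst y) + (snd x - snd y)"
      have "sumC A B - 2 \<le> tailG N m x y"
      proof (cases "A \<le> B")
        case AB: True
        have A1: "1 \<le> A" using A p1 by linarith
        let ?d = "3 / 2 * real N powr (- e1)"
        have low: "(if even (int n + ?u) then (cbin (n div 2))\<^sup>2 * (1 - ?d) else 0)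
            - 4 * exp (- (real N powr e1 / 72)) \<le> kw N n x y" if n: "n \<in> {2 * A..<2 * B}" for n
        proof -
          have n0: "0 < n" using n A1 by auto
          have "real N powr e1 / 72 = (real N / 6)\<^sup>2 / (2 * real N powr (2 - e1))"
            using N by (simp add: powr_diff powr_numeral power_divide)
          also have "\<dots> \<le> (real N / 6)\<^sup>2 / (2 * real n)"
            using n B n0 N by (intro divide_left_mono mult_left_mono mult_pos_pos) auto
          finally have "4 * exp (- ((real N / 6)\<^sup>2 / (2 * real n))) \<le> 4 * exp (- (real N powr e1 / 72))"
            by simp
          then have k: "rw2 n x y - 4 * exp (- (real N powr e1 / 72)) \<le> kw N n x y"
            using kw_lower[OF x _ n0, of y] by (smt (verit) divide_nonneg_nonneg of_nat_0_le_iff)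
          have "(if even (int n + ?u) then (cbin (n div 2))\<^sup>2 * (1 - ?d) else 0) \<le> rw2 n x y"
          proof (cases "even (int n + ?u)")
            case True
            have "(2 * real N powr a + 1)\<^sup>2 / real n \<le> (3 * real N powr a)\<^sup>2 / (6 * real N powr (2 * a + e1))"
            proof (intro frac_le power_mono)
              show "2 * real N powr a + 1 \<le> 3 * real N powr a"
                using N a ge_one_powr_ge_zero[of "real N" a] by simp
              show "6 * real N powr (2 * a + e1) \<le> real n" using n A by auto
            qed (use N in auto)
            also have "\<dots> = ?d"
              using N by (simp add: powr_add powr_minus power_mult_distrib field_simps)
                (simp add: power2_eq_square mult.commute flip: powr_add)
            finally have "(cbin (n div 2))\<^sup>2 * (1 - ?d) \<le> (cbin (n div 2))\<^sup>2 * (1 - (2 * real N powr a + 1)\<^sup>2 / real n)"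
              by (intro mult_left_mono) auto
            also have "\<dots> \<le> rw2 n x y"
              using True d n0 by (intro rw2_lower) (auto simp: add.assoc)
            finally show ?thesis by (simp only: True if_True)
          next
            case False
            then show ?thesis by (simp only: if_False rw2_nonneg)
          qed
          with k show ?thesis by linarith
        qed
        have "sumC A B * (1 - ?d) - 1 \<le> (\<Sum>n\<in>{2 * A..<2 * B}. kw N n x y)"
        proof -
          have "sumC A B * (1 - ?d) = (\<Sum>n\<in>{2 * A..<2 * B}. if even (int n + ?u) then (cbin (n div 2))\<^sup>2 * (1 - ?d) else 0)"
            by (subst sum_parity[OF AB]) (simp add: sumC_def sum_distrib_right)
          moreover have "real (card {2 * A..<2 * B}) * (4 * exp (- (real N powr e1 / 72))) \<le> 1"
          proof -
            have "real N powr (2 - e1) \<le> real N powr 2" using N e1 by (intro powr_mono) auto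
            then have "real (2 * B) \<le> real (N\<^sup>2)"
              using B N by (simp add: powr_numeral)
            then have "2 * B \<le> N\<^sup>2" by (simp only: of_nat_le_iff)
            then have "card {2 * A..<2 * B} \<le> N\<^sup>2" by simp
            then have "real (card {2 * A..<2 * B}) \<le> real (N\<^sup>2)" by (rule of_nat_mono)
            then have "real (card {2 * A..<2 * B}) \<le> (real N)\<^sup>2" by simp
            then have "real (card {2 * A..<2 * B}) * (4 * exp (- (real N powr e1 / 72)))
                \<le> (real N)\<^sup>2 * (4 * exp (- (real N powr e1 / 72)))"
              by (rule mult_right_mono) simp
            also have "\<dots> = 4 * (real N)\<^sup>2 * exp (- (real N powr e1 / 72))"
              by simp
            also note elim(1)
            finally show ?thesis .
          qed
          moreover have "(\<Sum>n\<in>{2 * A..<2 * B}. (if even (int n + ?u) then (cbin (n div 2))\<^sup>2 * (1 - ?d) else 0)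
            - 4 * exp (- (real N powr e1 / 72))) \<le> (\<Sum>n\<in>{2 * A..<2 * B}. kw N n x y)"
            by (rule sum_mono) (rule low)
          ultimately show ?thesis by (simp add: sum_subtractf)
        qed
        also have "(\<Sum>n\<in>{2 * A..<2 * B}. kw N n x y) \<le> tailG N (2 * A) x y"
          using tailG_split[of N "2 * A" x y "2 * B - 2 * A"] AB tailG_nonneg[of N "2 * B" x y] by simp
        also have "\<dots> \<le> tailG N m x y"
        proof (rule tailG_antimono)
          have "real N powr (2 * a) \<le> real N powr (2 * a + e1)" using N e1 by (intro powr_mono) auto
          then have "real m \<le> real (2 * A)" using m A by simp
          then show "m \<le> 2 * A" by (simp only: of_nat_le_iff)
        qed
        finally have 1: "sumC A B * (1 - ?d) - 1 \<le> tailG N m x y" .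
        have "sumC A B \<le> 2 + (ln (real B) - ln (real (max 1 A))) / pi"
          using A1 AB by (intro sumC_upper) auto
        also have "\<dots> \<le> 2 + (2 * ?L) / pi"
        proof -
          have "real N powr (2 - e1) \<le> real N powr 2" using N e1 by (intro powr_mono) auto
          then have "real B \<le> real N powr 2" using B(1) of_nat_0_le_iff[of B] by linarith
          then have "ln (real B) \<le> ln (real N powr 2)" using A1 AB by (intro ln_mono) auto
          also have "\<dots> = 2 * ?L" by (rule ln_powr)
          finally have "ln (real B) \<le> 2 * ?L" .
          moreover have "0 \<le> ln (real (max 1 A))" by simp
          ultimately have "ln (real B) - ln (real (max 1 A)) \<le> 2 * ?L" by linarith
          then show ?thesis by (intro add_left_mono divide_right_mono) simp_all
        qed
        also have "\<dots> \<le> 2 + ?L"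
          using pi_gt3 N mult_right_mono[of 2 pi ?L] by (simp add: divide_le_eq mult.commute)
        finally have "?d * sumC A B \<le> ?d * (2 + ?L)"
          by (intro mult_left_mono) auto
        with 1 elim(2) show ?thesis by (simp add: algebra_simps)
      next
        case False
        then have "sumC A B = 0" by (simp add: sumC_def)
        then show ?thesis using tailG_nonneg[of N m x y] by simp
      qed
      moreover have "g_const * (1 - a) * ?L - e / pi * ?L - ln 10 \<le> sumC A B"
      proof -
        have "(2 - e1) * ?L - ln 2 = ln (real N powr (2 - e1) / 2)"
          using N by (simp add: ln_divide_pos)
        also have "\<dots> \<le> ln (real B + 1)"
          using B N by (intro ln_mono) auto
        finally have b: "(2 - e1) * ?L - ln 2 \<le> ln (real B + 1)" .
        have "ln (real A + 1) \<le> ln (5 * real N powr (2 * a + e1))"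
          using A p1 by (intro ln_mono) auto
        also have "\<dots> = ln 5 + (2 * a + e1) * ?L"
          using N by (simp add: ln_mult)
        finally have "(2 - 2 * a - 2 * e1) * ?L - ln 10 \<le> ln (real B + 1) - ln (real A + 1)"
          using b ln_mult[of 2 "5::real"] by (simp add: algebra_simps)
        then have "((2 - 2 * a - 2 * e1) * ?L - ln 10) / pi \<le> (ln (real B + 1) - ln (real A + 1)) / pi"
          by (rule divide_right_mono) simp
        also have "\<dots> \<le> sumC A B" by (rule sumC_lower)
        also have "((2 - 2 * a - 2 * e1) * ?L - ln 10) / pi = g_const * (1 - a) * ?L - e / pi * ?L - ln 10 / pi"
          by (simp add: g_const_def e1_def field_simps)
        finally have "g_const * (1 - a) * ?L - e / pi * ?L - ln 10 / pi \<le> sumC A B" .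
        moreover have "ln 10 / pi \<le> ln (10::real) / 1"
          using pi_gt3 by (intro divide_left_mono) auto
        ultimately show ?thesis by simp
      qed
      ultimately show "(g_const * (1 - a) - e) * ?L \<le> tailG N m x y"
        using elim(3) by (simp add: algebra_simps)
    qed
  qed
qed

section \<open>Gaussian families\<close>

lemma integral_add_avg:
  fixes a b c :: "'a \<Rightarrow> complex"
  assumes "integrable M a" "integrable M b" "integrable M c"
  shows "(\<integral>x. a x + (b x + c x) / k \<partial>M) = (\<integral>x. a x \<partial>M) + ((\<integral>x. b x \<partial>M) + (\<integral>x. c x \<partial>M)) / k"
    "(\<integral>x. a x + (b x - c x) / k \<partial>M) = (\<integral>x. a x \<partial>M) + ((\<integral>x. b x \<partial>M) - (\<integral>x. c x \<partial>M)) / k"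
  using assms by simp_all

text \<open>Both weighted measures have the same mass \<open>c\<close>, as the hypothesis at
  \<open>t = 0\<close> shows. Dividing by \<open>c\<close> gives probability laws to which Levy
  uniqueness applies; for \<open>c = 0\<close> both weights vanish almost everywhere.\<close>

lemma weighted_char_unique:
  fixes X1 :: "'a \<Rightarrow> real" and X2 :: "'b \<Rightarrow> real" and f1 :: "'a \<Rightarrow> real" and f2 :: "'b \<Rightarrow> real"
  assumes M1: "prob_space M1" and M2: "prob_space M2"
    and X1[measurable]: "X1 \<in> borel_measurable M1" and X2[measurable]: "X2 \<in> borel_measurable M2"
    and f1[measurable]: "f1 \<in> borel_measurable M1" and f2[measurable]: "f2 \<in> borel_measurable M2"
    and b1: "\<And>x. 0 \<le> f1 x" "\<And>x. f1 x \<le> B" and b2: "\<And>x. 0 \<le> f2 x" "\<And>x. f2 x \<le> B"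
    and eq: "\<And>t. (\<integral>x. f1 x * iexp (t * X1 x) \<partial>M1) = (\<integral>x. f2 x * iexp (t * X2 x) \<partial>M2)"
    and A[measurable]: "A \<in> sets borel"
  shows "(\<integral>x. f1 x * indicator A (X1 x) \<partial>M1) = (\<integral>x. f2 x * indicator A (X2 x) \<partial>M2)"
proof -
  interpret P1: prob_space M1 by fact
  interpret P2: prob_space M2 by fact
  have i1: "integrable M1 f1"
    by (rule P1.integrable_const_bound[of _ B]) (use b1 in auto)
  have i2: "integrable M2 f2"
    by (rule P2.integrable_const_bound[of _ B]) (use b2 in auto)
  define c where "c = (\<integral>x. f1 x \<partial>M1)"
  have c2: "c = (\<integral>x. f2 x \<partial>M2)"
    using eq[of 0] unfolding c_def by simp
  have c0: "0 \<le> c" unfolding c_def using b1 by simp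
  have n1: "(\<integral>x. f1 x * indicator A (X1 x) \<partial>M1) = 0" if "c = 0"
  proof -
    have "AE x in M1. f1 x = 0"
      using integral_nonneg_eq_0_iff_AE[OF i1] b1 that unfolding c_def by auto
    then have "AE x in M1. f1 x * indicator A (X1 x) = 0" by auto
    then show ?thesis by (rule integral_eq_zero_AE)
  qed
  have n2: "(\<integral>x. f2 x * indicator A (X2 x) \<partial>M2) = 0" if "c = 0"
  proof -
    have "AE x in M2. f2 x = 0"
      using integral_nonneg_eq_0_iff_AE[OF i2] b2 that unfolding c2 by auto
    then have "AE x in M2. f2 x * indicator A (X2 x) = 0" by auto
    then show ?thesis by (rule integral_eq_zero_AE)
  qed
  show ?thesis
  proof (cases "c = 0")
    case False
    then have c: "0 < c" using c0 by simp
    define D1 where "D1 = distr (density M1 (\<lambda>x. ennreal (f1 x / c))) borel X1"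
    define D2 where "D2 = distr (density M2 (\<lambda>x. ennreal (f2 x / c))) borel X2"
    have p1: "prob_space (density M1 (\<lambda>x. ennreal (f1 x / c)))"
    proof
      have "(\<integral>\<^sup>+x. ennreal (f1 x / c) \<partial>M1) = ennreal (\<integral>x. f1 x / c \<partial>M1)"
        using i1 b1 c by (intro nn_integral_eq_integral) auto
      then show "emeasure (density M1 (\<lambda>x. ennreal (f1 x / c))) (space (density M1 (\<lambda>x. ennreal (f1 x / c)))) = 1"
        using c by (simp add: emeasure_density c_def)
    qed
    have p2: "prob_space (density M2 (\<lambda>x. ennreal (f2 x / c)))"
    proof
      have "(\<integral>\<^sup>+x. ennreal (f2 x / c) \<partial>M2) = ennreal (\<integral>x. f2 x / c \<partial>M2)"
        using i2 b2 c by (intro nn_integral_eq_integral) auto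
      then show "emeasure (density M2 (\<lambda>x. ennreal (f2 x / c))) (space (density M2 (\<lambda>x. ennreal (f2 x / c)))) = 1"
        using c by (simp add: emeasure_density c2)
    qed
    have r1: "real_distribution D1"
      unfolding D1_def by (rule prob_space.real_distribution_distr[OF p1]) simp
    have r2: "real_distribution D2"
      unfolding D2_def by (rule prob_space.real_distribution_distr[OF p2]) simp
    have "char D1 = char D2"
    proof
      fix t
      have "char D1 t = (\<integral>x. (f1 x / c) *\<^sub>R iexp (t * X1 x) \<partial>M1)"
        unfolding D1_def char_def using b1 c by (subst integral_distr) (auto simp: integral_density)
      also have "\<dots> = (\<integral>x. f1 x * iexp (t * X1 x) \<partial>M1) / c"
        by (simp add: scaleR_conv_of_real flip: integral_divide_zero)
      also have "\<dots> = (\<integral>x. f2 x * iexp (t * X2 x) \<partial>M2) / c"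
        by (simp only: eq)
      also have "\<dots> = (\<integral>x. (f2 x / c) *\<^sub>R iexp (t * X2 x) \<partial>M2)"
        by (simp add: scaleR_conv_of_real flip: integral_divide_zero)
      also have "\<dots> = char D2 t"
        unfolding D2_def char_def using b2 c by (subst integral_distr) (auto simp: integral_density)
      finally show "char D1 t = char D2 t" .
    qed
    then have "D1 = D2" by (rule Levy_uniqueness[OF r1 r2])
    have "(\<integral>x. f1 x * indicator A (X1 x) \<partial>M1) / c = (\<integral>y. indicator A y \<partial>D1)"
      unfolding D1_def using b1 c by (subst integral_distr) (auto simp: integral_density simp flip: integral_divide_zero)
    also have "\<dots> = (\<integral>x. f2 x * indicator A (X2 x) \<partial>M2) / c"
      unfolding \<open>D1 = D2\<close> unfolding D2_def
      using b2 c by (subst integral_distr) (auto simp: integral_density simp flip: integral_divide_zero)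
    finally show ?thesis using c by simp
  qed (simp add: n1 n2)
qed

text \<open>The indicators are introduced one coordinate at a time; the weights \<open>1 + cos h\<close> and
  \<open>1 + sin h\<close> are nonnegative, so one-dimensional uniqueness for positive finite measures applies to
  each coordinate in turn.\<close>

lemma cylinder_char_unique:
  fixes X1 :: "'i \<Rightarrow> 'a \<Rightarrow> real" and X2 :: "'i \<Rightarrow> 'b \<Rightarrow> real"
  assumes M1: "prob_space M1" and M2: "prob_space M2" and I: "finite I"
    and X1[measurable]: "\<And>i. X1 i \<in> borel_measurable M1" and X2[measurable]: "\<And>i. X2 i \<in> borel_measurable M2"
    and eq: "\<And>t. (\<integral>x. iexp (\<Sum>i\<in>I. t i * X1 i x) \<partial>M1) = (\<integral>x. iexp (\<Sum>i\<in>I. t i * X2 i x) \<partial>M2)"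
    and S: "S \<subseteq> I" and A: "\<And>i. i \<in> S \<Longrightarrow> A i \<in> sets borel"
  shows "(\<integral>x. of_real (\<Prod>i\<in>S. indicator (A i) (X1 i x)) * iexp (\<Sum>i\<in>I-S. t i * X1 i x) \<partial>M1)
       = (\<integral>x. of_real (\<Prod>i\<in>S. indicator (A i) (X2 i x)) * iexp (\<Sum>i\<in>I-S. t i * X2 i x) \<partial>M2)"
proof -
  have "finite S" using S I by (rule finite_subset)
  then show ?thesis using S A
  proof (induction S arbitrary: t rule: finite_induct)
    case empty
    then show ?case using eq by simp
  next
    case (insert k S)
    have [measurable]: "A k \<in> sets borel" "\<And>i. i \<in> S \<Longrightarrow> A i \<in> sets borel"
      using insert.prems by auto
    interpret P1: prob_space M1 by fact
    interpret P2: prob_space M2 by fact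
    define p1 where "p1 = (\<lambda>x. \<Prod>i\<in>S. indicator (A i) (X1 i x) :: real)"
    define p2 where "p2 = (\<lambda>x. \<Prod>i\<in>S. indicator (A i) (X2 i x) :: real)"
    define h1 where "h1 = (\<lambda>x. \<Sum>i\<in>I - insert k S. t i * X1 i x)"
    define h2 where "h2 = (\<lambda>x. \<Sum>i\<in>I - insert k S. t i * X2 i x)"
    have p1m[measurable]: "p1 \<in> borel_measurable M1" unfolding p1_def by measurable
    have p2m[measurable]: "p2 \<in> borel_measurable M2" unfolding p2_def by measurable
    have h1m[measurable]: "h1 \<in> borel_measurable M1" unfolding h1_def by measurable
    have h2m[measurable]: "h2 \<in> borel_measurable M2" unfolding h2_def by measurable
    have p1b: "0 \<le> p1 x" "p1 x \<le> 1" for x unfolding p1_def by (auto intro!: prod_nonneg prod_le_1)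
    have p2b: "0 \<le> p2 x" "p2 x \<le> 1" for x unfolding p2_def by (auto intro!: prod_nonneg prod_le_1)
    have E: "(\<integral>x. p1 x * iexp (s * X1 k x + c * h1 x) \<partial>M1) = (\<integral>x. p2 x * iexp (s * X2 k x + c * h2 x) \<partial>M2)" for s c
    proof -
      have Ik: "I - S = insert k (I - insert k S)" using insert by auto
      \<comment> \<open>The induction hypothesis holds for all frequencies: \<open>s\<close> is
        placed at the new coordinate and the others are scaled by \<open>c\<close>. The values 0, 1
        and -1 of \<open>c\<close> yield the weight itself and, by Euler's formula, its products
        with cosine and sine.\<close>
      let ?t = "\<lambda>i. if i = k then s else c * t i"
      have 1: "(\<Sum>i\<in>I - S. ?t i * X i x) = s * X k x + c * (\<Sum>i\<in>I - insert k S. t i * X i x)"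
        for X :: "'i \<Rightarrow> 'c \<Rightarrow> real" and x
      proof -
        have "(\<Sum>i\<in>I - S. ?t i * X i x) = s * X k x + (\<Sum>i\<in>I - insert k S. ?t i * X i x)"
          unfolding Ik using I by (subst sum.insert) auto
        also have "(\<Sum>i\<in>I - insert k S. ?t i * X i x) = c * (\<Sum>i\<in>I - insert k S. t i * X i x)"
          unfolding sum_distrib_left by (intro sum.cong) auto
        finally show ?thesis .
      qed
      show ?thesis
        using insert.IH[of ?t] insert.prems unfolding 1 1[of X2] p1_def p2_def h1_def h2_def by simp
    qed
    have int1: "integrable M1 (\<lambda>x. complex_of_real (p1 x) * iexp (s * X1 k x + c * h1 x))" for s c
      by (rule P1.integrable_const_bound[of _ 1]) (use p1b in \<open>auto simp: norm_mult\<close>)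
    have int2: "integrable M2 (\<lambda>x. complex_of_real (p2 x) * iexp (s * X2 k x + c * h2 x))" for s c
      by (rule P2.integrable_const_bound[of _ 1]) (use p2b in \<open>auto simp: norm_mult\<close>)
    have C0: "(\<integral>x. p1 x * indicator (A k) (X1 k x) \<partial>M1) = (\<integral>x. p2 x * indicator (A k) (X2 k x) \<partial>M2)"
      by (rule weighted_char_unique[OF M1 M2, where B = 1]) (use p1b p2b E[of _ 0] in auto)
    have bd: "0 \<le> p * (1 + u)" "p * (1 + u) \<le> 2" if "0 \<le> p" "p \<le> 1" "-1 \<le> u" "u \<le> 1" for p u :: real
      using that mult_mono[of p 1 "1 + u" 2] by auto
    have C1: "(\<integral>x. (p1 x * (1 + cos (h1 x))) * indicator (A k) (X1 k x) \<partial>M1)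
        = (\<integral>x. (p2 x * (1 + cos (h2 x))) * indicator (A k) (X2 k x) \<partial>M2)"
    proof (rule weighted_char_unique[OF M1 M2, where B = 2])
      fix s
      have split: "complex_of_real (p * (1 + cos h)) * iexp (s * z)
          = p * iexp (s * z + 0 * h) + (p * iexp (s * z + 1 * h) + p * iexp (s * z + (- 1) * h)) / 2" for p h z
      proof -
        have "complex_of_real (cos h) = (iexp h + iexp (- h)) / 2"
          by (simp add: cos_exp_eq flip: cos_of_real)
        moreover have "iexp (s * z + 0 * h) = iexp (s * z)" "iexp (s * z + 1 * h) = iexp (s * z) * iexp h"
          "iexp (s * z + (- 1) * h) = iexp (s * z) * iexp (- h)"
          by (simp_all add: distrib_left right_diff_distrib flip: exp_add)
        ultimately show ?thesis
          by (simp only: of_real_mult of_real_add of_real_1) (simp add: field_simps)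
      qed
      show "(\<integral>x. complex_of_real (p1 x * (1 + cos (h1 x))) * iexp (s * X1 k x) \<partial>M1)
        = (\<integral>x. complex_of_real (p2 x * (1 + cos (h2 x))) * iexp (s * X2 k x) \<partial>M2)"
        unfolding split integral_add_avg[OF int1 int1 int1] integral_add_avg[OF int2 int2 int2] E ..
    qed (auto intro!: bd p1b p2b)
    have C2: "(\<integral>x. (p1 x * (1 + sin (h1 x))) * indicator (A k) (X1 k x) \<partial>M1)
        = (\<integral>x. (p2 x * (1 + sin (h2 x))) * indicator (A k) (X2 k x) \<partial>M2)"
    proof (rule weighted_char_unique[OF M1 M2, where B = 2])
      fix s
      have split: "complex_of_real (p * (1 + sin h)) * iexp (s * z)
          = p * iexp (s * z + 0 * h) + (p * iexp (s * z + 1 * h) - p * iexp (s * z + (- 1) * h)) / (2 * \<i>)" for p h z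
      proof -
        have "complex_of_real (sin h) = (iexp h - iexp (- h)) / (2 * \<i>)"
          by (simp add: sin_exp_eq flip: sin_of_real)
        moreover have "iexp (s * z + 0 * h) = iexp (s * z)" "iexp (s * z + 1 * h) = iexp (s * z) * iexp h"
          "iexp (s * z + (- 1) * h) = iexp (s * z) * iexp (- h)"
          by (simp_all add: distrib_left right_diff_distrib flip: exp_add)
        ultimately show ?thesis
          by (simp only: of_real_mult of_real_add of_real_1) (simp add: field_simps)
      qed
      show "(\<integral>x. complex_of_real (p1 x * (1 + sin (h1 x))) * iexp (s * X1 k x) \<partial>M1)
        = (\<integral>x. complex_of_real (p2 x * (1 + sin (h2 x))) * iexp (s * X2 k x) \<partial>M2)"
        unfolding split integral_add_avg[OF int1 int1 int1] integral_add_avg[OF int2 int2 int2] E ..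
    qed (auto intro!: bd p1b p2b)
    \<comment> \<open>Recombination through
      \<open>exp (i h) = (1 + cos h) + i (1 + sin h) - (1 + i)\<close>, which uses only integrals
      against nonnegative weights.\<close>
    have trig: "(\<integral>x. complex_of_real (indicator (A k) (z x) * p x) * iexp (h x) \<partial>M)
        = of_real (\<integral>x. (p x * (1 + cos (h x))) * indicator (A k) (z x) \<partial>M)
          + \<i> * of_real (\<integral>x. (p x * (1 + sin (h x))) * indicator (A k) (z x) \<partial>M)
          - (1 + \<i>) * of_real (\<integral>x. p x * indicator (A k) (z x) \<partial>M)"
      if "prob_space M" and [measurable]: "p \<in> borel_measurable M" "h \<in> borel_measurable M" "z \<in> borel_measurable M"
        and p: "\<And>x. 0 \<le> p x" "\<And>x. p x \<le> 1"
      for M :: "'c measure" and p h z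
    proof -
      interpret prob_space M by fact
      have b: "norm (p x * (1 + u) * indicator (A k) (z x)) \<le> 2" if "\<bar>u\<bar> \<le> 1" for u x
        using that p[of x] mult_mono[of "p x" 1 "1 + u" 2]
        by (auto simp: abs_mult indicator_def)
      have i: "integrable M (\<lambda>x. p x * (1 + cos (h x)) * indicator (A k) (z x))"
        "integrable M (\<lambda>x. p x * (1 + sin (h x)) * indicator (A k) (z x))"
        by (rule integrable_const_bound[of _ 2]; use b in simp)+
      have j: "integrable M (\<lambda>x. p x * indicator (A k) (z x))"
        by (rule integrable_const_bound[of _ 1]) (use p in \<open>auto simp: indicator_def\<close>)
      have "complex_of_real (indicator (A k) (z x) * p x) * iexp (h x)
        = of_real (p x * (1 + cos (h x)) * indicator (A k) (z x))
          + \<i> * of_real (p x * (1 + sin (h x)) * indicator (A k) (z x))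
          - (1 + \<i>) * of_real (p x * indicator (A k) (z x))" for x
        by (simp add: exp_Euler algebra_simps flip: cos_of_real sin_of_real)
      then show ?thesis
        using i j by (simp del: of_real_mult of_real_add)
    qed
    have pr: "(\<Prod>i\<in>insert k S. indicator (A i) (X1 i x)) = indicator (A k) (X1 k x) * p1 x"
      "(\<Prod>i\<in>insert k S. indicator (A i) (X2 i y)) = indicator (A k) (X2 k y) * p2 y" for x y
      using insert.hyps by (simp_all add: p1_def p2_def)
    have hs: "(\<Sum>i\<in>I - insert k S. t i * X1 i x) = h1 x" "(\<Sum>i\<in>I - insert k S. t i * X2 i y) = h2 y" for x y
      by (simp_all add: h1_def h2_def)
    show ?case
      unfolding pr hs
        trig[OF M1 p1m h1m X1 p1b] trig[OF M2 p2m h2m X2 p2b] C0 C1 C2 ..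
  qed
qed

text \<open>With \<open>S = I\<close> the preceding lemma gives equal masses to all product sets,
  and these determine a finite measure on the product space.\<close>

lemma PiM_char_unique:
  fixes X1 :: "'i \<Rightarrow> 'a \<Rightarrow> real" and X2 :: "'i \<Rightarrow> 'b \<Rightarrow> real"
  assumes M1: "prob_space M1" and M2: "prob_space M2" and I: "finite I"
    and X1[measurable]: "\<And>i. X1 i \<in> borel_measurable M1" and X2[measurable]: "\<And>i. X2 i \<in> borel_measurable M2"
    and eq: "\<And>t. (\<integral>x. iexp (\<Sum>i\<in>I. t i * X1 i x) \<partial>M1) = (\<integral>x. iexp (\<Sum>i\<in>I. t i * X2 i x) \<partial>M2)"
  shows "distr M1 (PiM I (\<lambda>_. borel)) (\<lambda>x. \<lambda>i\<in>I. X1 i x) = distr M2 (PiM I (\<lambda>_. borel)) (\<lambda>x. \<lambda>i\<in>I. X2 i x)"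
    (is "?P = ?Q")
proof -
  interpret P1: prob_space M1 by fact
  interpret P2: prob_space M2 by fact
  have *: "emeasure (distr M (PiM I (\<lambda>_. borel)) (\<lambda>x. \<lambda>i\<in>I. X i x)) (Pi\<^sub>E I A)
      = ennreal (\<integral>x. (\<Prod>i\<in>I. indicator (A i) (X i x)) \<partial>M)"
    if M: "prob_space M" and [measurable]: "\<And>i. X i \<in> borel_measurable M" and A: "\<And>i. i \<in> I \<Longrightarrow> A i \<in> sets borel"
    for M :: "'c measure" and X :: "'i \<Rightarrow> 'c \<Rightarrow> real" and A
  proof -
    interpret prob_space M by fact
    have [measurable]: "Pi\<^sub>E I A \<in> sets (PiM I (\<lambda>_. borel))"
      using A I by (intro sets_PiM_I_finite) auto
    have [measurable]: "(\<lambda>x. \<lambda>i\<in>I. X i x) \<in> measurable M (PiM I (\<lambda>_. borel))"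
      by (rule measurable_restrict) simp
    have "emeasure (distr M (PiM I (\<lambda>_. borel)) (\<lambda>x. \<lambda>i\<in>I. X i x)) (Pi\<^sub>E I A)
        = emeasure M {x \<in> space M. (\<lambda>i\<in>I. X i x) \<in> Pi\<^sub>E I A}"
      by (subst emeasure_distr) (auto intro!: arg_cong2[where f = emeasure])
    also have "\<dots> = ennreal (prob {x \<in> space M. (\<lambda>i\<in>I. X i x) \<in> Pi\<^sub>E I A})"
      by (rule emeasure_eq_measure)
    also have "prob {x \<in> space M. (\<lambda>i\<in>I. X i x) \<in> Pi\<^sub>E I A}
        = (\<integral>x. indicator {x \<in> space M. (\<lambda>i\<in>I. X i x) \<in> Pi\<^sub>E I A} x \<partial>M)"
      by (auto intro!: arg_cong[where f = prob])
    also have "\<dots> = (\<integral>x. (\<Prod>i\<in>I. indicator (A i) (X i x)) \<partial>M)"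
    proof (intro Bochner_Integration.integral_cong refl)
      fix x assume x: "x \<in> space M"
      show "indicator {x \<in> space M. (\<lambda>i\<in>I. X i x) \<in> Pi\<^sub>E I A} x = (\<Prod>i\<in>I. indicator (A i) (X i x) :: real)"
      proof (cases "\<forall>i\<in>I. X i x \<in> A i")
        case True
        then show ?thesis using x by (auto simp: PiE_iff)
      next
        case False
        then have "(\<Prod>i\<in>I. indicator (A i) (X i x) :: real) = 0" using I by (auto simp: prod_zero_iff indicator_def)
        then show ?thesis using False by (auto simp: PiE_iff)
      qed
    qed
    finally show ?thesis .
  qed
  have Xr[measurable]: "(\<lambda>x. \<lambda>i\<in>I. X1 i x) \<in> measurable M1 (PiM I (\<lambda>_. borel))"
    "(\<lambda>x. \<lambda>i\<in>I. X2 i x) \<in> measurable M2 (PiM I (\<lambda>_. borel))"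
    by (rule measurable_restrict, simp)+
  show ?thesis
  proof (rule measure_eqI_PiM_finite[OF I])
    show "sets ?P = sets (PiM I (\<lambda>_. borel))" "sets ?Q = sets (PiM I (\<lambda>_. borel))" by simp_all
    fix A :: "'i \<Rightarrow> real set" assume A: "\<And>i. i \<in> I \<Longrightarrow> A i \<in> sets borel"
    have "(\<integral>x. of_real (\<Prod>i\<in>I. indicator (A i) (X1 i x)) * iexp (\<Sum>i\<in>I-I. 0 * X1 i x) \<partial>M1)
       = (\<integral>x. of_real (\<Prod>i\<in>I. indicator (A i) (X2 i x)) * iexp (\<Sum>i\<in>I-I. 0 * X2 i x) \<partial>M2)"
      by (rule cylinder_char_unique[OF M1 M2 I X1 X2 eq order_refl A])
    then have "(\<integral>x. (\<Prod>i\<in>I. indicator (A i) (X1 i x) :: real) \<partial>M1) = (\<integral>x. (\<Prod>i\<in>I. indicator (A i) (X2 i x)) \<partial>M2)"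
      by (simp del: of_real_prod)
    then show "emeasure ?P (Pi\<^sub>E I A) = emeasure ?Q (Pi\<^sub>E I A)"
      using *[OF M1 X1 A] *[OF M2 X2 A] by simp
  next
    define C where "C = (\<lambda>_::nat. \<Pi>\<^sub>E i\<in>I. (UNIV::real set))"
    show "range C \<subseteq> prod_algebra I (\<lambda>_. borel)"
      unfolding C_def using I by (auto intro!: prod_algebraI_finite)
    show "(\<Union>i. C i) = space (PiM I (\<lambda>_. borel))"
      by (simp add: C_def space_PiM)
    have "prob_space ?P" by (rule P1.prob_space_distr) (rule Xr)
    then interpret P: prob_space ?P .
    show "emeasure ?P (C i) \<noteq> \<infinity>" for i using P.emeasure_finite[of "C i"] by simp
  qed
qed

text \<open>On \<open>M \<Otimes> M\<close> the second group is evaluated at an independent copy.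
  Factorisation says that this vector has the same joint characteristic function as the original
  one, hence the same law, and there the events are independent by construction.\<close>

lemma indep_of_char_mult:
  fixes X :: "'i \<Rightarrow> 'a \<Rightarrow> real"
  assumes M: "prob_space M" and IJ: "finite I" "finite J" "I \<inter> J = {}"
    and X[measurable]: "\<And>i. X i \<in> borel_measurable M"
    and eq: "\<And>t. (\<integral>x. iexp (\<Sum>i\<in>I \<union> J. t i * X i x) \<partial>M)
      = (\<integral>x. iexp (\<Sum>i\<in>I. t i * X i x) \<partial>M) * (\<integral>x. iexp (\<Sum>i\<in>J. t i * X i x) \<partial>M)"
    and E[measurable]: "E \<in> sets (PiM I (\<lambda>_. borel))" and F[measurable]: "F \<in> sets (PiM J (\<lambda>_. borel))"
  shows "measure M {x\<in>space M. (\<lambda>i\<in>I. X i x) \<in> E \<and> (\<lambda>i\<in>J. X i x) \<in> F}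
    = measure M {x\<in>space M. (\<lambda>i\<in>I. X i x) \<in> E} * measure M {x\<in>space M. (\<lambda>i\<in>J. X i x) \<in> F}"
proof -
  interpret prob_space M by fact
  interpret PP: pair_prob_space M M ..
  define X2 where "X2 = (\<lambda>i p. if i \<in> I then X i (fst p) else X i (snd p))"
  have X2[measurable]: "X2 i \<in> borel_measurable (M \<Otimes>\<^sub>M M)" for i
    unfolding X2_def by (cases "i \<in> I") simp_all
  let ?K = "I \<union> J"
  have D: "distr M (PiM ?K (\<lambda>_. borel)) (\<lambda>x. \<lambda>i\<in>?K. X i x)
      = distr (M \<Otimes>\<^sub>M M) (PiM ?K (\<lambda>_. borel)) (\<lambda>x. \<lambda>i\<in>?K. X2 i x)"
  proof (rule PiM_char_unique[OF M PP.prob_space_axioms _ X X2])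
    show "finite ?K" using IJ by simp
    fix t
    let ?f = "\<lambda>x. iexp (\<Sum>i\<in>I. t i * X i x)" and ?g = "\<lambda>x. iexp (\<Sum>i\<in>J. t i * X i x)"
    have fg: "iexp (\<Sum>i\<in>?K. t i * X2 i (x, y)) = ?f x * ?g y" for x y
    proof -
      have "(\<Sum>i\<in>?K. t i * X2 i (x, y)) = (\<Sum>i\<in>I. t i * X2 i (x, y)) + (\<Sum>i\<in>J. t i * X2 i (x, y))"
        using IJ by (intro sum.union_disjoint) auto
      also have "(\<Sum>i\<in>I. t i * X2 i (x, y)) = (\<Sum>i\<in>I. t i * X i x)"
        by (intro sum.cong) (auto simp: X2_def)
      also have "(\<Sum>i\<in>J. t i * X2 i (x, y)) = (\<Sum>i\<in>J. t i * X i y)"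
        using IJ by (intro sum.cong) (auto simp: X2_def)
      finally show ?thesis by (simp add: exp_add distrib_left)
    qed
    have "integrable (M \<Otimes>\<^sub>M M) (\<lambda>p. iexp (\<Sum>i\<in>?K. t i * X2 i p))"
      by (rule PP.integrable_const_bound[of _ 1]) auto
    then have "(\<integral>p. iexp (\<Sum>i\<in>?K. t i * X2 i p) \<partial>(M \<Otimes>\<^sub>M M)) = (\<integral>x. (\<integral>y. iexp (\<Sum>i\<in>?K. t i * X2 i (x, y)) \<partial>M) \<partial>M)"
      by (rule PP.integral_fst'[symmetric])
    also have "\<dots> = (\<integral>x. ?f x \<partial>M) * (\<integral>x. ?g x \<partial>M)"
      unfolding fg by simp
    also have "\<dots> = (\<integral>x. iexp (\<Sum>i\<in>?K. t i * X i x) \<partial>M)"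
      by (simp only: eq)
    finally show "(\<integral>x. iexp (\<Sum>i\<in>?K. t i * X i x) \<partial>M) = (\<integral>p. iexp (\<Sum>i\<in>?K. t i * X2 i p) \<partial>(M \<Otimes>\<^sub>M M))" ..
  qed
  have r: "restrict (restrict f ?K) I = restrict f I" "restrict (restrict f ?K) J = restrict f J" for f :: "'i \<Rightarrow> real"
    by (auto simp: restrict_def)
  have r2: "(\<lambda>i\<in>I. X2 i p) = (\<lambda>i\<in>I. X i (fst p))" "(\<lambda>i\<in>J. X2 i p) = (\<lambda>i\<in>J. X i (snd p))" for p
    using IJ by (auto simp: restrict_def X2_def fun_eq_iff)
  have [measurable]: "(\<lambda>w. restrict w I) \<in> measurable (PiM ?K (\<lambda>_. borel :: real measure)) (PiM I (\<lambda>_. borel))"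
    "(\<lambda>w. restrict w J) \<in> measurable (PiM ?K (\<lambda>_. borel :: real measure)) (PiM J (\<lambda>_. borel))"
    by (rule measurable_restrict_subset, blast)+
  have XI[measurable]: "(\<lambda>x. \<lambda>i\<in>H. X i x) \<in> measurable M (PiM H (\<lambda>_. borel))" for H
    by (rule measurable_restrict) simp
  have X2I[measurable]: "(\<lambda>x. \<lambda>i\<in>H. X2 i x) \<in> measurable (M \<Otimes>\<^sub>M M) (PiM H (\<lambda>_. borel))" for H
    by (rule measurable_restrict) simp
  let ?G = "{w \<in> space (PiM ?K (\<lambda>_. borel)). restrict w I \<in> E \<and> restrict w J \<in> F}"
  have G[measurable]: "?G \<in> sets (PiM ?K (\<lambda>_. borel))" by measurable
  have "measure M {x\<in>space M. (\<lambda>i\<in>I. X i x) \<in> E \<and> (\<lambda>i\<in>J. X i x) \<in> F}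
      = measure (distr M (PiM ?K (\<lambda>_. borel)) (\<lambda>x. \<lambda>i\<in>?K. X i x)) ?G"
    by (subst measure_distr[OF XI G]) (auto intro!: arg_cong2[where f = measure] simp: r space_PiM)
  also have "\<dots> = measure (distr (M \<Otimes>\<^sub>M M) (PiM ?K (\<lambda>_. borel)) (\<lambda>x. \<lambda>i\<in>?K. X2 i x)) ?G"
    by (simp only: D)
  also have "\<dots> = measure (M \<Otimes>\<^sub>M M) ({x\<in>space M. (\<lambda>i\<in>I. X i x) \<in> E} \<times> {x\<in>space M. (\<lambda>i\<in>J. X i x) \<in> F})"
    by (subst measure_distr[OF X2I G])
      (auto intro!: arg_cong2[where f = measure] simp: r r2 space_PiM space_pair_measure)
  also have "\<dots> = measure M {x\<in>space M. (\<lambda>i\<in>I. X i x) \<in> E} * measure M {x\<in>space M. (\<lambda>i\<in>J. X i x) \<in> F}"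
    by (simp add: measure_def emeasure_pair_measure_Times enn2real_mult)
  finally show ?thesis .
qed

text \<open>The sign of \<open>Q\<close> is not assumed; it follows from the bound 1 on the modulus
  of a characteristic function. The law is then that of \<open>sqrt Q\<close> times a standard
  normal variable, which includes the degenerate case \<open>Q = 0\<close>.\<close>

lemma centered_normal_mgf:
  assumes M: "prob_space M" and Y[measurable]: "Y \<in> borel_measurable M"
    and ch: "\<And>t. char (distr M borel Y) t = complex_of_real (exp (- (Q * t\<^sup>2) / 2))"
  shows "integrable M (\<lambda>x. exp (Y x))" "(\<integral>x. exp (Y x) \<partial>M) = exp (Q / 2)"
proof -
  interpret prob_space M by fact
  interpret D: real_distribution "distr M borel Y" by simp
  have "norm (char (distr M borel Y) 1) \<le> 1" by (rule D.cmod_char_le_1)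
  then have Q: "0 \<le> Q" unfolding ch by simp
  define s where "s = sqrt Q"
  have s: "s\<^sup>2 = Q" using Q by (simp add: s_def)
  interpret S: real_distribution std_normal_distribution by (rule real_dist_normal_dist)
  have eq: "distr M borel Y = distr std_normal_distribution borel (\<lambda>x. s * x)"
  proof (rule Levy_uniqueness)
    show "real_distribution (distr std_normal_distribution borel (\<lambda>x. s * x))" by simp
    show "char (distr M borel Y) = char (distr std_normal_distribution borel (\<lambda>x. s * x))"
    proof
      fix t
      have "char (distr std_normal_distribution borel (\<lambda>x. s * x)) t = char std_normal_distribution (s * t)"
        unfolding char_def by (subst integral_distr) (auto simp: mult_ac)
      also have "\<dots> = complex_of_real (exp (- (Q * t\<^sup>2) / 2))"
        by (simp add: char_std_normal_distribution power_mult_distrib s)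
      finally show "char (distr M borel Y) t = char (distr std_normal_distribution borel (\<lambda>x. s * x)) t"
        by (simp add: ch)
    qed
  qed (rule D.real_distribution_axioms)
  have dens: "std_normal_density x * exp (s * x) = exp (Q / 2) * normal_density s 1 x" for x
    unfolding normal_density_def s[symmetric] by (simp add: power2_eq_square field_simps flip: exp_add)
  have i0: "integrable std_normal_distribution (\<lambda>x. exp (s * x))"
    by (subst integrable_density) (auto simp: dens)
  have I0: "(\<integral>x. exp (s * x) \<partial>std_normal_distribution) = exp (Q / 2)"
    by (subst integral_density) (auto simp: dens)
  have "integrable (distr M borel Y) exp"
    unfolding eq by (subst integrable_distr_eq) (auto simp: i0)
  then show "integrable M (\<lambda>x. exp (Y x))" by (subst (asm) integrable_distr_eq) auto
  have "(\<integral>x. exp (Y x) \<partial>M) = (\<integral>y. exp y \<partial>distr M borel Y)"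
    by (subst integral_distr) auto
  also have "\<dots> = (\<integral>x. exp (s * x) \<partial>std_normal_distribution)"
    unfolding eq by (subst integral_distr) auto
  finally show "(\<integral>x. exp (Y x) \<partial>M) = exp (Q / 2)" by (simp add: I0)
qed

text \<open>The Gaussian clause of \<open>is_dgff\<close> for arbitrary index sets, so that smoothed
  fields, block fields and harmonic parts are handled by the same lemmas. \<open>K\<close> enters
  only through its quadratic form on \<open>I\<close>.\<close>

definition gfam :: "'a measure \<Rightarrow> 'i set \<Rightarrow> ('i \<Rightarrow> 'a \<Rightarrow> real) \<Rightarrow> ('i \<Rightarrow> 'i \<Rightarrow> real) \<Rightarrow> bool" where
  "gfam M I X K \<longleftrightarrow> prob_space M \<and> finite I \<and> (\<forall>i. X i \<in> borel_measurable M) \<and>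
    (\<forall>a t. char (distr M borel (\<lambda>\<omega>. \<Sum>i\<in>I. a i * X i \<omega>)) t
      = complex_of_real (exp (- ((\<Sum>i\<in>I. \<Sum>j\<in>I. a i * a j * K i j) * t\<^sup>2) / 2)))"

lemma gfamD:
  assumes "gfam M I X K"
  shows "prob_space M" "finite I" "\<And>i. X i \<in> borel_measurable M"
    "\<And>a t. char (distr M borel (\<lambda>\<omega>. \<Sum>i\<in>I. a i * X i \<omega>)) t
      = complex_of_real (exp (- ((\<Sum>i\<in>I. \<Sum>j\<in>I. a i * a j * K i j) * t\<^sup>2) / 2))"
  using assms unfolding gfam_def by blast+

lemma gfam_mgf:
  assumes "gfam M I X K"
  shows "integrable M (\<lambda>\<omega>. exp (\<Sum>i\<in>I. a i * X i \<omega>))"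
    "(\<integral>\<omega>. exp (\<Sum>i\<in>I. a i * X i \<omega>) \<partial>M) = exp ((\<Sum>i\<in>I. \<Sum>j\<in>I. a i * a j * K i j) / 2)"
proof -
  note [measurable] = gfamD(3)[OF assms]
  have "(\<lambda>\<omega>. \<Sum>i\<in>I. a i * X i \<omega>) \<in> borel_measurable M" by measurable
  note centered_normal_mgf[OF gfamD(1)[OF assms] this gfamD(4)[OF assms]]
  then show "integrable M (\<lambda>\<omega>. exp (\<Sum>i\<in>I. a i * X i \<omega>))"
    "(\<integral>\<omega>. exp (\<Sum>i\<in>I. a i * X i \<omega>) \<partial>M) = exp ((\<Sum>i\<in>I. \<Sum>j\<in>I. a i * a j * K i j) / 2)"
    by auto
qed

lemma gfam_linear:
  assumes g: "gfam M I X K" and J: "finite J" and Y: "\<And>j. Y j \<in> borel_measurable M"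
    and c: "\<And>j \<omega>. j \<in> J \<Longrightarrow> \<omega> \<in> space M \<Longrightarrow> Y j \<omega> = (\<Sum>i\<in>I. c j i * X i \<omega>)"
    and K': "\<And>j j'. j \<in> J \<Longrightarrow> j' \<in> J \<Longrightarrow> K' j j' = (\<Sum>i\<in>I. \<Sum>i'\<in>I. c j i * c j' i' * K i i')"
  shows "gfam M J Y K'"
  unfolding gfam_def
proof (intro conjI allI)
  show "prob_space M" "finite J" "\<And>j. Y j \<in> borel_measurable M" using gfamD(1)[OF g] J Y by auto
  fix a :: "'c \<Rightarrow> real" and t :: real
  define b where "b = (\<lambda>i. \<Sum>j\<in>J. a j * c j i)"
  have 1: "(\<Sum>j\<in>J. a j * Y j \<omega>) = (\<Sum>i\<in>I. b i * X i \<omega>)" if "\<omega> \<in> space M" for \<omega>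
  proof -
    have "(\<Sum>j\<in>J. a j * Y j \<omega>) = (\<Sum>j\<in>J. \<Sum>i\<in>I. a j * (c j i * X i \<omega>))"
      by (intro sum.cong refl) (simp add: c[OF _ that] sum_distrib_left)
    also have "\<dots> = (\<Sum>i\<in>I. \<Sum>j\<in>J. a j * (c j i * X i \<omega>))" by (rule sum.swap)
    finally show ?thesis by (simp add: b_def sum_distrib_right mult.assoc)
  qed
  have "(\<Sum>i\<in>I. \<Sum>i'\<in>I. b i * b i' * K i i') = (\<Sum>i\<in>I. \<Sum>i'\<in>I. \<Sum>j\<in>J. \<Sum>j'\<in>J. a j * a j' * (c j i * c j' i' * K i i'))"
    unfolding b_def sum_product unfolding sum_distrib_right by (intro sum.cong refl) (simp add: mult_ac)
  also have "\<dots> = (\<Sum>i\<in>I. \<Sum>j\<in>J. \<Sum>i'\<in>I. \<Sum>j'\<in>J. a j * a j' * (c j i * c j' i' * K i i'))"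
    by (intro sum.cong refl sum.swap)
  also have "\<dots> = (\<Sum>j\<in>J. \<Sum>i\<in>I. \<Sum>i'\<in>I. \<Sum>j'\<in>J. a j * a j' * (c j i * c j' i' * K i i'))"
    by (rule sum.swap)
  also have "\<dots> = (\<Sum>j\<in>J. \<Sum>i\<in>I. \<Sum>j'\<in>J. \<Sum>i'\<in>I. a j * a j' * (c j i * c j' i' * K i i'))"
    by (intro sum.cong refl sum.swap)
  also have "\<dots> = (\<Sum>j\<in>J. \<Sum>j'\<in>J. \<Sum>i\<in>I. \<Sum>i'\<in>I. a j * a j' * (c j i * c j' i' * K i i'))"
    by (intro sum.cong refl sum.swap)
  also have "\<dots> = (\<Sum>j\<in>J. \<Sum>j'\<in>J. a j * a j' * K' j j')"
    by (intro sum.cong refl) (simp add: K' sum_distrib_left)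
  finally have 2: "(\<Sum>j\<in>J. \<Sum>j'\<in>J. a j * a j' * K' j j') = (\<Sum>i\<in>I. \<Sum>i'\<in>I. b i * b i' * K i i')" ..
  have "distr M borel (\<lambda>\<omega>. \<Sum>j\<in>J. a j * Y j \<omega>) = distr M borel (\<lambda>\<omega>. \<Sum>i\<in>I. b i * X i \<omega>)"
    by (rule distr_cong) (auto simp: 1)
  then show "char (distr M borel (\<lambda>\<omega>. \<Sum>j\<in>J. a j * Y j \<omega>)) t
      = complex_of_real (exp (- ((\<Sum>j\<in>J. \<Sum>j'\<in>J. a j * a j' * K' j j') * t\<^sup>2) / 2))"
    unfolding 2 by (simp add: gfamD(4)[OF g])
qed

lemma gfam_iexp:
  assumes "gfam M I X K"
  shows "(\<integral>\<omega>. iexp (\<Sum>i\<in>I. a i * X i \<omega>) \<partial>M) = complex_of_real (exp (- (\<Sum>i\<in>I. \<Sum>j\<in>I. a i * a j * K i j) / 2))"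
proof -
  note [measurable] = gfamD(3)[OF assms]
  show ?thesis
    using gfamD(4)[OF assms, of a 1] unfolding char_def
    by (subst (asm) integral_distr) auto
qed

lemma gfam_subset:
  assumes g: "gfam M I X K" and "J \<subseteq> I"
  shows "gfam M J X K"
proof -
  have I: "finite I" by (rule gfamD(2)[OF g])
  have d: "(\<Sum>i\<in>I. (if i = j then 1 else 0) * f i) = f j" if "j \<in> J" for f :: "'b \<Rightarrow> real" and j
  proof -
    have "(\<Sum>i\<in>I. (if i = j then 1 else 0) * f i) = (\<Sum>i\<in>I. if i = j then f i else 0)"
      by (intro sum.cong) auto
    then show ?thesis using that I assms(2) by (auto simp: sum.delta)
  qed
  show ?thesis
  proof (rule gfam_linear[OF g, where c = "\<lambda>j i. if i = j then 1 else 0"])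
    show "finite J" using I assms(2) by (rule finite_subset[rotated])
    show "X j \<in> borel_measurable M" for j by (rule gfamD(3)[OF g])
    show "X j \<omega> = (\<Sum>i\<in>I. (if i = j then 1 else 0) * X i \<omega>)" if "j \<in> J" for j \<omega>
      using d[OF that] by simp
    show "K j j' = (\<Sum>i\<in>I. \<Sum>i'\<in>I. (if i = j then 1 else 0) * (if i' = j' then 1 else 0) * K i i')"
      if "j \<in> J" "j' \<in> J" for j j'
      unfolding mult.assoc sum_distrib_left[symmetric] d[OF that(1)] d[OF that(2)] ..
  qed
qed

text \<open>Vanishing cross-covariances split the quadratic form, so the joint characteristic
  function factorises.\<close>

lemma gfam_indep:
  assumes g: "gfam M (I \<union> J) X K" and IJ: "I \<inter> J = {}"
    and K: "\<And>i j. i \<in> I \<Longrightarrow> j \<in> J \<Longrightarrow> K i j = 0 \<and> K j i = 0"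
    and E: "E \<in> sets (PiM I (\<lambda>_. borel))" and F: "F \<in> sets (PiM J (\<lambda>_. borel))"
  shows "measure M {x\<in>space M. (\<lambda>i\<in>I. X i x) \<in> E \<and> (\<lambda>i\<in>J. X i x) \<in> F}
    = measure M {x\<in>space M. (\<lambda>i\<in>I. X i x) \<in> E} * measure M {x\<in>space M. (\<lambda>i\<in>J. X i x) \<in> F}"
proof (rule indep_of_char_mult[OF gfamD(1)[OF g] _ _ IJ gfamD(3)[OF g] _ E F])
  show fin: "finite I" "finite J" using gfamD(2)[OF g] by auto
  fix t
  have u: "(\<Sum>i\<in>I \<union> J. f i) = (\<Sum>i\<in>I. f i) + (\<Sum>i\<in>J. f i)" for f :: "'b \<Rightarrow> real"
    using fin IJ by (rule sum.union_disjoint)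
  have "(\<Sum>i\<in>I \<union> J. \<Sum>j\<in>I \<union> J. t i * t j * K i j)
      = (\<Sum>i\<in>I. \<Sum>j\<in>I. t i * t j * K i j) + (\<Sum>i\<in>J. \<Sum>j\<in>J. t i * t j * K i j)"
    using K by (simp add: u sum.distrib)
  moreover have "exp (- (A + B) / 2) = exp (- A / 2) * exp (- B / 2)" for A B :: real
    by (subst exp_add[symmetric]) (simp add: field_simps)
  ultimately show "(\<integral>x. iexp (\<Sum>i\<in>I \<union> J. t i * X i x) \<partial>M)
      = (\<integral>x. iexp (\<Sum>i\<in>I. t i * X i x) \<partial>M) * (\<integral>x. iexp (\<Sum>i\<in>J. t i * X i x) \<partial>M)"
    unfolding gfam_iexp[OF g] gfam_iexp[OF gfam_subset[OF g Un_upper1]] gfam_iexp[OF gfam_subset[OF g Un_upper2]]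
    by (simp only: of_real_mult)
qed

lemma is_dgff_gfam:
  assumes "prob_space M" "is_dgff M N Phi"
  shows "gfam M (intVN N) (\<lambda>x \<omega>. Phi \<omega> x) (greenN N)"
  using assms unfolding gfam_def is_dgff_def
  by (auto simp: intVN_def bdryVN_def VN_def)

section \<open>High plateaus with polynomially small probability\<close>

text \<open>The critical tilt: \<open>gam^2 g / 2 = 2\<close> balances the exponential moment with
  the entropy of \<open>N^2\<close> sites, and the tilted mean
  \<open>gam g ln N = 2 sqrt g ln N\<close> is the level of the maximum.\<close>

definition gam :: real where "gam = 2 / sqrt g_const"

lemma g_const_pos: "0 < g_const" by (simp add: g_const_def)

lemma gam_pos: "0 < gam" by (simp add: gam_def g_const_pos)

lemma gam_g: "gam * g_const = 2 * sqrt g_const"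
  using g_const_pos by (simp add: gam_def field_simps flip: real_sqrt_mult)

lemma gam_sq_g: "gam * gam * g_const = 4"
  using g_const_pos by (simp add: gam_def field_simps flip: real_sqrt_mult)

text \<open>The killed heat semigroup at time \<open>m\<close> applied to the field, an average over
  the scale \<open>sqrt m\<close>.\<close>

definition smooth :: "nat \<Rightarrow> (site \<Rightarrow> 'a \<Rightarrow> real) \<Rightarrow> nat \<Rightarrow> site \<Rightarrow> 'a \<Rightarrow> real" where
  "smooth N X m x \<omega> = (\<Sum>z\<in>intVN N. kw N m x z * X z \<omega>)"

lemma smooth_0: "x \<in> intVN N \<Longrightarrow> smooth N X 0 x \<omega> = X x \<omega>"
proof -
  assume x: "x \<in> intVN N"
  have "smooth N X 0 x \<omega> = (\<Sum>z\<in>intVN N. if x = z then X z \<omega> else 0)"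
    unfolding smooth_def using x by (intro sum.cong) auto
  then show ?thesis using x by (simp add: sum.delta)
qed

text \<open>With \<open>P\<close> the killed transition matrix, the covariance is the matrix
  \<open>P^m G P^m'\<close>, where \<open>G\<close> is the sum of all powers of \<open>P\<close> and
  \<open>P\<close> is symmetric; this is the sum from \<open>m + m'\<close> on.\<close>

lemma gfam_smooth:
  assumes g: "gfam M (intVN N) X (greenN N)" and J: "finite J"
  shows "gfam M J (\<lambda>j. smooth N X (m j) (x j)) (\<lambda>j j'. tailG N (m j + m j') (x j) (x j'))"
proof (rule gfam_linear[OF g J])
  note [measurable] = gfamD(3)[OF g]
  show "smooth N X (m j) (x j) \<in> borel_measurable M" for j
    unfolding smooth_def[abs_def] by measurable
  show "smooth N X (m j) (x j) \<omega> = (\<Sum>i\<in>intVN N. kw N (m j) (x j) i * X i \<omega>)" for j \<omega>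
    by (simp add: smooth_def)
  show "tailG N (m j + m j') (x j) (x j')
      = (\<Sum>i\<in>intVN N. \<Sum>i'\<in>intVN N. kw N (m j) (x j) i * kw N (m j') (x j') i' * greenN N i i')" for j j'
  proof -
    have "(\<Sum>i\<in>intVN N. \<Sum>i'\<in>intVN N. kw N (m j) (x j) i * kw N (m j') (x j') i' * greenN N i i')
        = (\<Sum>i\<in>intVN N. kw N (m j) (x j) i * (\<Sum>i'\<in>intVN N. kw N (m j') (x j') i' * tailG N 0 i' i))"
      unfolding greenN_tailG sum_distrib_left by (subst tailG_sym) (simp add: mult.assoc)
    also have "\<dots> = (\<Sum>i\<in>intVN N. kw N (m j) (x j) i * tailG N (m j') i (x j'))"
      by (intro sum.cong refl arg_cong2[where f = "(*)"]) (simp add: kw_tailG, rule tailG_sym)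
    also have "\<dots> = tailG N (m j + m j') (x j) (x j')"
      by (rule kw_tailG)
    finally show ?thesis ..
  qed
qed

lemma smooth_mgf:
  assumes g: "gfam M (intVN N) X (greenN N)"
  shows "has_bochner_integral M
    (\<lambda>\<omega>. exp (a * smooth N X m1 x1 \<omega> + b * smooth N X m2 x2 \<omega> + c * smooth N X m3 x3 \<omega>))
    (exp ((a * a * tailG N (m1 + m1) x1 x1 + b * b * tailG N (m2 + m2) x2 x2 + c * c * tailG N (m3 + m3) x3 x3
      + 2 * a * b * tailG N (m1 + m2) x1 x2 + 2 * a * c * tailG N (m1 + m3) x1 x3
      + 2 * b * c * tailG N (m2 + m3) x2 x3) / 2))"
proof -
  define m where "m = (\<lambda>j::nat. if j = 0 then m1 else if j = 1 then m2 else m3)"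
  define x where "x = (\<lambda>j::nat. if j = 0 then x1 else if j = 1 then x2 else x3)"
  define d where "d = (\<lambda>j::nat. if j = 0 then a else if j = 1 then b else c)"
  have gf: "gfam M {0, 1, 2} (\<lambda>j. smooth N X (m j) (x j)) (\<lambda>j j'. tailG N (m j + m j') (x j) (x j'))"
    using g by (rule gfam_smooth) simp
  have s: "tailG N (m2 + m1) x2 x1 = tailG N (m1 + m2) x1 x2" "tailG N (m3 + m1) x3 x1 = tailG N (m1 + m3) x1 x3"
    "tailG N (m3 + m2) x3 x2 = tailG N (m2 + m3) x2 x3"
    by (subst tailG_sym, simp add: add.commute)+
  show ?thesis
    unfolding has_bochner_integral_iff
    using gfam_mgf[OF gf, of d]
    by (simp add: m_def x_def d_def s) (simp add: algebra_simps)
qed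

text \<open>The Cauchy-Schwarz lower bound for the probability that \<open>Z\<close> is nonzero, in
  pointwise form. The majorant \<open>F\<close> of the square is what gets integrated, so the
  truncation can be relaxed to exponentials inside the second moment.\<close>

lemma second_moment_bound:
  assumes M: "prob_space M" and [measurable]: "Z \<in> borel_measurable M" "B \<in> sets M"
    and Z: "\<And>\<omega>. \<omega> \<in> space M \<Longrightarrow> 0 \<le> Z \<omega>" "\<And>\<omega>. \<omega> \<in> space M \<Longrightarrow> \<omega> \<notin> B \<Longrightarrow> Z \<omega> = 0"
    and i: "integrable M Z" "integrable M F"
    and F: "\<And>\<omega>. \<omega> \<in> space M \<Longrightarrow> (Z \<omega>)\<^sup>2 \<le> F \<omega>"
    and m: "0 < m" "m \<le> (\<integral>\<omega>. Z \<omega> \<partial>M)" and v: "0 < v" "(\<integral>\<omega>. F \<omega> \<partial>M) \<le> v"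
  shows "m\<^sup>2 / v \<le> measure M B"
proof -
  interpret prob_space M by fact
  \<comment> \<open>The weight in \<open>Z \<le> a F / 2 + 1 / (2 a)\<close> on \<open>B\<close>,
    chosen so that the first term integrates to at most half of \<open>m\<close>.\<close>
  define a where "a = m / v"
  have a: "0 < a" using m v by (simp add: a_def)
  have pw: "Z \<omega> \<le> a / 2 * F \<omega> + 1 / (2 * a) * indicator B \<omega>" if "\<omega> \<in> space M" for \<omega>
  proof (cases "\<omega> \<in> B")
    case True
    have "0 \<le> (a * Z \<omega> - 1)\<^sup>2" by simp
    then have "2 * a * Z \<omega> \<le> a * a * (Z \<omega>)\<^sup>2 + 1"
      by (simp add: power2_eq_square algebra_simps)
    also have "\<dots> \<le> a * a * F \<omega> + 1"
      using F[OF that] a by (simp add: mult_left_mono)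
    finally have "Z \<omega> \<le> (a * a * F \<omega> + 1) / (2 * a)"
      using a by (simp add: le_divide_eq mult_ac)
    also have "\<dots> = a / 2 * F \<omega> + 1 / (2 * a)"
      using a by (simp add: field_simps)
    finally show ?thesis using True by simp
  next
    case False
    have "0 \<le> F \<omega>" using F[OF that] by (rule order.trans[rotated]) simp
    then show ?thesis using Z(2)[OF that False] a False by simp
  qed
  have "m \<le> (\<integral>\<omega>. a / 2 * F \<omega> + 1 / (2 * a) * indicator B \<omega> \<partial>M)"
    using m(2) by (rule order.trans) (intro integral_mono i Bochner_Integration.integrable_add integrable_mult_right pw; simp add: integrable_indicator_iff emeasure_eq_measure)
  also have "\<dots> = a / 2 * (\<integral>\<omega>. F \<omega> \<partial>M) + 1 / (2 * a) * prob B"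
    using i by (subst Bochner_Integration.integral_add) (simp_all add: emeasure_eq_measure)
  also have "\<dots> \<le> a / 2 * v + 1 / (2 * a) * prob B"
    using v a by simp
  also have "\<dots> = m / 2 + v * prob B / (2 * m)"
    using m v by (simp add: a_def)
  finally have "m / 2 \<le> v * prob B / (2 * m)" by linarith
  then have "m / 2 * (2 * m) \<le> v * prob B / (2 * m) * (2 * m)"
    using m by (intro mult_right_mono) auto
  then show ?thesis
    using m v by (simp add: divide_le_eq power2_eq_square mult.commute)
qed

lemma sball_subset: "{y. sdist x y \<le> r} \<subseteq> {fst x - \<lfloor>r\<rfloor>..fst x + \<lfloor>r\<rfloor>} \<times> {snd x - \<lfloor>r\<rfloor>..snd x + \<lfloor>r\<rfloor>}"
  unfolding sdist_def le_floor_iff[symmetric] by auto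

lemma finite_sball: "finite {y. sdist x y \<le> r}"
  by (rule finite_subset[OF sball_subset]) simp

lemma card_sball:
  assumes "0 \<le> r"
  shows "real (card {y. sdist x y \<le> r}) \<le> (2 * r + 1)\<^sup>2"
proof -
  have "card {y. sdist x y \<le> r} \<le> card ({fst x - \<lfloor>r\<rfloor>..fst x + \<lfloor>r\<rfloor>} \<times> {snd x - \<lfloor>r\<rfloor>..snd x + \<lfloor>r\<rfloor>})"
    by (rule card_mono[OF _ sball_subset]) simp
  also have "\<dots> = (nat (2 * \<lfloor>r\<rfloor> + 1))\<^sup>2"
    by (simp add: card_cartesian_product power2_eq_square algebra_simps)
  finally have "real (card {y. sdist x y \<le> r}) \<le> real ((nat (2 * \<lfloor>r\<rfloor> + 1))\<^sup>2)"
    by (rule of_nat_mono)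
  also have "\<dots> = (2 * real_of_int \<lfloor>r\<rfloor> + 1)\<^sup>2"
    using assms by simp
  also have "\<dots> \<le> (2 * r + 1)\<^sup>2"
    using assms by (intro power_mono) auto
  finally show ?thesis .
qed

text \<open>Candidate centres at spacing about \<open>N^b\<close>: there are about
  \<open>N^(2 (1 - b))\<close> of them, which matches the variance \<open>g (1 - b) ln N\<close> of
  the field at that scale under the critical tilt.\<close>

lemma grid_exists:
  assumes b: "0 < b" "b < 1"
  shows "\<forall>\<^sub>F N in sequentially. \<exists>P. finite P \<and> (\<forall>x\<in>P. real N / 4 \<le> depth N x)
    \<and> real N powr (2 * (1 - b)) / 64 \<le> real (card P)
    \<and> (\<forall>x\<in>P. \<forall>r. real N powr b \<le> r \<longrightarrow> real (card {y\<in>P. sdist x y \<le> r}) \<le> 9 * (r / real N powr b)\<^sup>2)"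
proof -
  have "\<forall>\<^sub>F N in sequentially. real N powr (1 - b) / 8 \<le> (real N / 2 - 1) / (2 * real N powr b) - 1"
    using b by real_asymp
  moreover have "\<forall>\<^sub>F N in sequentially. (2::nat) \<le> N"
    by (rule eventually_ge_at_top)
  ultimately show ?thesis
  proof eventually_elim
    case (elim N)
    define w where "w = \<lceil>real N powr b\<rceil>"
    have p1: "1 \<le> real N powr b" using elim(2) b by (intro ge_one_powr_ge_zero) auto
    have w: "real N powr b \<le> real_of_int w" "real_of_int w \<le> 2 * real N powr b" "0 < w"
      using p1 unfolding w_def by linarith+
    \<comment> \<open>The extra 1 at the lower end makes up for \<open>depth\<close> being measured
      from coordinate 1.\<close>
    define I where "I = {\<lceil>(real N / 4 + 1) / w\<rceil>..\<lfloor>(3 * real N / 4) / w\<rfloor>}"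
    define f where "f = (\<lambda>p::site. (w * fst p, w * snd p))"
    have inj: "inj f" using w(3) by (auto simp: f_def inj_def)
    define P where "P = f ` (I \<times> I)"
    have I: "real N / 4 + 1 \<le> real_of_int (w * i)" "real_of_int (w * i) \<le> 3 * real N / 4" if "i \<in> I" for i
      using that w(3) unfolding I_def by (auto simp: ceiling_le_iff le_floor_iff field_simps)
    have cI: "real N powr (1 - b) / 8 \<le> real (card I)"
    proof -
      note elim(1)
      also have "(real N / 2 - 1) / (2 * real N powr b) - 1 \<le> (real N / 2 - 1) / w - 1"
        using w elim(2) by (intro diff_right_mono divide_left_mono) auto
      also have "\<dots> = (3 * real N / 4) / w - (real N / 4 + 1) / w - 1"
        by (simp add: diff_divide_distrib add_divide_distrib)
      also have "\<dots> \<le> real_of_int (\<lfloor>(3 * real N / 4) / w\<rfloor> - \<lceil>(real N / 4 + 1) / w\<rceil> + 1)"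
        by linarith
      also have "\<dots> \<le> real (card I)"
        unfolding I_def by simp
      finally show ?thesis .
    qed
    have "finite P" by (simp add: P_def I_def)
    moreover have "real N / 4 \<le> depth N x" if "x \<in> P" for x
      using that I unfolding P_def f_def depth_def by force
    moreover have "real N powr (2 * (1 - b)) / 64 \<le> real (card P)"
    proof -
      have "card P = (card I)\<^sup>2"
        unfolding P_def by (subst card_image) (auto intro: inj_on_subset[OF inj] simp: card_cartesian_product power2_eq_square)
      moreover have "(real N powr (1 - b) / 8)\<^sup>2 \<le> (real (card I))\<^sup>2"
        using cI by (intro power_mono) auto
      moreover have "(real N powr (1 - b))\<^sup>2 = real N powr (2 * (1 - b))"
        by (simp add: power2_eq_square flip: powr_add)
      ultimately show ?thesis by (simp add: power_divide)
    qed
    moreover have "real (card {y\<in>P. sdist x y \<le> r}) \<le> 9 * (r / real N powr b)\<^sup>2"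
      if x: "x \<in> P" and r: "real N powr b \<le> r" for x r
    proof -
      from x obtain p where p: "x = f p" by (auto simp: P_def)
      have "{y\<in>P. sdist x y \<le> r} \<subseteq> f ` {q. sdist p q \<le> r / w}"
      proof
        fix y assume "y \<in> {y\<in>P. sdist x y \<le> r}"
        then obtain q where q: "y = f q" "sdist (f p) (f q) \<le> r" by (auto simp: P_def p)
        have "max (w * a) (w * c) = w * max a c" for a c
          using w(3) by (auto simp: max_def)
        then have "sdist (f p) (f q) = w * sdist p q"
          using w(3) by (simp add: sdist_def f_def abs_mult flip: right_diff_distrib)
        with q w show "y \<in> f ` {q. sdist p q \<le> r / w}" by (auto simp: field_simps)
      qed
      then have "card {y\<in>P. sdist x y \<le> r} \<le> card (f ` {q. sdist p q \<le> r / w})"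
        by (intro card_mono finite_imageI finite_sball)
      also have "\<dots> \<le> card {q. sdist p q \<le> r / w}" by (intro card_image_le finite_sball)
      finally have "real (card {y\<in>P. sdist x y \<le> r}) \<le> real (card {q. sdist p q \<le> r / w})" by simp
      also have "\<dots> \<le> (2 * (r / w) + 1)\<^sup>2"
        using r p1 w by (intro card_sball) auto
      also have "\<dots> \<le> (3 * (r / real N powr b))\<^sup>2"
      proof (rule power_mono)
        have "r / w \<le> r / real N powr b" using w p1 r elim(2) by (intro divide_left_mono mult_pos_pos) auto
        moreover have "1 \<le> r / real N powr b" using r p1 by (subst le_divide_eq_1_pos) linarith+
        ultimately show "2 * (r / w) + 1 \<le> 3 * (r / real N powr b)" by linarith
        show "0 \<le> 2 * (r / w) + 1" using r p1 w by simp
      qed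
      finally show ?thesis by (simp add: power_mult_distrib power_divide)
    qed
    ultimately show ?case by blast
  qed
qed

text \<open>Truncated second moment at the critical tilt \<open>gam = 2 / sqrt g\<close>. The weight of a grid point is the
  exponential of the field smoothed at scale \<open>N^b\<close>; it is kept only if the field smoothed at the
  intermediate scales \<open>N^(al k)\<close> stays below the line \<open>gam g (1 - al k) ln N\<close> and the field near
  the point does not drop below its typical minimum. Pairs of points at distance about \<open>N^(al k)\<close>
  are handled by the constraint at level \<open>k\<close>.\<close>

locale ml_setup =
  fixes M :: "'a measure" and N :: nat and X :: "site \<Rightarrow> 'a \<Rightarrow> real" and b e d s L :: real
    and K :: nat and al :: "nat \<Rightarrow> real" and t :: "nat \<Rightarrow> nat" and P :: "site set"
  assumes g: "gfam M (intVN N) X (greenN N)"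
    and L_def: "L = ln (real N)" and al_def: "\<And>k. al k = 1 - (1 - b) * real k / real K"
    and t_def: "\<And>k. t k = nat \<lfloor>real N powr (2 * al k)\<rfloor>"
    and N: "2 \<le> N" and b: "0 < b" "b < 1" and K: "0 < K" and e: "0 < e" and d: "0 < d" and s: "0 < s"
    and U: "\<And>k x y m. k \<le> K \<Longrightarrow> real N powr (2 * al k) \<le> real m + 1 \<Longrightarrow>
        tailG N m x y \<le> (g_const * (1 - al k) + e) * L"
    and U0: "\<And>x. tailG N 0 x x \<le> (g_const + e) * L"
    and Far: "\<And>k x y m. k \<le> K \<Longrightarrow> real N powr (al k) \<le> sdist x y \<Longrightarrow>
        tailG N m x y \<le> (g_const * (1 - al k) + e) * L"
    and Lo: "\<And>k x y m. k \<le> K \<Longrightarrow> real N / 6 \<le> depth N x \<Longrightarrow> sdist x y \<le> real N powr (al k) \<Longrightarrow>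
        real m \<le> 5 * real N powr (2 * al k) \<Longrightarrow> (g_const * (1 - al k) - e) * L \<le> tailG N m x y"
    and P: "finite P" "P \<noteq> {}" "\<And>x. x \<in> P \<Longrightarrow> real N / 4 \<le> depth N x"
        "\<And>x r. x \<in> P \<Longrightarrow> real N powr b \<le> r \<Longrightarrow>
          real (card {y\<in>P. sdist x y \<le> r}) \<le> 9 * (r / real N powr b)\<^sup>2"
    and Nb: "real N powr b + real N / 6 \<le> real N / 4"
    and viol: "(real K + 2) * exp (- ((s * d - s * s * (g_const + e) / 2 - gam * s * e) * L))
      + 9 * exp (- ((gam * d - 4 * gam * gam * e) * L)) \<le> 1 / 2"
begin

section \<open>Moments of the truncated weights\<close>

abbreviation "T \<equiv> tailG N"

definition "C k x \<omega> = smooth N X (t k) x \<omega>"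

text \<open>Under the tilt by \<open>gam * C K x\<close> the variable \<open>C k x\<close> has mean
  about \<open>gam g (1 - al k) ln N\<close>, since its covariance with \<open>C K x\<close> is
  about \<open>g (1 - al k) ln N\<close>. So \<open>q k\<close> is the typical value plus the slack
  \<open>d\<close>.\<close>

definition "q k = (gam * g_const * (1 - al k) + d) * L"

definition "w0 x = exp (gam * gam * T (t K + t K) x x / 2)"

lemma L_pos: "0 < L" using N by (simp add: L_def)

lemma powr_exp: "real N powr a = exp (a * L)"
  using N by (simp add: powr_def L_def)

lemma al_K: "al K = b" using K by (simp add: al_def)

lemma al_0: "al 0 = 1" by (simp add: al_def)

lemma al_antimono: "j \<le> k \<Longrightarrow> al k \<le> al j"
  unfolding al_def using b K by (intro diff_left_mono divide_right_mono mult_left_mono) auto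

lemma al_bounds:
  assumes "k \<le> K"
  shows "b \<le> al k" "al k \<le> 1"
  using assms al_antimono[of k K] al_antimono[of 0 k] by (simp_all add: al_K al_0)

lemma al_Suc: "al k - al (Suc k) \<le> 1 / real K"
  unfolding al_def using b K by (simp add: field_simps)

lemma t_bounds: "real N powr (2 * al k) \<le> real (t k) + 1" "real (t k) \<le> real N powr (2 * al k)"
proof -
  have "0 \<le> real N powr (2 * al k)" by simp
  then show "real N powr (2 * al k) \<le> real (t k) + 1" "real (t k) \<le> real N powr (2 * al k)"
    unfolding t_def by linarith+
qed

lemma t_K_le: "k \<le> K \<Longrightarrow> real (t K) \<le> real N powr (2 * al k)"
proof -
  assume "k \<le> K"
  then have "real N powr (2 * al K) \<le> real N powr (2 * al k)"
    using al_antimono N by (intro powr_mono) auto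
  with t_bounds(2)[of K] show ?thesis by linarith
qed

lemma cov_upper: "k \<le> K \<Longrightarrow> T (m + t k) x y \<le> (g_const * (1 - al k) + e) * L"
  using t_bounds(1)[of k] by (intro U) auto

lemma cov_lower:
  assumes "k \<le> K" "real N / 6 \<le> depth N x" "sdist x y \<le> real N powr (al k)"
  shows "(g_const * (1 - al k) - e) * L \<le> T (t K + t k) x y"
proof (rule Lo[OF assms])
  have "real (t K + t k) \<le> 2 * real N powr (2 * al k)"
    using t_K_le[OF assms(1)] t_bounds(2)[of k] by simp
  also have "\<dots> \<le> 5 * real N powr (2 * al k)" by simp
  finally show "real (t K + t k) \<le> 5 * real N powr (2 * al k)" .
qed

lemma depth6: "x \<in> P \<Longrightarrow> real N / 6 \<le> depth N x"
  using P(3)[of x] by simp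

lemma sdist_self [simp]: "sdist x x = 0" by (simp add: sdist_def)

lemma C_meas [measurable]: "C k x \<in> borel_measurable M"
proof -
  note [measurable] = gfamD(3)[OF g]
  show ?thesis unfolding C_def[abs_def] smooth_def by measurable
qed

lemma mgf3:
  "has_bochner_integral M (\<lambda>\<omega>. exp (a1 * smooth N X m1 x1 \<omega> + a2 * smooth N X m2 x2 \<omega> + a3 * smooth N X m3 x3 \<omega> - c))
    (exp ((a1 * a1 * T (m1 + m1) x1 x1 + a2 * a2 * T (m2 + m2) x2 x2 + a3 * a3 * T (m3 + m3) x3 x3
      + 2 * a1 * a2 * T (m1 + m2) x1 x2 + 2 * a1 * a3 * T (m1 + m3) x1 x3
      + 2 * a2 * a3 * T (m2 + m3) x2 x3) / 2 - c))"
  unfolding exp_diff by (intro has_bochner_integral_divide_zero smooth_mgf g)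

lemma weight_mgf: "has_bochner_integral M (\<lambda>\<omega>. exp (gam * C K x \<omega>)) (w0 x)"
  using mgf3[of gam "t K" x 0 0 x 0 0 x 0] by (simp add: w0_def C_def)

text \<open>Exponential Chebyshev bound under the tilted measure: on \<open>C k x > q k\<close> the
  additional factor is at least 1, and \<open>q k\<close> exceeds the tilted mean by
  \<open>d\<close> up to the covariance error \<open>e\<close>. The next lemma is the same with sign
  reversed.\<close>

lemma viol_up:
  assumes k: "k \<le> K" and x: "x \<in> P"
  obtains I where "has_bochner_integral M (\<lambda>\<omega>. exp (gam * C K x \<omega> + s * (C k x \<omega> - q k))) I"
    "I \<le> w0 x * exp (- ((s * d - s * s * (g_const + e) / 2 - gam * s * e) * L))"
proof
  let ?I = "exp ((gam * gam * T (t K + t K) x x + s * s * T (t k + t k) x x + 2 * gam * s * T (t K + t k) x x) / 2 - s * q k)"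
  show "has_bochner_integral M (\<lambda>\<omega>. exp (gam * C K x \<omega> + s * (C k x \<omega> - q k))) ?I"
    using mgf3[of gam "t K" x s "t k" x 0 0 x "s * q k"] by (simp add: C_def algebra_simps)
  have "T (t k + t k) x x \<le> (g_const * (1 - al k) + e) * L" by (rule cov_upper[OF k])
  also have "\<dots> \<le> (g_const + e) * L"
  proof (intro mult_right_mono add_right_mono)
    show "g_const * (1 - al k) \<le> g_const"
      using al_bounds[OF k] b g_const_pos by (simp add: mult_left_le)
  qed (use L_pos in simp)
  finally have 1: "s * s * T (t k + t k) x x \<le> s * s * ((g_const + e) * L)"
    using s by (intro mult_left_mono) auto
  have 2: "gam * s * T (t K + t k) x x \<le> gam * s * ((g_const * (1 - al k) + e) * L)"
    using s gam_pos by (intro mult_left_mono cov_upper k) auto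
  have "(gam * gam * T (t K + t K) x x + s * s * T (t k + t k) x x + 2 * gam * s * T (t K + t k) x x) / 2 - s * q k
    \<le> (gam * gam * T (t K + t K) x x + s * s * ((g_const + e) * L) + 2 * (gam * s * ((g_const * (1 - al k) + e) * L))) / 2 - s * q k"
    using 1 2 by simp
  also have "\<dots> = gam * gam * T (t K + t K) x x / 2 + - ((s * d - s * s * (g_const + e) / 2 - gam * s * e) * L)"
    by (simp add: q_def field_simps)
  finally show "?I \<le> w0 x * exp (- ((s * d - s * s * (g_const + e) / 2 - gam * s * e) * L))"
    unfolding w0_def exp_add[symmetric] by simp
qed

lemma viol_lo:
  assumes x: "x \<in> P"
  obtains I where "has_bochner_integral M
      (\<lambda>\<omega>. exp (gam * C K x \<omega> - s * (C K x \<omega> - (gam * g_const * (1 - b) - d) * L))) I"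
    "I \<le> w0 x * exp (- ((s * d - s * s * (g_const + e) / 2 - gam * s * e) * L))"
proof
  let ?q = "(gam * g_const * (1 - b) - d) * L"
  let ?T = "T (t K + t K) x x"
  let ?I = "exp ((gam - s) * (gam - s) * ?T / 2 + s * ?q)"
  show "has_bochner_integral M (\<lambda>\<omega>. exp (gam * C K x \<omega> - s * (C K x \<omega> - ?q))) ?I"
    using mgf3[of "gam - s" "t K" x 0 0 x 0 0 x "- s * ?q"] by (simp add: C_def algebra_simps)
  have "?T \<le> (g_const * (1 - b) + e) * L" using cov_upper[of K] by (simp add: al_K)
  also have "\<dots> \<le> (g_const + e) * L"
    using b g_const_pos L_pos by (intro mult_right_mono add_right_mono) (auto simp: mult_left_le)
  finally have 1: "s * s * ?T \<le> s * s * ((g_const + e) * L)"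
    using s by (intro mult_left_mono) auto
  have "(g_const * (1 - b) - e) * L \<le> ?T"
    using cov_lower[of K x x] depth6[OF x] by (simp add: al_K)
  then have 2: "gam * s * ((g_const * (1 - b) - e) * L) \<le> gam * s * ?T"
    using s gam_pos by (intro mult_left_mono) auto
  have "(gam - s) * (gam - s) * ?T / 2 + s * ?q = (gam * gam * ?T + s * s * ?T - 2 * (gam * s * ?T)) / 2 + s * ?q"
    by (simp add: algebra_simps)
  also have "\<dots> \<le> (gam * gam * ?T + s * s * ((g_const + e) * L) - 2 * (gam * s * ((g_const * (1 - b) - e) * L))) / 2 + s * ?q"
    using 1 2 by simp
  also have "\<dots> = gam * gam * ?T / 2 + - ((s * d - s * s * (g_const + e) / 2 - gam * s * e) * L)"
    by (simp add: field_simps)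
  finally show "?I \<le> w0 x * exp (- ((s * d - s * s * (g_const + e) / 2 - gam * s * e) * L))"
    unfolding w0_def exp_add[symmetric] by simp
qed

lemma ball_int: "x \<in> P \<Longrightarrow> sdist x y \<le> real N powr b \<Longrightarrow> y \<in> intVN N"
  using P(3)[of x] Nb N unfolding sdist_def depth_def intVN_eq
  by (cases y) (auto simp: min_def max_def split: if_splits; linarith)

text \<open>The difference \<open>X y - C K x\<close> has variance about \<open>g b ln N\<close> and
  is nearly uncorrelated with \<open>C K x\<close>, so the weight hardly moves it. Tilting it by
  \<open>- gam\<close> costs \<open>gam^2 g b / 2 - gam^2 g b = - 2 b\<close> in the exponent, which
  pays for the order of \<open>N^(2 b)\<close> sites in the ball.\<close>

lemma viol_res:
  assumes x: "x \<in> P" and y: "sdist x y \<le> real N powr b"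
  obtains I where "has_bochner_integral M
      (\<lambda>\<omega>. exp (gam * C K x \<omega> - gam * (X y \<omega> - C K x \<omega> + (gam * g_const * b + d) * L))) I"
    "I \<le> w0 x * exp (- ((2 * b + gam * d - 4 * gam * gam * e) * L))"
proof
  let ?T = "T (t K + t K) x x" and ?c = "gam * ((gam * g_const * b + d) * L)"
  let ?I = "exp (gam * gam * (4 * ?T + T 0 y y - 4 * T (t K) x y) / 2 - ?c)"
  have yi: "y \<in> intVN N" by (rule ball_int[OF x y])
  show "has_bochner_integral M
      (\<lambda>\<omega>. exp (gam * C K x \<omega> - gam * (X y \<omega> - C K x \<omega> + (gam * g_const * b + d) * L))) ?I"
    using mgf3[of "2 * gam" "t K" x "- gam" 0 y 0 0 x ?c]
    by (simp add: C_def smooth_0[OF yi] algebra_simps)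
  have 1: "?T \<le> (g_const * (1 - b) + e) * L" using cov_upper[of K] by (simp add: al_K)
  have 2: "T 0 y y \<le> (g_const + e) * L" by (rule U0)
  have "real (t K) \<le> 5 * real N powr (2 * al K)"
    using t_bounds(2)[of K] by (smt (verit) powr_ge_zero)
  then have 3: "(g_const * (1 - b) - e) * L \<le> T (t K) x y"
    using Lo[of K x y "t K"] depth6[OF x] y by (simp add: al_K)
  have "gam * gam * (3 * ?T + T 0 y y - 4 * T (t K) x y) \<le> gam * gam * ((g_const * b + 8 * e) * L)"
  proof (rule mult_left_mono)
    have "3 * ((g_const * (1 - b) + e) * L) + (g_const + e) * L - 4 * ((g_const * (1 - b) - e) * L) = (g_const * b + 8 * e) * L"
      by (simp add: algebra_simps)
    then show "3 * ?T + T 0 y y - 4 * T (t K) x y \<le> (g_const * b + 8 * e) * L"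
      using 1 2 3 by linarith
  qed simp
  moreover have "gam * gam * (4 * ?T + T 0 y y - 4 * T (t K) x y)
      = gam * gam * ?T + gam * gam * (3 * ?T + T 0 y y - 4 * T (t K) x y)"
    by (simp add: algebra_simps)
  ultimately have "gam * gam * (4 * ?T + T 0 y y - 4 * T (t K) x y) / 2 - ?c
      \<le> gam * gam * ?T / 2 + gam * gam * ((g_const * b + 8 * e) * L) / 2 - ?c"
    by linarith
  also have "\<dots> = gam * gam * ?T / 2 + (- (gam * gam * g_const * b * L / 2) + 4 * gam * gam * e * L - gam * d * L)"
    by (simp add: field_simps)
  also have "\<dots> = gam * gam * ?T / 2 + - ((2 * b + gam * d - 4 * gam * gam * e) * L)"
    unfolding gam_sq_g by (simp add: algebra_simps)
  finally show "?I \<le> w0 x * exp (- ((2 * b + gam * d - 4 * gam * gam * e) * L))"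
    unfolding w0_def exp_add[symmetric] by simp
qed

definition "rel k x y \<longleftrightarrow> sdist x y \<le> real N powr (al k) \<and> (k < K \<longrightarrow> real N powr (al (Suc k)) \<le> sdist x y)"

text \<open>The constraint at level \<open>k\<close> enters as the factor
  \<open>exp (gam * (q k - C k x))\<close>, which is at least 1 where it holds. It removes one copy
  of the coarse field common to \<open>x\<close> and \<open>y\<close> and lowers the excess exponent
  from \<open>4 (1 - al k)\<close> to \<open>2 (1 - al k)\<close>. The term \<open>4 / K\<close>
  arises because the distance is known only up to one step of the scale ladder.\<close>

lemma pair_bound:
  assumes k: "k \<le> K" and x: "x \<in> P" and y: "y \<in> P" and r: "rel k x y"
  obtains I where "has_bochner_integral M (\<lambda>\<omega>. exp (gam * (C K x \<omega> + C K y \<omega> - C k x \<omega>) + gam * q k)) I"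
    "I \<le> exp ((4 * (1 - b) + 2 * (1 - al k) + 4 / real K + 9 / 2 * gam * gam * e + gam * d) * L)"
proof
  let ?I = "exp (gam * gam * (T (t K + t K) x x + T (t K + t K) y y + T (t k + t k) x x
    + 2 * T (t K + t K) x y - 2 * T (t K + t k) x x - 2 * T (t K + t k) y x) / 2 + gam * q k)"
  show "has_bochner_integral M (\<lambda>\<omega>. exp (gam * (C K x \<omega> + C K y \<omega> - C k x \<omega>) + gam * q k)) ?I"
    using mgf3[of gam "t K" x gam "t K" y "- gam" "t k" x "- (gam * q k)"]
    by (simp add: C_def algebra_simps)
  have yx: "sdist y x = sdist x y" by (simp add: sdist_def abs_minus_commute)
  have 1: "T (t K + t K) x x \<le> (g_const * (1 - b) + e) * L" "T (t K + t K) y y \<le> (g_const * (1 - b) + e) * L"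
    using cov_upper[of K] by (simp_all add: al_K)
  have 2: "T (t k + t k) x x \<le> (g_const * (1 - al k) + e) * L" by (rule cov_upper[OF k])
  have 3: "T (t K + t K) x y \<le> (g_const * (1 - al k) + g_const / real K + e) * L"
  proof (cases "k < K")
    case True
    have "T (t K + t K) x y \<le> (g_const * (1 - al (Suc k)) + e) * L"
      using r True by (intro Far) (auto simp: rel_def)
    also have "\<dots> \<le> (g_const * (1 - al k) + g_const / real K + e) * L"
    proof (intro mult_right_mono add_right_mono)
      have "g_const * (al k - al (Suc k)) \<le> g_const * (1 / real K)"
        using al_Suc g_const_pos by (intro mult_left_mono) auto
      then show "g_const * (1 - al (Suc k)) \<le> g_const * (1 - al k) + g_const / real K"
        by (simp add: algebra_simps)
    qed (use L_pos in simp)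
    finally show ?thesis .
  next
    case False
    then have "T (t K + t K) x y \<le> (g_const * (1 - al k) + e) * L"
      using cov_upper[of K] k by simp
    also have "\<dots> \<le> (g_const * (1 - al k) + g_const / real K + e) * L"
      using g_const_pos L_pos by (intro mult_right_mono add_right_mono) auto
    finally show ?thesis .
  qed
  have 4: "(g_const * (1 - al k) - e) * L \<le> T (t K + t k) x x"
    using depth6[OF x] by (intro cov_lower k) auto
  have 5: "(g_const * (1 - al k) - e) * L \<le> T (t K + t k) y x"
    using depth6[OF y] r yx by (intro cov_lower k) (auto simp: rel_def)
  let ?V = "2 * g_const * (1 - b) - g_const * (1 - al k) + 2 * g_const / real K + 9 * e"
  have "gam * gam * (T (t K + t K) x x + T (t K + t K) y y + T (t k + t k) x x
    + 2 * T (t K + t K) x y - 2 * T (t K + t k) x x - 2 * T (t K + t k) y x) \<le> gam * gam * (?V * L)"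
  proof (rule mult_left_mono)
    have "?V * L = 2 * ((g_const * (1 - b) + e) * L) + (g_const * (1 - al k) + e) * L
        + 2 * ((g_const * (1 - al k) + g_const / real K + e) * L) - 4 * ((g_const * (1 - al k) - e) * L)"
      by (simp add: algebra_simps)
    then show "T (t K + t K) x x + T (t K + t K) y y + T (t k + t k) x x
    + 2 * T (t K + t K) x y - 2 * T (t K + t k) x x - 2 * T (t K + t k) y x \<le> ?V * L"
      using 1 2 3 4 5 by linarith
  qed simp
  then have "gam * gam * (T (t K + t K) x x + T (t K + t K) y y + T (t k + t k) x x
    + 2 * T (t K + t K) x y - 2 * T (t K + t k) x x - 2 * T (t K + t k) y x) / 2 + gam * q k
    \<le> gam * gam * (?V * L) / 2 + gam * q k" by simp
  also have "\<dots> = (gam * gam * g_const) * ((1 - b) + (1 - al k) / 2 + 1 / real K) * L + (9 / 2 * gam * gam * e + gam * d) * L"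
    using K by (simp add: q_def field_simps)
  also have "\<dots> = (4 * (1 - b) + 2 * (1 - al k) + 4 / real K + 9 / 2 * gam * gam * e + gam * d) * L"
    unfolding gam_sq_g by (simp add: field_simps)
  finally show "?I \<le> exp ((4 * (1 - b) + 2 * (1 - al k) + 4 / real K + 9 / 2 * gam * gam * e + gam * d) * L)"
    by simp
qed

definition "gev x = {\<omega>\<in>space M. (\<forall>k\<in>{..K}. C k x \<omega> \<le> q k) \<and> (gam * g_const * (1 - b) - d) * L \<le> C K x \<omega>
  \<and> (\<forall>y\<in>{y. sdist x y \<le> real N powr b}. - ((gam * g_const * b + d) * L) \<le> X y \<omega> - C K x \<omega>)}"

lemma gev_sets [measurable]: "gev x \<in> sets M"
proof -
  note [measurable] = gfamD(3)[OF g]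
  have [measurable]: "{y. sdist x y \<le> real N powr b} \<in> sets (count_space UNIV)" by simp
  show ?thesis unfolding gev_def by (measurable; simp add: finite_sball)
qed

text \<open>Truncation keeps at least half of the weight: the terms \<open>f1\<close>,
  \<open>f2\<close>, \<open>f3\<close> charge each possible violation, and by the hypothesis
  \<open>viol\<close> their integrals add up to at most half of \<open>w0 x\<close>.\<close>

lemma gev_weight:
  assumes x: "x \<in> P"
  shows "integrable M (\<lambda>\<omega>. exp (gam * C K x \<omega>) * indicator (gev x) \<omega>)"
    "w0 x / 2 \<le> (\<integral>\<omega>. exp (gam * C K x \<omega>) * indicator (gev x) \<omega> \<partial>M)"
proof -
  let ?W = "\<lambda>\<omega>. exp (gam * C K x \<omega>)"
  let ?D = "{y. sdist x y \<le> real N powr b}"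
  let ?c1 = "exp (- ((s * d - s * s * (g_const + e) / 2 - gam * s * e) * L))"
  let ?c2 = "exp (- ((2 * b + gam * d - 4 * gam * gam * e) * L))"
  define f1 where "f1 = (\<lambda>k \<omega>. exp (gam * C K x \<omega> + s * (C k x \<omega> - q k)))"
  define f2 where "f2 = (\<lambda>\<omega>. exp (gam * C K x \<omega> - s * (C K x \<omega> - (gam * g_const * (1 - b) - d) * L)))"
  define f3 where "f3 = (\<lambda>y \<omega>. exp (gam * C K x \<omega> - gam * (X y \<omega> - C K x \<omega> + (gam * g_const * b + d) * L)))"
  have W: "integrable M ?W" "(\<integral>\<omega>. ?W \<omega> \<partial>M) = w0 x"
    using weight_mgf[of x] by (auto simp: has_bochner_integral_iff)
  have i1: "integrable M (f1 k)" "(\<integral>\<omega>. f1 k \<omega> \<partial>M) \<le> w0 x * ?c1" if "k \<in> {..K}" for k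
    using viol_up[of k x] that x unfolding f1_def has_bochner_integral_iff by blast+
  have i2: "integrable M f2" "(\<integral>\<omega>. f2 \<omega> \<partial>M) \<le> w0 x * ?c1"
    using viol_lo[of x] x unfolding f2_def has_bochner_integral_iff by blast+
  have i3: "integrable M (f3 y)" "(\<integral>\<omega>. f3 y \<omega> \<partial>M) \<le> w0 x * ?c2" if "y \<in> ?D" for y
    using viol_res[of x y] that x unfolding f3_def has_bochner_integral_iff by blast+
  show int: "integrable M (\<lambda>\<omega>. ?W \<omega> * indicator (gev x) \<omega>)"
    by (rule Bochner_Integration.integrable_bound[OF W(1)]) (auto simp: indicator_def)
  let ?S = "\<lambda>\<omega>. (\<Sum>k\<in>{..K}. f1 k \<omega>) + f2 \<omega> + (\<Sum>y\<in>?D. f3 y \<omega>)"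
  have iS: "integrable M ?S"
    using i1 i2 i3 by (intro Bochner_Integration.integrable_add Bochner_Integration.integrable_sum) auto
  \<comment> \<open>Off \<open>gev x\<close> some constraint fails, and the exponential that charges
    it is at least the weight itself, so the left side is not positive.\<close>
  have pw: "?W \<omega> - ?S \<omega> \<le> ?W \<omega> * indicator (gev x) \<omega>" if \<omega>: "\<omega> \<in> space M" for \<omega>
  proof (cases "\<omega> \<in> gev x")
    case True
    have "0 \<le> ?S \<omega>"
      unfolding f1_def f2_def f3_def by (intro add_nonneg_nonneg sum_nonneg) auto
    then show ?thesis using True by simp
  next
    case False
    have n: "0 \<le> (\<Sum>k\<in>{..K}. f1 k \<omega>)" "0 \<le> f2 \<omega>" "0 \<le> (\<Sum>y\<in>?D. f3 y \<omega>)"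
      unfolding f1_def f2_def f3_def by (auto intro!: sum_nonneg)
    from False \<omega> consider k where "k \<in> {..K}" "q k < C k x \<omega>"
      | "C K x \<omega> < (gam * g_const * (1 - b) - d) * L"
      | y where "y \<in> ?D" "X y \<omega> - C K x \<omega> < - ((gam * g_const * b + d) * L)"
      unfolding gev_def by force
    then have "?W \<omega> \<le> ?S \<omega>"
    proof cases
      case 1
      have "?W \<omega> \<le> f1 k \<omega>" using 1 s by (simp add: f1_def)
      also have "\<dots> \<le> (\<Sum>k\<in>{..K}. f1 k \<omega>)"
        using 1 by (intro member_le_sum) (auto simp: f1_def)
      finally show ?thesis using n by linarith
    next
      case 2
      then have "s * (C K x \<omega> - (gam * g_const * (1 - b) - d) * L) \<le> 0"
        using s by (intro mult_nonneg_nonpos) auto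
      then have "?W \<omega> \<le> f2 \<omega>" by (simp add: f2_def)
      then show ?thesis using n by linarith
    next
      case 3
      then have "gam * (X y \<omega> - C K x \<omega> + (gam * g_const * b + d) * L) \<le> 0"
        using gam_pos by (intro mult_nonneg_nonpos) auto
      then have "?W \<omega> \<le> f3 y \<omega>" by (simp add: f3_def)
      also have "\<dots> \<le> (\<Sum>y\<in>?D. f3 y \<omega>)"
        using 3 finite_sball by (intro member_le_sum) (auto simp: f3_def)
      finally show ?thesis using n by linarith
    qed
    then show ?thesis using False by simp
  qed
  have w0: "0 \<le> w0 x" by (simp add: w0_def)
  have "(\<integral>\<omega>. ?S \<omega> \<partial>M) = (\<Sum>k\<in>{..K}. \<integral>\<omega>. f1 k \<omega> \<partial>M) + (\<integral>\<omega>. f2 \<omega> \<partial>M) + (\<Sum>y\<in>?D. \<integral>\<omega>. f3 y \<omega> \<partial>M)"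
  proof -
    have s: "integrable M (\<lambda>\<omega>. \<Sum>k\<in>{..K}. f1 k \<omega>)" "integrable M (\<lambda>\<omega>. \<Sum>y\<in>?D. f3 y \<omega>)"
      using i1 i3 by (intro Bochner_Integration.integrable_sum; blast)+
    have "(\<integral>\<omega>. (\<Sum>k\<in>{..K}. f1 k \<omega>) \<partial>M) = (\<Sum>k\<in>{..K}. \<integral>\<omega>. f1 k \<omega> \<partial>M)"
      using i1 by (intro Bochner_Integration.integral_sum) blast
    moreover have "(\<integral>\<omega>. (\<Sum>y\<in>?D. f3 y \<omega>) \<partial>M) = (\<Sum>y\<in>?D. \<integral>\<omega>. f3 y \<omega> \<partial>M)"
      using i3 by (intro Bochner_Integration.integral_sum) blast
    ultimately show ?thesis
      using s i2(1) by (simp only: Bochner_Integration.integral_add Bochner_Integration.integrable_add)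
  qed
  also have "\<dots> \<le> (\<Sum>k\<in>{..K}. w0 x * ?c1) + w0 x * ?c1 + (\<Sum>y\<in>?D. w0 x * ?c2)"
    using i1 i2 i3 by (intro add_mono sum_mono) auto
  also have "\<dots> = w0 x * ((real K + 2) * ?c1 + real (card ?D) * ?c2)"
    by (simp add: algebra_simps)
  also have "\<dots> \<le> w0 x * (1 / 2)"
  proof (rule mult_left_mono[OF _ w0])
    have "1 \<le> real N powr b" using N b by (intro ge_one_powr_ge_zero) auto
    then have "real (card ?D) \<le> (3 * real N powr b)\<^sup>2"
      by (intro order.trans[OF card_sball] power_mono) auto
    also have "\<dots> = 9 * exp (2 * b * L)"
      unfolding powr_exp by (simp add: power2_eq_square flip: exp_add)
    finally have "real (card ?D) * ?c2 \<le> 9 * exp (2 * b * L) * ?c2"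
      by (rule mult_right_mono) simp
    also have "\<dots> = 9 * exp (- ((gam * d - 4 * gam * gam * e) * L))"
      by (simp add: algebra_simps flip: exp_add)
    finally show "(real K + 2) * ?c1 + real (card ?D) * ?c2 \<le> 1 / 2"
      using viol by linarith
  qed
  finally have S2: "(\<integral>\<omega>. ?S \<omega> \<partial>M) \<le> w0 x / 2" by simp
  have "w0 x / 2 \<le> (\<integral>\<omega>. ?W \<omega> \<partial>M) - (\<integral>\<omega>. ?S \<omega> \<partial>M)" using S2 W by simp
  also have "\<dots> = (\<integral>\<omega>. ?W \<omega> - ?S \<omega> \<partial>M)"
    by (rule Bochner_Integration.integral_diff[OF W(1) iS, symmetric])
  also have "\<dots> \<le> (\<integral>\<omega>. ?W \<omega> * indicator (gev x) \<omega> \<partial>M)"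
    by (intro integral_mono int Bochner_Integration.integrable_diff W iS pw)
  finally show "w0 x / 2 \<le> (\<integral>\<omega>. ?W \<omega> * indicator (gev x) \<omega> \<partial>M)" .
qed

lemma w0_lower: "x \<in> P \<Longrightarrow> exp ((2 * (1 - b) - gam * gam * e / 2) * L) \<le> w0 x"
proof -
  assume x: "x \<in> P"
  have "(g_const * (1 - b) - e) * L \<le> T (t K + t K) x x"
    using cov_lower[of K x x] depth6[OF x] by (simp add: al_K)
  then have "gam * gam * ((g_const * (1 - b) - e) * L) / 2 \<le> gam * gam * T (t K + t K) x x / 2"
    by (intro divide_right_mono mult_left_mono) auto
  moreover have "gam * gam * ((g_const * (1 - b) - e) * L) / 2
      = ((gam * gam * g_const) * (1 - b) / 2 - gam * gam * e / 2) * L"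
    by (simp add: field_simps)
  moreover have "\<dots> = (2 * (1 - b) - gam * gam * e / 2) * L"
    unfolding gam_sq_g by simp
  ultimately show ?thesis unfolding w0_def by simp
qed

lemma rel_exists:
  assumes "x \<in> P" "y \<in> P"
  shows "\<exists>k\<le>K. rel k x y"
proof -
  let ?Q = "\<lambda>k. sdist x y \<le> real N powr (al k)"
  have "?Q 0"
    using P(3)[OF assms(1)] P(3)[OF assms(2)] N
    by (auto simp: al_0 sdist_def depth_def abs_le_iff split: if_splits)
  define k where "k = (GREATEST k. k \<le> K \<and> ?Q k)"
  have k: "k \<le> K \<and> ?Q k"
    unfolding k_def by (rule GreatestI_nat[where b = K]) (use \<open>?Q 0\<close> in auto)
  have "real N powr (al (Suc k)) \<le> sdist x y" if "k < K"
  proof (rule ccontr)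
    assume "\<not> ?thesis"
    then have "Suc k \<le> K \<and> ?Q (Suc k)" using that by auto
    then have "Suc k \<le> k"
      unfolding k_def by (rule Greatest_le_nat[where b = K]) auto
    then show False by simp
  qed
  with k show ?thesis unfolding rel_def by blast
qed

text \<open>The entropy of pairs cancels the level: there are of order
  \<open>N^(2 (al k - b))\<close> partners at scale \<open>k\<close>, each contributing at most
  \<open>N^(4 (1 - b) + 2 (1 - al k))\<close> up to errors, which is \<open>N^(6 (1 - b))\<close>
  for every \<open>k\<close>. With about \<open>N^(2 (1 - b))\<close> centres both the second moment
  and the square of the first have exponent \<open>8 (1 - b)\<close>.\<close>

lemma ml_measure:
  "real (card P) / (36 * (real K + 1)) * exp (- ((2 * (1 - b) + 4 / real K + 11 / 2 * gam * gam * e + gam * d) * L))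
    \<le> measure M (\<Union>x\<in>P. gev x)"
proof -
  define W where "W = (\<lambda>x \<omega>. exp (gam * C K x \<omega>) * indicator (gev x) \<omega>)"
  define Z where "Z = (\<lambda>\<omega>. \<Sum>x\<in>P. W x \<omega>)"
  define H where "H = (\<lambda>x k y \<omega>. exp (gam * (C K x \<omega> + C K y \<omega> - C k x \<omega>) + gam * q k))"
  define R where "R = (\<lambda>x k. {y\<in>P. rel k x y})"
  define F where "F = (\<lambda>\<omega>. \<Sum>x\<in>P. \<Sum>k\<in>{..K}. \<Sum>y\<in>R x k. H x k y \<omega>)"
  define hb where "hb = (\<lambda>k. exp ((4 * (1 - b) + 2 * (1 - al k) + 4 / real K + 9 / 2 * gam * gam * e + gam * d) * L))"
  have iW: "integrable M (W x)" "w0 x / 2 \<le> (\<integral>\<omega>. W x \<omega> \<partial>M)" if "x \<in> P" for x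
    using gev_weight[OF that] unfolding W_def by auto
  have iH: "integrable M (H x k y)" "(\<integral>\<omega>. H x k y \<omega> \<partial>M) \<le> hb k"
    if "x \<in> P" "k \<in> {..K}" "y \<in> R x k" for x k y
    using pair_bound[of k x y] that unfolding H_def hb_def R_def has_bochner_integral_iff by blast+
  have finR: "finite (R x k)" for x k using P(1) by (simp add: R_def)
  \<comment> \<open>Both truncations are dropped here except for the one inequality
    \<open>C k x \<le> q k\<close> at the scale of the pair.\<close>
  have W_le: "W x \<omega> * W y \<omega> \<le> H x k y \<omega>" if "k \<le> K" for x y k \<omega>
  proof (cases "\<omega> \<in> gev x \<and> \<omega> \<in> gev y")
    case True
    then have "C k x \<omega> \<le> q k" using that by (auto simp: gev_def)
    then have "gam * C k x \<omega> \<le> gam * q k" using gam_pos by (intro mult_left_mono) auto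
    then show ?thesis using True by (simp add: W_def H_def algebra_simps flip: exp_add)
  next
    case False
    then show ?thesis by (auto simp: W_def H_def)
  qed
  have ZF: "(Z \<omega>)\<^sup>2 \<le> F \<omega>" for \<omega>
  proof -
    have "(Z \<omega>)\<^sup>2 = (\<Sum>x\<in>P. \<Sum>y\<in>P. W x \<omega> * W y \<omega>)"
      by (simp add: Z_def power2_eq_square sum_product)
    also have "\<dots> \<le> (\<Sum>x\<in>P. \<Sum>y\<in>P. \<Sum>k\<in>{..K}. if rel k x y then H x k y \<omega> else 0)"
    proof (intro sum_mono)
      fix x y assume xy: "x \<in> P" "y \<in> P"
      obtain k where k: "k \<le> K" "rel k x y" using rel_exists[OF xy] by blast
      have "W x \<omega> * W y \<omega> \<le> (if rel k x y then H x k y \<omega> else 0)" using W_le k by simp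
      also have "\<dots> \<le> (\<Sum>k\<in>{..K}. if rel k x y then H x k y \<omega> else 0)"
        using k by (intro member_le_sum) (auto simp: H_def)
      finally show "W x \<omega> * W y \<omega> \<le> (\<Sum>k\<in>{..K}. if rel k x y then H x k y \<omega> else 0)" .
    qed
    also have "\<dots> = (\<Sum>x\<in>P. \<Sum>k\<in>{..K}. \<Sum>y\<in>P. if rel k x y then H x k y \<omega> else 0)"
      by (intro sum.cong refl sum.swap)
    also have "\<dots> = F \<omega>"
      unfolding F_def R_def sum.inter_filter[OF P(1)] ..
    finally show ?thesis .
  qed
  let ?m = "real (card P) * exp ((2 * (1 - b) - gam * gam * e / 2) * L) / 2"
  let ?v = "real (card P) * ((real K + 1) * (9 * exp ((6 * (1 - b) + 4 / real K + 9 / 2 * gam * gam * e + gam * d) * L)))"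
  have cP: "0 < real (card P)" using P(1,2) by (simp add: card_gt_0_iff)
  have "?m\<^sup>2 / ?v \<le> measure M (\<Union>x\<in>P. gev x)"
  proof (rule second_moment_bound[OF gfamD(1)[OF g], where Z = Z and F = F])
    have [measurable]: "W x \<in> borel_measurable M" for x unfolding W_def by measurable
    show "Z \<in> borel_measurable M" unfolding Z_def by measurable
    show "(\<Union>x\<in>P. gev x) \<in> sets M" using P(1) by measurable
    show "0 \<le> Z \<omega>" for \<omega> unfolding Z_def W_def by (intro sum_nonneg) auto
    show "Z \<omega> = 0" if "\<omega> \<notin> (\<Union>x\<in>P. gev x)" for \<omega>
      unfolding Z_def W_def using that by (intro sum.neutral) auto
    show "integrable M Z" unfolding Z_def using iW by (intro Bochner_Integration.integrable_sum)
    show iF: "integrable M F" unfolding F_def using iH by (intro Bochner_Integration.integrable_sum)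
    show "(Z \<omega>)\<^sup>2 \<le> F \<omega>" for \<omega> by (rule ZF)
    show "0 < ?m" using cP by simp
    show "0 < ?v" using cP by (intro mult_pos_pos) auto
    have "?m = (\<Sum>x\<in>P. exp ((2 * (1 - b) - gam * gam * e / 2) * L) / 2)" by simp
    also have "\<dots> \<le> (\<Sum>x\<in>P. \<integral>\<omega>. W x \<omega> \<partial>M)"
    proof (rule sum_mono)
      fix x assume "x \<in> P"
      then show "exp ((2 * (1 - b) - gam * gam * e / 2) * L) / 2 \<le> (\<integral>\<omega>. W x \<omega> \<partial>M)"
        using iW[of x] w0_lower[of x] by linarith
    qed
    also have "\<dots> = (\<integral>\<omega>. Z \<omega> \<partial>M)"
      unfolding Z_def using iW by (subst Bochner_Integration.integral_sum) auto
    finally show "?m \<le> (\<integral>\<omega>. Z \<omega> \<partial>M)" .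
    have "(\<integral>\<omega>. F \<omega> \<partial>M) = (\<Sum>x\<in>P. \<Sum>k\<in>{..K}. \<Sum>y\<in>R x k. \<integral>\<omega>. H x k y \<omega> \<partial>M)"
    proof -
      have 1: "integrable M (\<lambda>\<omega>. \<Sum>y\<in>R x k. H x k y \<omega>)"
        "(\<integral>\<omega>. (\<Sum>y\<in>R x k. H x k y \<omega>) \<partial>M) = (\<Sum>y\<in>R x k. \<integral>\<omega>. H x k y \<omega> \<partial>M)"
        if "x \<in> P" "k \<in> {..K}" for x k
        by (rule Bochner_Integration.integrable_sum Bochner_Integration.integral_sum, rule iH(1)[OF that], assumption)+
      have 2: "integrable M (\<lambda>\<omega>. \<Sum>k\<in>{..K}. \<Sum>y\<in>R x k. H x k y \<omega>)" if "x \<in> P" for x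
        by (rule Bochner_Integration.integrable_sum) (rule 1(1)[OF that])
      have "(\<integral>\<omega>. F \<omega> \<partial>M) = (\<Sum>x\<in>P. \<integral>\<omega>. (\<Sum>k\<in>{..K}. \<Sum>y\<in>R x k. H x k y \<omega>) \<partial>M)"
        unfolding F_def by (rule Bochner_Integration.integral_sum) (rule 2)
      also have "\<dots> = (\<Sum>x\<in>P. \<Sum>k\<in>{..K}. \<integral>\<omega>. (\<Sum>y\<in>R x k. H x k y \<omega>) \<partial>M)"
        by (intro sum.cong refl Bochner_Integration.integral_sum 1(1))
      also have "\<dots> = (\<Sum>x\<in>P. \<Sum>k\<in>{..K}. \<Sum>y\<in>R x k. \<integral>\<omega>. H x k y \<omega> \<partial>M)"
        by (intro sum.cong refl 1(2))
      finally show ?thesis .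
    qed
    also have "\<dots> \<le> (\<Sum>x\<in>P. \<Sum>k\<in>{..K}. \<Sum>y\<in>R x k. hb k)"
      using iH by (intro sum_mono) auto
    also have "\<dots> = (\<Sum>x\<in>P. \<Sum>k\<in>{..K}. real (card (R x k)) * hb k)" by simp
    also have "\<dots> \<le> (\<Sum>x\<in>P. \<Sum>k\<in>{..K}. 9 * exp ((6 * (1 - b) + 4 / real K + 9 / 2 * gam * gam * e + gam * d) * L))"
    proof (intro sum_mono)
      fix x k assume x: "x \<in> P" and k: "k \<in> {..K}"
      have "real N powr b \<le> real N powr (al k)"
        using al_bounds(1)[of k] k N by (intro powr_mono) auto
      have "card (R x k) \<le> card {y\<in>P. sdist x y \<le> real N powr (al k)}"
        using P(1) by (intro card_mono) (auto simp: R_def rel_def)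
      then have "real (card (R x k)) \<le> real (card {y\<in>P. sdist x y \<le> real N powr (al k)})" by simp
      also have "\<dots> \<le> 9 * (real N powr (al k) / real N powr b)\<^sup>2"
        by (rule P(4)[OF x]) fact
      also have "\<dots> = 9 * exp (2 * (al k - b) * L)"
        unfolding powr_exp by (simp add: power2_eq_square algebra_simps flip: exp_add exp_diff)
      finally have "real (card (R x k)) * hb k \<le> 9 * exp (2 * (al k - b) * L) * hb k"
        by (rule mult_right_mono) (simp add: hb_def)
      also have "\<dots> = 9 * exp ((6 * (1 - b) + 4 / real K + 9 / 2 * gam * gam * e + gam * d) * L)"
        unfolding hb_def by (simp add: algebra_simps flip: exp_add)
      finally show "real (card (R x k)) * hb k \<le> 9 * exp ((6 * (1 - b) + 4 / real K + 9 / 2 * gam * gam * e + gam * d) * L)" .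
    qed
    also have "\<dots> = ?v" by simp
    finally show "(\<integral>\<omega>. F \<omega> \<partial>M) \<le> ?v" .
  qed
  moreover have "?m\<^sup>2 / ?v = real (card P) / (36 * (real K + 1))
      * exp (- ((2 * (1 - b) + 4 / real K + 11 / 2 * gam * gam * e + gam * d) * L))"
  proof -
    let ?a = "exp ((2 * (1 - b) - gam * gam * e / 2) * L)"
    let ?b = "exp ((6 * (1 - b) + 4 / real K + 9 / 2 * gam * gam * e + gam * d) * L)"
    have "?m\<^sup>2 / ?v = real (card P) / (36 * (real K + 1)) * (?a * ?a / ?b)"
    proof -
      have "(p * a / 2)\<^sup>2 / (p * (k * (9 * u))) = p / (36 * k) * (a * a / u)"
        if "0 < p" "0 < k" "0 < u" for p a k u :: real
        using that by (simp add: power2_eq_square mult_ac)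
      then show ?thesis using cP by (simp del: times_divide_eq_left times_divide_eq_right)
    qed
    also have "?a * ?a / ?b = exp (- ((2 * (1 - b) + 4 / real K + 11 / 2 * gam * gam * e + gam * d) * L))"
      unfolding exp_add[symmetric] exp_diff[symmetric] by (simp add: field_simps)
    finally show ?thesis .
  qed
  ultimately show ?thesis by simp
qed

lemma gev_imp:
  assumes "\<omega> \<in> gev x" "sdist x y \<le> real N powr b"
  shows "(2 * sqrt g_const * (1 - 2 * b) - 2 * d) * L \<le> X y \<omega>"
proof -
  have "(gam * g_const * (1 - b) - d) * L \<le> C K x \<omega>" "- ((gam * g_const * b + d) * L) \<le> X y \<omega> - C K x \<omega>"
    using assms by (simp_all add: gev_def del: split_paired_All)
  then have "(gam * g_const * (1 - b) - d) * L - (gam * g_const * b + d) * L \<le> X y \<omega>"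
    by linarith
  then show ?thesis unfolding gam_g by (simp add: algebra_simps)
qed

end

text \<open>The threshold for \<open>N\<close> is uniform over the probability space and the field.
  This matters because the statement is applied to block fields, which change with the size of the
  surrounding box.\<close>

theorem gff_plateau:
  assumes b: "0 < b" "b < 1" and de: "0 < \<delta>" and ep: "0 < \<epsilon>"
  shows "\<forall>\<^sub>F N in sequentially. \<forall>(M :: 'a measure) X. gfam M (intVN N) X (greenN N) \<longrightarrow>
    real N powr (- \<epsilon>) \<le> measure M {\<omega>\<in>space M. \<exists>x. real N / 4 \<le> depth N x \<and>
      (\<forall>y. sdist x y \<le> real N powr b \<longrightarrow> 2 * sqrt g_const * (1 - 2 * b - \<delta>) * ln (real N) \<le> X y \<omega>)}"
proof -
  \<comment> \<open>\<open>d\<close> is small against both the level slack and the exponent budget.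
    \<open>e\<close> is small against \<open>d / gam\<close>, and \<open>s\<close> makes the
    quadratic Chernoff term at most a quarter of \<open>s * d\<close>, so \<open>c1\<close> and
    \<open>c2\<close> are positive. \<open>K\<close> makes the ladder error \<open>4 / K\<close> at
    most \<open>\<epsilon> / 4\<close>; together the errors stay below
    \<open>\<epsilon> / 2\<close>.\<close>
  define d where "d = min (sqrt g_const * \<delta>) (\<epsilon> / (8 * gam))"
  define e where "e = min 1 (d / (8 * gam))"
  define s where "s = d / (2 * (g_const + 1))"
  define K where "K = nat \<lceil>16 / \<epsilon>\<rceil>"
  define al where "al = (\<lambda>k. 1 - (1 - b) * real k / real K)"
  define c1 where "c1 = s * d - s * s * (g_const + e) / 2 - gam * s * e"
  define c2 where "c2 = gam * d - 4 * gam * gam * e"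
  have d: "0 < d" "d \<le> sqrt g_const * \<delta>" "gam * d \<le> \<epsilon> / 8"
  proof -
    show "0 < d" using de ep g_const_pos gam_pos by (simp add: d_def)
    show "d \<le> sqrt g_const * \<delta>" by (simp add: d_def)
    have "d \<le> \<epsilon> / (8 * gam)" by (simp add: d_def)
    then show "gam * d \<le> \<epsilon> / 8" using gam_pos by (simp add: field_simps)
  qed
  have e: "0 < e" "e \<le> 1" "gam * e \<le> d / 8"
  proof -
    show "0 < e" using d gam_pos by (simp add: e_def)
    show "e \<le> 1" by (simp add: e_def)
    have "e \<le> d / (8 * gam)" by (simp add: e_def)
    then show "gam * e \<le> d / 8" using gam_pos by (simp add: field_simps)
  qed
  have s: "0 < s" using d g_const_pos by (simp add: s_def)
  have K: "0 < K" "4 / real K \<le> \<epsilon> / 4"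
  proof -
    have "16 / \<epsilon> \<le> real K" unfolding K_def by linarith
    moreover have "0 < 16 / \<epsilon>" using ep by simp
    ultimately show "0 < K" by linarith
    have "4 / real K \<le> 4 / (16 / \<epsilon>)"
      using \<open>16 / \<epsilon> \<le> real K\<close> \<open>0 < 16 / \<epsilon>\<close> \<open>0 < K\<close> by (intro divide_left_mono) auto
    then show "4 / real K \<le> \<epsilon> / 4" by simp
  qed
  note gd = d(3) and ds = d(2) and ge = e(3) and K4 = K(2)
  have c1: "0 < c1"
  proof -
    have "s * (g_const + e) \<le> s * (g_const + 1)" using e s by simp
    also have "\<dots> = d / 2" using g_const_pos by (simp add: s_def field_simps)
    finally have "s * (s * (g_const + e)) \<le> s * (d / 2)" using s by (intro mult_left_mono) auto
    moreover have "s * (gam * e) \<le> s * (d / 8)" using s e by (intro mult_left_mono) auto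
    moreover have "0 < s * d" using s d by simp
    moreover have "c1 = s * d - s * (s * (g_const + e)) / 2 - s * (gam * e)"
      unfolding c1_def by simp
    ultimately show ?thesis by simp
  qed
  have c2: "0 < c2"
  proof -
    have "gam * (gam * e) \<le> gam * (d / 8)" using gam_pos e by (intro mult_left_mono) auto
    moreover have "0 < gam * d" using gam_pos d by simp
    ultimately show ?thesis unfolding c2_def by (simp add: algebra_simps)
  qed
  have al: "0 \<le> al k" "al k \<le> 1" if "k \<le> K" for k
  proof -
    have "(1 - b) * real k / real K \<le> 1 * 1"
      using that K b unfolding times_divide_eq_right[symmetric] by (intro mult_mono) auto
    then show "0 \<le> al k" by (simp add: al_def)
    show "al k \<le> 1" using b by (simp add: al_def)
  qed
  have "\<forall>\<^sub>F N in sequentially. \<forall>k\<in>{..K}. \<forall>x y m. real N powr (2 * al k) \<le> real m + 1 \<longrightarrow>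
    tailG N m x y \<le> (g_const * (1 - al k) + e) * ln (real N)"
    using e al by (intro eventually_ball_finite ballI tailG_upper_asymp) auto
  moreover have "\<forall>\<^sub>F N in sequentially. \<forall>k\<in>{..K}. \<forall>x y m. real N powr (al k) \<le> sdist x y \<longrightarrow>
    tailG N m x y \<le> (g_const * (1 - al k) + e) * ln (real N)"
    using e al by (intro eventually_ball_finite ballI tailG_upper_far) auto
  moreover have "\<forall>\<^sub>F N in sequentially. \<forall>k\<in>{..K}. \<forall>x y m. real N / 6 \<le> depth N x \<longrightarrow>
    sdist x y \<le> real N powr (al k) \<longrightarrow> real m \<le> 5 * real N powr (2 * al k) \<longrightarrow>
    (g_const * (1 - al k) - e) * ln (real N) \<le> tailG N m x y"
    using e al by (intro eventually_ball_finite ballI tailG_lower_asymp) auto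
  moreover have "\<forall>\<^sub>F N in sequentially. \<forall>x y m. real N powr (2 * 0) \<le> real m + 1 \<longrightarrow>
    tailG N m x y \<le> (g_const * (1 - 0) + e) * ln (real N)"
    using e by (intro tailG_upper_asymp) auto
  moreover note grid_exists[OF b]
  moreover have "\<forall>\<^sub>F N in sequentially. real N powr b + real N / 6 \<le> real N / 4"
    using b by real_asymp
  moreover have "\<forall>\<^sub>F N in sequentially. (real K + 2) * exp (- (c1 * ln (real N))) + 9 * exp (- (c2 * ln (real N))) \<le> 1 / 2"
  proof -
    define k where "k = real K + 2"
    have "0 < k" by (simp add: k_def)
    then have "(\<lambda>N. k * real N powr (- c1) + 9 * real N powr (- c2)) \<longlonglongrightarrow> 0"
      using c1 c2 by (intro tendsto_add_zero; real_asymp)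
    then have "\<forall>\<^sub>F N in sequentially. k * real N powr (- c1) + 9 * real N powr (- c2) < 1 / 2"
      by (rule order_tendstoD) simp
    then show ?thesis
      using eventually_gt_at_top[of 0] unfolding k_def by eventually_elim (simp add: powr_def)
  qed
  \<comment> \<open>\<open>2304 = 64 * 36\<close> collects the constants of the grid count and of
    \<open>ml_measure\<close>.\<close>
  moreover have "\<forall>\<^sub>F N in sequentially. 2304 * (real K + 1) \<le> real N powr (\<epsilon> / 2)"
    using ep by real_asymp
  moreover have "\<forall>\<^sub>F N in sequentially. (2::nat) \<le> N"
    by (rule eventually_ge_at_top)
  ultimately show ?thesis
  proof eventually_elim
    case (elim N)
    let ?L = "ln (real N)"
    obtain P where PP: "finite P" "\<And>x. x \<in> P \<Longrightarrow> real N / 4 \<le> depth N x"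
      "real N powr (2 * (1 - b)) / 64 \<le> real (card P)"
      "\<And>x r. x \<in> P \<Longrightarrow> real N powr b \<le> r \<Longrightarrow> real (card {y\<in>P. sdist x y \<le> r}) \<le> 9 * (r / real N powr b)\<^sup>2"
      using elim(5) by blast
    have N: "1 \<le> real N" "0 < ?L" using elim(9) by auto
    show ?case
    proof (intro allI impI)
      fix M :: "'a measure" and X :: "site \<Rightarrow> 'a \<Rightarrow> real"
      assume g: "gfam M (intVN N) X (greenN N)"
      interpret prob_space M by (rule gfamD(1)[OF g])
      have "P \<noteq> {}"
      proof
        assume "P = {}"
        then have "real N powr (2 * (1 - b)) \<le> 0" using PP(3) by simp
        then show False using N by simp
      qed
      interpret ml_setup M N X b e d s ?L K al "\<lambda>k. nat \<lfloor>real N powr (2 * al k)\<rfloor>" P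
      proof unfold_locales
        show "gfam M (intVN N) X (greenN N)" by (rule g)
        show "al k = 1 - (1 - b) * real k / real K" for k by (simp add: al_def)
        show "2 \<le> N" by (rule elim(9))
        show "tailG N m x y \<le> (g_const * (1 - al k) + e) * ?L"
          if "k \<le> K" "real N powr (2 * al k) \<le> real m + 1" for k x y m
          by (rule elim(1)[rule_format]) (use that in auto)
        show "tailG N m x y \<le> (g_const * (1 - al k) + e) * ?L"
          if "k \<le> K" "real N powr (al k) \<le> sdist x y" for k x y m
          by (rule elim(2)[rule_format]) (use that in auto)
        show "(g_const * (1 - al k) - e) * ?L \<le> tailG N m x y"
          if "k \<le> K" "real N / 6 \<le> depth N x" "sdist x y \<le> real N powr (al k)"
            "real m \<le> 5 * real N powr (2 * al k)" for k x y m
          by (rule elim(3)[rule_format]) (use that in auto)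
        show "tailG N 0 x x \<le> (g_const + e) * ?L" for x
          using elim(4)[rule_format, of 0 x x] N by simp
        show "(real K + 2) * exp (- ((s * d - s * s * (g_const + e) / 2 - gam * s * e) * ?L))
          + 9 * exp (- ((gam * d - 4 * gam * gam * e) * ?L)) \<le> 1 / 2"
          using elim(7) unfolding c1_def c2_def .
      qed (use b K e d s PP \<open>P \<noteq> {}\<close> elim(6) in auto)
      have "real N powr (- \<epsilon>) \<le> real (card P) / (36 * (real K + 1))
          * exp (- ((2 * (1 - b) + 4 / real K + 11 / 2 * gam * gam * e + gam * d) * ?L))"
      proof -
        have "gam * (gam * e) \<le> gam * (d / 8)" using gam_pos ge by (intro mult_left_mono) auto
        then have "4 / real K + 11 / 2 * gam * gam * e + gam * d \<le> \<epsilon> / 2"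
        proof -
          assume "gam * (gam * e) \<le> gam * (d / 8)"
          moreover have "11 / 2 * gam * gam * e = 11 / 2 * (gam * (gam * e))" by simp
          moreover have "gam * (d / 8) = gam * d / 8" by simp
          ultimately show ?thesis using K4 gd \<open>0 < \<epsilon>\<close> by linarith
        qed
        then have "2 * (1 - b) + 4 / real K + 11 / 2 * gam * gam * e + gam * d \<le> 2 * (1 - b) + \<epsilon> / 2"
          by linarith
        then have "(2 * (1 - b) + 4 / real K + 11 / 2 * gam * gam * e + gam * d) * ?L \<le> (2 * (1 - b) + \<epsilon> / 2) * ?L"
          by (rule mult_right_mono) (use N in simp)
        then have 1: "real N powr (- (2 * (1 - b) + \<epsilon> / 2))
            \<le> exp (- ((2 * (1 - b) + 4 / real K + 11 / 2 * gam * gam * e + gam * d) * ?L))"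
          by (simp only: powr_exp exp_le_cancel_iff mult_minus_left neg_le_iff_le)
        have "real N powr (- \<epsilon>) * (2304 * (real K + 1)) \<le> real N powr (- \<epsilon>) * real N powr (\<epsilon> / 2)"
          by (intro mult_left_mono elim(8)) auto
        also have "\<dots> = real N powr (2 * (1 - b)) * real N powr (- (2 * (1 - b) + \<epsilon> / 2))"
          by (simp flip: powr_add)
        finally have "real N powr (- \<epsilon>) \<le> (real N powr (2 * (1 - b)) / 64) / (36 * (real K + 1))
            * real N powr (- (2 * (1 - b) + \<epsilon> / 2))"
          by (simp add: field_simps)
        also have "\<dots> \<le> real (card P) / (36 * (real K + 1))
          * exp (- ((2 * (1 - b) + 4 / real K + 11 / 2 * gam * gam * e + gam * d) * ?L))"
          by (intro mult_mono divide_right_mono PP(3) 1) auto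
        finally show ?thesis .
      qed
      also have "\<dots> \<le> measure M (\<Union>x\<in>P. gev x)" by (rule ml_measure)
      also have "\<dots> \<le> measure M {\<omega>\<in>space M. \<exists>x. real N / 4 \<le> depth N x \<and>
        (\<forall>y. sdist x y \<le> real N powr b \<longrightarrow> 2 * sqrt g_const * (1 - 2 * b - \<delta>) * ?L \<le> X y \<omega>)}"
      proof (rule finite_measure_mono)
        show "(\<Union>x\<in>P. gev x) \<subseteq> {\<omega>\<in>space M. \<exists>x. real N / 4 \<le> depth N x \<and>
          (\<forall>y. sdist x y \<le> real N powr b \<longrightarrow> 2 * sqrt g_const * (1 - 2 * b - \<delta>) * ?L \<le> X y \<omega>)}"
        proof
          fix \<omega> assume "\<omega> \<in> (\<Union>x\<in>P. gev x)"
          then obtain x where x: "x \<in> P" "\<omega> \<in> gev x" by blast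
          have "2 * sqrt g_const * (1 - 2 * b - \<delta>) * ?L \<le> X y \<omega>" if "sdist x y \<le> real N powr b" for y
          proof -
            have "2 * sqrt g_const * (1 - 2 * b - \<delta>) * ?L \<le> (2 * sqrt g_const * (1 - 2 * b) - 2 * d) * ?L"
              using ds N by (intro mult_right_mono) (auto simp: algebra_simps)
            also have "\<dots> \<le> X y \<omega>" by (rule gev_imp[OF x(2) that])
            finally show ?thesis .
          qed
          moreover have "\<omega> \<in> space M" using x(2) by (simp add: gev_def)
          ultimately show "\<omega> \<in> {\<omega>\<in>space M. \<exists>x. real N / 4 \<le> depth N x \<and>
            (\<forall>y. sdist x y \<le> real N powr b \<longrightarrow> 2 * sqrt g_const * (1 - 2 * b - \<delta>) * ?L \<le> X y \<omega>)}"
            using PP(2)[OF x(1)] by blast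
        qed
        have fin: "finite {x. real N / 4 \<le> depth N x}"
        proof (rule finite_subset)
          show "{x. real N / 4 \<le> depth N x} \<subseteq> {1..int N} \<times> {1..int N}"
            unfolding depth_def by auto
        qed simp
        note [measurable] = gfamD(3)[OF g]
        have "{\<omega>\<in>space M. \<exists>x\<in>{x. real N / 4 \<le> depth N x}. \<forall>y\<in>{y. sdist x y \<le> real N powr b}.
            2 * sqrt g_const * (1 - 2 * b - \<delta>) * ?L \<le> X y \<omega>} \<in> sets M"
          by (intro sets.sets_Collect_finite_Ex sets.sets_Collect_finite_All fin finite_sball) measurable
        then show "{\<omega>\<in>space M. \<exists>x. real N / 4 \<le> depth N x \<and>
          (\<forall>y. sdist x y \<le> real N powr b \<longrightarrow> 2 * sqrt g_const * (1 - 2 * b - \<delta>) * ?L \<le> X y \<omega>)} \<in> sets M"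
          by simp
      qed
      finally show "real N powr (- \<epsilon>) \<le> measure M {\<omega>\<in>space M. \<exists>x. real N / 4 \<le> depth N x \<and>
        (\<forall>y. sdist x y \<le> real N powr b \<longrightarrow> 2 * sqrt g_const * (1 - 2 * b - \<delta>) * ln (real N) \<le> X y \<omega>)}" .
    qed
  qed
qed

section \<open>The domain Markov property\<close>

lemma greenN_sym: "greenN N x y = greenN N y x"
  unfolding greenN_tailG by (rule tailG_sym)

lemma greenN_outside: "y \<notin> intVN N \<Longrightarrow> greenN N x y = 0"
  unfolding greenN_tailG by (rule tailG_outside2)

definition lap :: "(site \<Rightarrow> real) \<Rightarrow> site \<Rightarrow> real" where
  "lap f z = f z - (\<Sum>w\<in>nbrs z. f w) / 4"

text \<open>On the interior the Green function inverts the identity minus the averaging operator: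
  the Green sum from time 1 on is resolved at the last step.\<close>

lemma lap_greenN:
  assumes "z \<in> intVN N"
  shows "lap (greenN N x) z = (if z = x then 1 else 0)"
proof -
  have "tailG N (Suc 0) x z = (\<Sum>n. \<Sum>w\<in>nbrs z. kw N n x w / 4)"
    unfolding tailG_def using assms by (simp only: add_Suc_right add_0_right kw_Suc2 if_True sum_divide_distrib)
  also have "\<dots> = (\<Sum>w\<in>nbrs z. \<Sum>n. kw N n x w / 4)"
    by (intro suminf_sum summable_divide summable_kw)
  also have "\<dots> = (\<Sum>w\<in>nbrs z. greenN N x w) / 4"
    unfolding greenN_def sum_divide_distrib by (intro sum.cong refl suminf_divide summable_kw)
  finally have "greenN N x z = kw N 0 x z + (\<Sum>w\<in>nbrs z. greenN N x w) / 4"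
    using tailG_Suc[of N 0 x z] by (simp add: greenN_tailG)
  then show ?thesis using assms by (auto simp: lap_def)
qed

text \<open>The neighbour relation is symmetric, and both functions vanish off \<open>A\<close>, so
  no boundary terms appear.\<close>

lemma lap_sum_by_parts:
  assumes A: "finite A" and f: "\<And>z. z \<notin> A \<Longrightarrow> f z = 0" and h: "\<And>z. z \<notin> A \<Longrightarrow> h z = 0"
  shows "(\<Sum>z\<in>A. lap f z * h z) = (\<Sum>z\<in>A. f z * lap h z)"
proof -
  have n: "(\<Sum>w\<in>nbrs z. u w) = (\<Sum>w\<in>A. if w \<in> nbrs z then u w else 0)" if "\<And>z. z \<notin> A \<Longrightarrow> u z = 0"
    for u :: "site \<Rightarrow> real" and z
  proof -
    have "(\<Sum>w\<in>nbrs z. u w) = (\<Sum>w\<in>nbrs z \<inter> A. u w)"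
      by (rule sum.mono_neutral_right) (use that in auto)
    also have "\<dots> = (\<Sum>w\<in>A. if w \<in> nbrs z then u w else 0)"
      using A by (simp add: sum.inter_restrict Int_commute)
    finally show ?thesis .
  qed
  have "(\<Sum>z\<in>A. (\<Sum>w\<in>nbrs z. f w) * h z) = (\<Sum>z\<in>A. \<Sum>w\<in>A. (if w \<in> nbrs z then f w else 0) * h z)"
    by (simp add: n[OF f] sum_distrib_right)
  also have "\<dots> = (\<Sum>w\<in>A. \<Sum>z\<in>A. (if w \<in> nbrs z then f w else 0) * h z)"
    by (rule sum.swap)
  also have "\<dots> = (\<Sum>w\<in>A. \<Sum>z\<in>A. f w * (if z \<in> nbrs w then h z else 0))"
    by (intro sum.cong refl) (auto simp: nbrs_sym)
  also have "\<dots> = (\<Sum>w\<in>A. f w * (\<Sum>z\<in>nbrs w. h z))"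
    by (simp add: n[OF h] sum_distrib_left)
  finally show ?thesis
    by (simp add: lap_def left_diff_distrib right_diff_distrib sum_subtractf flip: sum_divide_distrib)
qed

text \<open>Since the block Green function is extended by 0, its Laplacian is the point mass at
  \<open>v + x\<close> plus nonpositive masses on the boundary layer of the block. Paired with the
  field this subtracts the harmonic extension of the boundary values.\<close>

definition greenB :: "nat \<Rightarrow> site \<Rightarrow> site \<Rightarrow> site \<Rightarrow> real" where
  "greenB n v x z = greenN n x (z - v)"

text \<open>Applying the Green operator of the block \<open>v + intVN n\<close> to the Laplacian of the field gives the
  part of the field inside the block that is independent of the outside; this avoids harmonic
  measure.\<close>

definition psi :: "nat \<Rightarrow> nat \<Rightarrow> (site \<Rightarrow> 'a \<Rightarrow> real) \<Rightarrow> site \<Rightarrow> site \<Rightarrow> 'a \<Rightarrow> real" where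
  "psi N n X v x \<omega> = (\<Sum>z\<in>intVN N. lap (greenB n v x) z * X z \<omega>)"

definition inside :: "nat \<Rightarrow> nat \<Rightarrow> site \<Rightarrow> bool" where
  "inside N n v \<longleftrightarrow> 0 \<le> fst v \<and> fst v + int n \<le> int N \<and> 0 \<le> snd v \<and> snd v + int n \<le> int N"

text \<open>Distance \<open>n\<close> is enough although the Laplacian of \<open>greenB\<close> also
  charges boundary points of its block: these still lie in \<open>v + {1..n}^2\<close>, which is
  disjoint from the other block.\<close>

definition apart :: "nat \<Rightarrow> site \<Rightarrow> site \<Rightarrow> bool" where
  "apart n v v' \<longleftrightarrow> int n \<le> \<bar>fst v - fst v'\<bar> \<or> int n \<le> \<bar>snd v - snd v'\<bar>"

lemma inside_int: "inside N n v \<Longrightarrow> z - v \<in> intVN n \<Longrightarrow> z \<in> intVN N"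
  by (cases z; cases v) (auto simp: inside_def intVN_eq)

lemma inside_int': "inside N n v \<Longrightarrow> x \<in> intVN n \<Longrightarrow> v + x \<in> intVN N"
  by (rule inside_int[of N n v]) auto

lemma greenB_outside: "z - v \<notin> intVN n \<Longrightarrow> greenB n v x z = 0"
  by (simp add: greenB_def greenN_outside)

lemma lap_greenB_shift: "lap (greenB n v x) z = lap (greenN n x) (z - v)"
  by (cases z; cases v) (simp add: lap_def greenB_def sum_nbrs algebra_simps)

lemma lap_greenB_apart:
  assumes "apart n v v'" "z - v \<in> intVN n"
  shows "lap (greenB n v' x) z = 0"
proof -
  have "z - v' \<notin> intVN n" "\<And>w. w \<in> nbrs z \<Longrightarrow> w - v' \<notin> intVN n"
    using assms by (cases z; cases v; cases v'; auto simp: apart_def intVN_eq nbrs_def)+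
  then show ?thesis by (simp add: lap_def greenB_outside)
qed

text \<open>Summation by parts moves the Laplacian onto \<open>greenN N\<close>, where it becomes a
  point mass. So the covariance of the block field with any linear functional is given by
  \<open>greenB\<close> alone.\<close>

lemma green_lap:
  assumes "inside N n v"
  shows "(\<Sum>i\<in>intVN N. \<Sum>i'\<in>intVN N. lap (greenB n v x) i * c i' * greenN N i i') = (\<Sum>i\<in>intVN N. c i * greenB n v x i)"
proof -
  have "(\<Sum>i\<in>intVN N. \<Sum>i'\<in>intVN N. lap (greenB n v x) i * c i' * greenN N i i')
      = (\<Sum>i'\<in>intVN N. c i' * (\<Sum>i\<in>intVN N. lap (greenB n v x) i * greenN N i' i))"
    unfolding sum_distrib_left by (subst sum.swap) (intro sum.cong refl, simp add: greenN_sym)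
  also have "\<dots> = (\<Sum>i'\<in>intVN N. c i' * (\<Sum>i\<in>intVN N. greenB n v x i * lap (greenN N i') i))"
    by (intro sum.cong refl arg_cong2[where f = "(*)"] lap_sum_by_parts)
      (auto simp: greenN_outside intro!: greenB_outside dest: inside_int[OF assms])
  also have "\<dots> = (\<Sum>i'\<in>intVN N. c i' * greenB n v x i')"
  proof (intro sum.cong refl arg_cong2[where f = "(*)"])
    fix i' assume i': "i' \<in> intVN N"
    have "(\<Sum>i\<in>intVN N. greenB n v x i * lap (greenN N i') i) = (\<Sum>i\<in>intVN N. if i = i' then greenB n v x i else 0)"
      by (intro sum.cong) (auto simp: lap_greenN)
    then show "(\<Sum>i\<in>intVN N. greenB n v x i * lap (greenN N i') i) = greenB n v x i'"
      using i' by simp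
  qed
  finally show ?thesis .
qed

lemma cov_psi:
  assumes v: "inside N n v" "inside N n v'" and x: "x' \<in> intVN n" and a: "v \<noteq> v' \<Longrightarrow> apart n v v'"
  shows "(\<Sum>i\<in>intVN N. \<Sum>i'\<in>intVN N. lap (greenB n v x) i * lap (greenB n v' x') i' * greenN N i i')
    = (if v = v' then greenN n x x' else 0)"
proof -
  have "(\<Sum>i\<in>intVN N. lap (greenB n v' x') i * greenB n v x i) = (if v = v' then greenN n x x' else 0)"
  proof (cases "v = v'")
    case True
    have "(\<Sum>i\<in>intVN N. lap (greenB n v' x') i * greenB n v x i) = (\<Sum>i\<in>intVN N. if i = v + x' then greenB n v x i else 0)"
    proof (intro sum.cong refl)
      fix i
      show "lap (greenB n v' x') i * greenB n v x i = (if i = v + x' then greenB n v x i else 0)"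
      proof (cases "i - v \<in> intVN n")
        case in_int: True
        have "i - v = x' \<longleftrightarrow> i = v + x'" by auto
        then show ?thesis
          using in_int True unfolding lap_greenB_shift by (simp add: lap_greenN)
      next
        case False
        then have "greenB n v x i = 0" by (rule greenB_outside)
        then show ?thesis by (simp only: mult_zero_right if_cancel)
      qed
    qed
    also have "\<dots> = greenN n x x'"
      using inside_int'[OF v(1) x] by (simp add: greenB_def)
    finally show ?thesis using True by simp
  next
    case False
    have "lap (greenB n v' x') i * greenB n v x i = 0" for i
      using lap_greenB_apart[OF a[OF False], of i x'] greenB_outside[of i v n x] by auto
    then have "(\<Sum>i\<in>intVN N. lap (greenB n v' x') i * greenB n v x i) = 0"
      by (intro sum.neutral ballI)
    then show ?thesis using False by simp
  qed
  then show ?thesis unfolding green_lap[OF v(1)] .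
qed

lemma psi_meas:
  assumes "gfam M (intVN N) X K"
  shows "psi N n X v x \<in> borel_measurable M"
proof -
  note [measurable] = gfamD(3)[OF assms]
  show ?thesis unfolding psi_def[abs_def] by measurable
qed

lemma gfam_psi:
  assumes g: "gfam M (intVN N) X (greenN N)" and V: "finite V"
    and ins: "\<And>v. v \<in> V \<Longrightarrow> inside N n v" and ap: "\<And>v v'. v \<in> V \<Longrightarrow> v' \<in> V \<Longrightarrow> v \<noteq> v' \<Longrightarrow> apart n v v'"
  shows "gfam M (V \<times> intVN n) (\<lambda>p. psi N n X (fst p) (snd p))
    (\<lambda>p p'. if fst p = fst p' then greenN n (snd p) (snd p') else 0)"
proof (rule gfam_linear[OF g, where c = "\<lambda>p. lap (greenB n (fst p) (snd p))"])
  show "finite (V \<times> intVN n)" using V by simp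
  show "psi N n X (fst p) (snd p) \<in> borel_measurable M" for p by (rule psi_meas[OF g])
  show "psi N n X (fst p) (snd p) \<omega> = (\<Sum>i\<in>intVN N. lap (greenB n (fst p) (snd p)) i * X i \<omega>)" for p \<omega>
    by (simp add: psi_def)
  show "(if fst p = fst p' then greenN n (snd p) (snd p') else 0)
    = (\<Sum>i\<in>intVN N. \<Sum>i'\<in>intVN N. lap (greenB n (fst p) (snd p)) i * lap (greenB n (fst p') (snd p')) i' * greenN N i i')"
    if "p \<in> V \<times> intVN n" "p' \<in> V \<times> intVN n" for p p'
    using that by (intro cov_psi[symmetric] ins ap) auto
qed

text \<open>The harmonic part at one fixed site is adjoined under the index \<open>None\<close>. It
  is uncorrelated with the block field because both the full field and the block field at
  \<open>v + y\<close> have covariance \<open>greenN n x y\<close> with the block field at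
  \<open>x\<close>.\<close>

lemma gfam_psi_harm:
  assumes g: "gfam M (intVN N) X (greenN N)" and v: "inside N n v" and y: "y \<in> intVN n"
  shows "gfam M (insert None (Some ` intVN n))
    (\<lambda>i. case i of None \<Rightarrow> (\<lambda>\<omega>. X (v + y) \<omega> - psi N n X v y \<omega>) | Some x \<Rightarrow> psi N n X v x)
    (\<lambda>i j. case i of None \<Rightarrow> (case j of None \<Rightarrow> greenN N (v + y) (v + y) - greenN n y y | Some _ \<Rightarrow> 0)
      | Some x \<Rightarrow> (case j of None \<Rightarrow> 0 | Some x' \<Rightarrow> greenN n x x'))"
proof (rule gfam_linear[OF g, where c = "\<lambda>i z. case i of None \<Rightarrow> (if z = v + y then 1 else 0) - lap (greenB n v y) z
    | Some x \<Rightarrow> lap (greenB n v x) z"])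
  let ?I = "intVN N"
  have vy: "v + y \<in> ?I" by (rule inside_int'[OF v y])
  note [measurable] = gfamD(3)[OF g] psi_meas[OF g]
  show "finite (insert None (Some ` intVN n))" by simp
  show "(case i of None \<Rightarrow> (\<lambda>\<omega>. X (v + y) \<omega> - psi N n X v y \<omega>) | Some x \<Rightarrow> psi N n X v x) \<in> borel_measurable M" for i
    by (cases i) simp_all
  have d: "(\<Sum>z\<in>?I. (if z = v + y then 1 else 0) * u z) = u (v + y)" for u :: "site \<Rightarrow> real"
  proof -
    have "(\<Sum>z\<in>?I. (if z = v + y then 1 else 0) * u z) = (\<Sum>z\<in>?I. if z = v + y then u z else 0)"
      by (intro sum.cong) auto
    then show ?thesis using vy by simp
  qed
  show "(case i of None \<Rightarrow> (\<lambda>\<omega>. X (v + y) \<omega> - psi N n X v y \<omega>) | Some x \<Rightarrow> psi N n X v x) \<omega>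
    = (\<Sum>z\<in>?I. (case i of None \<Rightarrow> (if z = v + y then 1 else 0) - lap (greenB n v y) z | Some x \<Rightarrow> lap (greenB n v x) z) * X z \<omega>)" for i \<omega>
    by (cases i) (simp_all add: psi_def left_diff_distrib sum_subtractf d)
  have cp: "(\<Sum>i\<in>?I. \<Sum>i'\<in>?I. lap (greenB n v x) i * lap (greenB n v x') i' * greenN N i i') = greenN n x x'"
    if "x' \<in> intVN n" for x x'
    using cov_psi[OF v v that, of x] by simp
  have cd: "(\<Sum>i\<in>?I. \<Sum>i'\<in>?I. lap (greenB n v x) i * (if i' = v + y then 1 else 0) * greenN N i i') = greenN n x y" for x
    unfolding green_lap[OF v] d by (simp add: greenB_def)
  have sw: "(\<Sum>i\<in>?I. \<Sum>i'\<in>?I. a i * b i' * greenN N i i') = (\<Sum>i\<in>?I. \<Sum>i'\<in>?I. b i * a i' * greenN N i i')"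
    for a b :: "site \<Rightarrow> real"
    by (subst sum.swap) (simp add: greenN_sym mult_ac)
  have dd: "(\<Sum>i\<in>?I. \<Sum>i'\<in>?I. (if i = v + y then 1 else 0) * (if i' = v + y then 1 else 0) * greenN N i i') = greenN N (v + y) (v + y)"
    unfolding mult.assoc sum_distrib_left[symmetric] d ..
  let ?B = "\<lambda>a b. \<Sum>i\<in>?I. \<Sum>i'\<in>?I. a i * b i' * greenN N i i'"
  have Br: "?B a (\<lambda>z. b z - c z) = ?B a b - ?B a c" for a b c :: "site \<Rightarrow> real"
    by (simp only: left_diff_distrib right_diff_distrib sum_subtractf)
  have Bl: "?B (\<lambda>z. b z - c z) a = ?B b a - ?B c a" for a b c :: "site \<Rightarrow> real"
    by (simp only: left_diff_distrib right_diff_distrib sum_subtractf)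
  let ?d = "\<lambda>z. if z = v + y then 1 else 0 :: real" and ?l = "\<lambda>x. lap (greenB n v x)"
  have c1: "?B (?l x) (\<lambda>z. ?d z - ?l y z) = 0" for x
    unfolding Br cd cp[OF y] by simp
  have c1': "?B (\<lambda>z. ?d z - ?l y z) (?l x) = 0" for x
    using c1[of x] sw[of "?l x"] by simp
  have c2: "?B ?d (\<lambda>z. ?d z - ?l y z) = greenN N (v + y) (v + y) - greenN n y y"
    unfolding Br dd sw[of ?d "?l y"] cd ..
  have c3: "?B (\<lambda>z. ?d z - ?l y z) (\<lambda>z. ?d z - ?l y z) = greenN N (v + y) (v + y) - greenN n y y"
    using c1[of y] c2 unfolding Bl by simp
  show "(case i of None \<Rightarrow> (case j of None \<Rightarrow> greenN N (v + y) (v + y) - greenN n y y | Some _ \<Rightarrow> 0)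
      | Some x \<Rightarrow> (case j of None \<Rightarrow> 0 | Some x' \<Rightarrow> greenN n x x'))
    = (\<Sum>z\<in>?I. \<Sum>z'\<in>?I. (case i of None \<Rightarrow> (if z = v + y then 1 else 0) - lap (greenB n v y) z | Some x \<Rightarrow> lap (greenB n v x) z)
      * (case j of None \<Rightarrow> (if z' = v + y then 1 else 0) - lap (greenB n v y) z' | Some x \<Rightarrow> lap (greenB n v x) z') * greenN N z z')"
    if "i \<in> insert None (Some ` intVN n)" "j \<in> insert None (Some ` intVN n)" for i j
  proof (cases i; cases j)
    fix x x' assume "i = Some x" "j = Some x'"
    with that cp[of x' x] show ?thesis by auto
  next
    fix x assume "i = Some x" "j = None"
    then show ?thesis using c1[of x] by simp
  next
    fix x assume "i = None" "j = Some x"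
    then show ?thesis using c1'[of x] by simp
  next
    assume "i = None" "j = None"
    then show ?thesis using c3 by simp
  qed
qed

section \<open>Independence over blocks and control of the harmonic part\<close>

lemma gfam_tail:
  assumes g: "gfam M I X K" and i: "i \<in> I" and a: "0 \<le> a"
  shows "measure M {\<omega>\<in>space M. s \<le> X i \<omega>} \<le> exp (a * a * K i i / 2 - a * s)"
    "measure M {\<omega>\<in>space M. X i \<omega> \<le> - s} \<le> exp (a * a * K i i / 2 - a * s)"
proof -
  interpret prob_space M by (rule gfamD(1)[OF g])
  note [measurable] = gfamD(3)[OF g]
  have I: "finite I" by (rule gfamD(2)[OF g])
  have *: "measure M {\<omega>\<in>space M. s * \<bar>c\<bar> \<le> c * X i \<omega>} \<le> exp (c * c * K i i / 2 - \<bar>c\<bar> * s)" for c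
  proof -
    have d: "(\<Sum>j\<in>I. (if j = i then c else 0) * u j) = c * u i" for u :: "_ \<Rightarrow> real"
    proof -
      have "(\<Sum>j\<in>I. (if j = i then c else 0) * u j) = (\<Sum>j\<in>I. if j = i then c * u j else 0)"
        by (intro sum.cong) auto
      then show ?thesis using i I by simp
    qed
    have v: "(\<Sum>j\<in>I. \<Sum>k\<in>I. (if j = i then c else 0) * (if k = i then c else 0) * K j k) = c * c * K i i"
      unfolding mult.assoc sum_distrib_left[symmetric] d ..
    have int: "integrable M (\<lambda>\<omega>. exp (c * X i \<omega>))" and E: "(\<integral>\<omega>. exp (c * X i \<omega>) \<partial>M) = exp (c * c * K i i / 2)"
      using gfam_mgf[OF g, of "\<lambda>j. if j = i then c else 0"] unfolding d v by auto
    have "measure M {\<omega>\<in>space M. s * \<bar>c\<bar> \<le> c * X i \<omega>} = measure M {\<omega>\<in>space M. exp (s * \<bar>c\<bar>) \<le> exp (c * X i \<omega>)}"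
      by simp
    also have "\<dots> \<le> (\<integral>\<omega>. exp (c * X i \<omega>) \<partial>M) / exp (s * \<bar>c\<bar>)"
      by (rule integral_Markov_inequality_measure[OF int, where A = "{}"]) auto
    finally show ?thesis by (simp add: E exp_diff mult.commute)
  qed
  show "measure M {\<omega>\<in>space M. s \<le> X i \<omega>} \<le> exp (a * a * K i i / 2 - a * s)"
  proof (cases "a = 0")
    case False
    then show ?thesis using *[of a] a by (simp add: mult.commute[of s])
  qed (simp add: measure_le_1)
  show "measure M {\<omega>\<in>space M. X i \<omega> \<le> - s} \<le> exp (a * a * K i i / 2 - a * s)"
  proof (cases "a = 0")
    case False
    then have a: "0 < a" using a by simp
    have "X i \<omega> \<le> - s \<longleftrightarrow> s * \<bar>- a\<bar> \<le> - a * X i \<omega>" for \<omega>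
    proof -
      have "s * a \<le> (- X i \<omega>) * a \<longleftrightarrow> s \<le> - X i \<omega>"
        using a by (rule mult_le_cancel_right_pos)
      then show ?thesis using a by (auto simp: mult.commute)
    qed
    then show ?thesis using *[of "- a"] a by simp
  qed (simp add: measure_le_1)
qed

text \<open>Fields of separated blocks are jointly Gaussian and uncorrelated; the induction splits
  off one block and applies independence of the remaining group.\<close>

lemma blocks_fail:
  assumes g: "gfam M (intVN N) X (greenN N)" and V: "finite V"
    and ins: "\<And>v. v \<in> V \<Longrightarrow> inside N n v" and ap: "\<And>v v'. v \<in> V \<Longrightarrow> v' \<in> V \<Longrightarrow> v \<noteq> v' \<Longrightarrow> apart n v v'"
    and E[measurable]: "E \<in> sets (PiM (intVN n) (\<lambda>_. borel))"
    and p: "\<And>v. v \<in> V \<Longrightarrow> p \<le> measure M {\<omega>\<in>space M. (\<lambda>x\<in>intVN n. psi N n X v x \<omega>) \<in> E}"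
  shows "measure M {\<omega>\<in>space M. \<forall>v\<in>V. (\<lambda>x\<in>intVN n. psi N n X v x \<omega>) \<notin> E} \<le> (1 - p) ^ card V"
  using V ins ap p
proof (induction V rule: finite_induct)
  case empty
  interpret prob_space M by (rule gfamD(1)[OF g])
  show ?case by (simp add: prob_space)
next
  case (insert v V)
  interpret prob_space M by (rule gfamD(1)[OF g])
  note [measurable] = psi_meas[OF g]
  have res[measurable]: "(\<lambda>\<omega>. \<lambda>x\<in>intVN n. psi N n X u x \<omega>) \<in> measurable M (PiM (intVN n) (\<lambda>_. borel))" for u
    by (rule measurable_restrict) simp
  let ?Y = "\<lambda>p. psi N n X (fst p) (snd p)"
  let ?I = "V \<times> intVN n" and ?J = "{v} \<times> intVN n"
  have IJ: "insert v V \<times> intVN n = ?I \<union> ?J" by auto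
  have gf: "gfam M (?I \<union> ?J) ?Y (\<lambda>p p'. if fst p = fst p' then greenN n (snd p) (snd p') else 0)"
    unfolding IJ[symmetric] using insert by (intro gfam_psi[OF g]) auto
  define E1 where "E1 = {w\<in>space (PiM ?I (\<lambda>_. borel)). \<forall>u\<in>V. (\<lambda>x\<in>intVN n. w (u, x)) \<notin> E}"
  define F1 where "F1 = {w\<in>space (PiM ?J (\<lambda>_. borel)). (\<lambda>x\<in>intVN n. w (v, x)) \<notin> E}"
  have m: "(\<lambda>w. \<lambda>x\<in>intVN n. w (u, x)) \<in> measurable (PiM (U \<times> intVN n) (\<lambda>_. borel :: real measure)) (PiM (intVN n) (\<lambda>_. borel))"
    if "u \<in> U" for u and U :: "site set"
    using that by (intro measurable_restrict measurable_component_singleton) auto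
  have "{w\<in>space (PiM ?I (\<lambda>_. borel)). (\<lambda>x\<in>intVN n. w (u, x)) \<notin> E} \<in> sets (PiM ?I (\<lambda>_. borel :: real measure))" if "u \<in> V" for u
    using m[OF that] by measurable
  then have E1: "E1 \<in> sets (PiM ?I (\<lambda>_. borel))"
    unfolding E1_def using insert.hyps(1) by (intro sets.sets_Collect_finite_All) auto
  have F1: "F1 \<in> sets (PiM ?J (\<lambda>_. borel))"
    unfolding F1_def using m[of v "{v}"] by measurable
  have r: "(\<lambda>x\<in>intVN n. (\<lambda>p\<in>U \<times> intVN n. ?Y p \<omega>) (u, x)) = (\<lambda>x\<in>intVN n. psi N n X u x \<omega>)" if "u \<in> U" for u U \<omega>
    using that by (auto simp: restrict_def)
  let ?A = "{\<omega>\<in>space M. \<forall>u\<in>V. (\<lambda>x\<in>intVN n. psi N n X u x \<omega>) \<notin> E}"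
  let ?B = "{\<omega>\<in>space M. (\<lambda>x\<in>intVN n. psi N n X v x \<omega>) \<notin> E}"
  have A: "(\<lambda>p\<in>?I. ?Y p \<omega>) \<in> E1 \<longleftrightarrow> (\<forall>u\<in>V. (\<lambda>x\<in>intVN n. psi N n X u x \<omega>) \<notin> E)" for \<omega>
    unfolding E1_def using r[of _ V \<omega>] by (simp add: space_PiM)
  have B: "(\<lambda>p\<in>?J. ?Y p \<omega>) \<in> F1 \<longleftrightarrow> (\<lambda>x\<in>intVN n. psi N n X v x \<omega>) \<notin> E" for \<omega>
    unfolding F1_def using r[of v "{v}" \<omega>] by (simp add: space_PiM)
  have "measure M {\<omega>\<in>space M. (\<lambda>p\<in>?I. ?Y p \<omega>) \<in> E1 \<and> (\<lambda>p\<in>?J. ?Y p \<omega>) \<in> F1}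
      = measure M {\<omega>\<in>space M. (\<lambda>p\<in>?I. ?Y p \<omega>) \<in> E1} * measure M {\<omega>\<in>space M. (\<lambda>p\<in>?J. ?Y p \<omega>) \<in> F1}"
    using insert.hyps(2) by (intro gfam_indep[OF gf _ _ E1 F1]) auto
  then have "measure M {\<omega>\<in>space M. \<forall>u\<in>insert v V. (\<lambda>x\<in>intVN n. psi N n X u x \<omega>) \<notin> E} = measure M ?A * measure M ?B"
    unfolding A B by (simp add: conj_commute)
  also have "\<dots> \<le> (1 - p) ^ card V * (1 - p)"
  proof (rule mult_mono)
    show "measure M ?A \<le> (1 - p) ^ card V"
      using insert.prems by (intro insert.IH) auto
    have "measure M ?B = 1 - measure M {\<omega>\<in>space M. (\<lambda>x\<in>intVN n. psi N n X v x \<omega>) \<in> E}"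
      by (subst prob_compl[symmetric]) (auto intro!: arg_cong[where f = prob])
    then show B': "measure M ?B \<le> 1 - p" using insert.prems(3)[OF insertI1] by linarith
    have "0 \<le> 1 - p" using B' measure_nonneg[of M ?B] by linarith
    then show "0 \<le> (1 - p) ^ card V" by simp
  qed simp
  also have "\<dots> = (1 - p) ^ card (insert v V)"
    using insert.hyps by simp
  finally show ?case .
qed

text \<open>The selected point depends on the block field only, so the harmonic part at that point is no
  larger in law than at a fixed point: no union bound over the block is paid.\<close>

lemma selected_harm_bound:
  fixes X :: "site \<Rightarrow> 'a \<Rightarrow> real"
  assumes g: "gfam M (intVN N) X (greenN N)" and v: "inside N n v" and S: "S \<subseteq> intVN n"
    and p: "0 \<le> p" "\<And>x. x \<in> S \<Longrightarrow> measure M {\<omega>\<in>space M. s \<le> X (v + x) \<omega> - psi N n X v x \<omega>} \<le> p"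
  shows "measure M {\<omega>\<in>space M. \<exists>x\<in>S. (psi N n X v x \<omega> \<le> c \<and> (\<forall>x'\<in>S. psi N n X v x' \<omega> \<le> c \<longrightarrow> to_nat x \<le> to_nat x'))
    \<and> s \<le> X (v + x) \<omega> - psi N n X v x \<omega>} \<le> p"
proof -
  interpret prob_space M by (rule gfamD(1)[OF g])
  note [measurable] = psi_meas[OF g] gfamD(3)[OF g]
  have fS: "finite S" using S by (rule finite_subset) simp
  \<comment> \<open>Taking the least code among the low sites makes the choice unique, so the
    selection events are disjoint and their probabilities add up to at most 1.\<close>
  define sel where "sel = (\<lambda>(f :: site \<Rightarrow> real) x. f x \<le> c \<and> (\<forall>x'\<in>S. f x' \<le> c \<longrightarrow> to_nat x \<le> to_nat x'))"
  let ?f = "\<lambda>\<omega> x. psi N n X v x \<omega>" and ?h = "\<lambda>x \<omega>. X (v + x) \<omega> - psi N n X v x \<omega>"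
  have uniq: "x = x'" if "x \<in> S" "x' \<in> S" "sel f x" "sel f x'" for x x' f
  proof -
    have "to_nat x = to_nat x'" using that unfolding sel_def by (intro antisym) auto
    then show ?thesis by simp
  qed
  have selM: "{\<omega>\<in>space M'. sel (\<lambda>x. G x \<omega>) x} \<in> sets M'"
    if "\<And>x. x \<in> S \<Longrightarrow> G x \<in> borel_measurable M'" "x \<in> S" for G :: "site \<Rightarrow> 'b \<Rightarrow> real" and M' :: "'b measure" and x
  proof -
    have "{\<omega>\<in>space M'. G x' \<omega> \<le> c \<longrightarrow> to_nat x \<le> to_nat x'} \<in> sets M'" if "x' \<in> S" for x'
      using \<open>\<And>x. x \<in> S \<Longrightarrow> G x \<in> borel_measurable M'\<close>[OF that] by measurable
    then have "{\<omega>\<in>space M'. \<forall>x'\<in>S. G x' \<omega> \<le> c \<longrightarrow> to_nat x \<le> to_nat x'} \<in> sets M'"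
      using fS by (intro sets.sets_Collect_finite_All) auto
    moreover have "{\<omega>\<in>space M'. G x \<omega> \<le> c} \<in> sets M'"
      using that(1)[OF that(2)] by measurable
    ultimately show ?thesis unfolding sel_def by (intro sets.sets_Collect_conj)
  qed
  have ind: "measure M {\<omega>\<in>space M. sel (?f \<omega>) x \<and> s \<le> ?h x \<omega>}
      = measure M {\<omega>\<in>space M. sel (?f \<omega>) x} * measure M {\<omega>\<in>space M. s \<le> ?h x \<omega>}" if x: "x \<in> S" for x
  proof -
    \<comment> \<open>\<open>sel\<close> reads only the coordinates tagged \<open>Some\<close>, the
      harmonic part at the fixed site \<open>x\<close> only the coordinate
      \<open>None\<close>.\<close>
    let ?I = "Some ` intVN n" and ?J = "{None :: site option}"
    let ?Y = "\<lambda>i. case i of None \<Rightarrow> (\<lambda>\<omega>. X (v + x) \<omega> - psi N n X v x \<omega>) | Some x \<Rightarrow> psi N n X v x"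
    define E where "E = {w\<in>space (PiM ?I (\<lambda>_. borel :: real measure)). sel (\<lambda>x. w (Some x)) x}"
    define F where "F = {w\<in>space (PiM ?J (\<lambda>_. borel :: real measure)). s \<le> w None}"
    have E: "E \<in> sets (PiM ?I (\<lambda>_. borel))"
      unfolding E_def using S x by (intro selM measurable_component_singleton) auto
    have F: "F \<in> sets (PiM ?J (\<lambda>_. borel))"
      unfolding F_def by measurable
    have gf: "gfam M (?I \<union> ?J) ?Y
      (\<lambda>i j. case i of None \<Rightarrow> (case j of None \<Rightarrow> greenN N (v + x) (v + x) - greenN n x x | Some _ \<Rightarrow> 0)
      | Some x \<Rightarrow> (case j of None \<Rightarrow> 0 | Some x' \<Rightarrow> greenN n x x'))"
      using gfam_psi_harm[OF g v, of x] x S by auto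
    have "sel (\<lambda>y. if Some y \<in> ?I then psi N n X v y \<omega> else undefined) x \<longleftrightarrow> sel (?f \<omega>) x" for \<omega>
    proof -
      have "x \<in> intVN n" "\<forall>x'\<in>S. x' \<in> intVN n" using S x by blast+
      then show ?thesis unfolding sel_def by (simp add: inj_image_mem_iff)
    qed
    moreover have "(\<lambda>y. (\<lambda>i\<in>?I. ?Y i \<omega>) (Some y)) = (\<lambda>y. if Some y \<in> ?I then psi N n X v y \<omega> else undefined)" for \<omega>
      by (auto simp: restrict_def)
    moreover have "(\<lambda>i\<in>?I. ?Y i \<omega>) \<in> space (PiM ?I (\<lambda>_. borel :: real measure))" for \<omega>
      by (simp add: space_PiM)
    ultimately have Ei: "(\<lambda>i\<in>?I. ?Y i \<omega>) \<in> E \<longleftrightarrow> sel (?f \<omega>) x" for \<omega>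
      unfolding E_def mem_Collect_eq by (simp only: simp_thms)
    have Fi: "(\<lambda>i\<in>?J. ?Y i \<omega>) \<in> F \<longleftrightarrow> s \<le> ?h x \<omega>" for \<omega>
      unfolding F_def by (simp add: space_PiM)
    show ?thesis
      by (rule gfam_indep[OF gf _ _ E F, unfolded Ei Fi]) auto
  qed
  have m: "{\<omega>\<in>space M. sel (?f \<omega>) x} \<in> sets M" if "x \<in> S" for x
    using that by (intro selM) auto
  have m2: "{\<omega>\<in>space M. sel (?f \<omega>) x \<and> s \<le> ?h x \<omega>} \<in> sets M" if "x \<in> S" for x
    by (rule sets.sets_Collect_conj[OF _ m[OF that]]) measurable
  have "measure M {\<omega>\<in>space M. \<exists>x\<in>S. sel (?f \<omega>) x \<and> s \<le> ?h x \<omega>}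
      = measure M (\<Union>x\<in>S. {\<omega>\<in>space M. sel (?f \<omega>) x \<and> s \<le> ?h x \<omega>})"
    by (intro arg_cong[where f = prob]) auto
  also have "\<dots> \<le> (\<Sum>x\<in>S. measure M {\<omega>\<in>space M. sel (?f \<omega>) x \<and> s \<le> ?h x \<omega>})"
    using m2 fS by (intro finite_measure_subadditive_finite) auto
  also have "\<dots> \<le> (\<Sum>x\<in>S. measure M {\<omega>\<in>space M. sel (?f \<omega>) x} * p)"
    by (intro sum_mono) (simp add: ind p mult_left_mono)
  also have "\<dots> = measure M (\<Union>x\<in>S. {\<omega>\<in>space M. sel (?f \<omega>) x}) * p"
  proof -
    have "disjoint_family_on (\<lambda>x. {\<omega>\<in>space M. sel (?f \<omega>) x}) S"
      unfolding disjoint_family_on_def using uniq by blast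
    then show ?thesis
      using m fS by (subst finite_measure_finite_Union) (auto simp: sum_distrib_right)
  qed
  also have "\<dots> \<le> 1 * p" by (intro mult_right_mono p prob_le_1)
  finally show ?thesis by (simp add: sel_def)
qed

text \<open>The sign \<open>c\<close> allows the plateau estimate to be applied to the negative of
  the block field, which produces low points.\<close>

lemma gfam_psi_single:
  assumes g: "gfam M (intVN N) X (greenN N)" and v: "inside N n v" and c: "c * c = 1"
  shows "gfam M (intVN n) (\<lambda>x \<omega>. c * psi N n X v x \<omega>) (greenN n)"
proof (rule gfam_linear[OF g, where c = "\<lambda>x z. c * lap (greenB n v x) z"])
  show "finite (intVN n)" by simp
  note [measurable] = psi_meas[OF g]
  show "(\<lambda>\<omega>. c * psi N n X v x \<omega>) \<in> borel_measurable M" for x by measurable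
  show "c * psi N n X v x \<omega> = (\<Sum>i\<in>intVN N. c * lap (greenB n v x) i * X i \<omega>)" for x \<omega>
    by (simp add: psi_def sum_distrib_left mult.assoc)
  show "greenN n x x' = (\<Sum>i\<in>intVN N. \<Sum>i'\<in>intVN N. c * lap (greenB n v x) i * (c * lap (greenB n v x') i') * greenN N i i')"
    if "x \<in> intVN n" "x' \<in> intVN n" for x x'
  proof -
    have "(\<Sum>i\<in>intVN N. \<Sum>i'\<in>intVN N. c * lap (greenB n v x) i * (c * lap (greenB n v x') i') * greenN N i i')
        = (c * c) * (\<Sum>i\<in>intVN N. \<Sum>i'\<in>intVN N. lap (greenB n v x) i * lap (greenB n v x') i' * greenN N i i')"
      unfolding sum_distrib_left by (intro sum.cong refl) (simp add: mult_ac)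
    then show ?thesis using cov_psi[OF v v that(2), of x] c by simp
  qed
qed

lemma harm_tail:
  assumes g: "gfam M (intVN N) X (greenN N)" and v: "inside N n v" and y: "y \<in> intVN n" and a: "0 \<le> a"
    and var: "greenN N (v + y) (v + y) - greenN n y y \<le> V"
  shows "measure M {\<omega>\<in>space M. s \<le> X (v + y) \<omega> - psi N n X v y \<omega>} \<le> exp (a * a * V / 2 - a * s)"
    "measure M {\<omega>\<in>space M. X (v + y) \<omega> - psi N n X v y \<omega> \<le> - s} \<le> exp (a * a * V / 2 - a * s)"
proof -
  have "exp (a * a * (greenN N (v + y) (v + y) - greenN n y y) / 2 - a * s) \<le> exp (a * a * V / 2 - a * s)"
    using var by (simp add: mult_left_mono)
  then show "measure M {\<omega>\<in>space M. s \<le> X (v + y) \<omega> - psi N n X v y \<omega>} \<le> exp (a * a * V / 2 - a * s)"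
    "measure M {\<omega>\<in>space M. X (v + y) \<omega> - psi N n X v y \<omega> \<le> - s} \<le> exp (a * a * V / 2 - a * s)"
    using gfam_tail[OF gfam_psi_harm[OF g v y], of None a s] a by (auto elim: order.trans)
qed

section \<open>Blocks of polynomial size\<close>

definition bsize :: "real \<Rightarrow> nat \<Rightarrow> nat" where
  "bsize c N = nat \<lfloor>real N powr c\<rfloor>"

lemma bsize_bounds:
  assumes "1 \<le> N" "0 < c"
  shows "real (bsize c N) \<le> real N powr c" "real N powr c \<le> 2 * real (bsize c N)" "1 \<le> bsize c N"
    "ln (real (bsize c N)) \<le> c * ln (real N)" "c * ln (real N) - ln 2 \<le> ln (real (bsize c N))"
proof -
  have p: "1 \<le> real N powr c" using assms by (intro ge_one_powr_ge_zero) auto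
  then show 1: "real (bsize c N) \<le> real N powr c" "real N powr c \<le> 2 * real (bsize c N)" "1 \<le> bsize c N"
  proof -
    have f: "1 \<le> \<lfloor>real N powr c\<rfloor>" using p by (simp add: le_floor_iff)
    then have b: "real (bsize c N) = real_of_int \<lfloor>real N powr c\<rfloor>" by (simp add: bsize_def)
    show "real (bsize c N) \<le> real N powr c" unfolding b by simp
    show "real N powr c \<le> 2 * real (bsize c N)" unfolding b using f by linarith
    have "1 \<le> real (bsize c N)" unfolding b using f by linarith
    then show "1 \<le> bsize c N" by simp
  qed
  have "ln (real (bsize c N)) \<le> ln (real N powr c)" using 1 by (intro ln_mono) auto
  then show "ln (real (bsize c N)) \<le> c * ln (real N)" by simp
  have "ln (real N powr c) \<le> ln (2 * real (bsize c N))" using 1 p assms(1) by (intro ln_mono) auto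
  then show "c * ln (real N) - ln 2 \<le> ln (real (bsize c N))" using 1 by (simp add: ln_mult)
qed

lemma filterlim_bsize: "0 < c \<Longrightarrow> filterlim (bsize c) sequentially sequentially"
  unfolding bsize_def by real_asymp

lemma eventually_bsize: "0 < c \<Longrightarrow> eventually Q sequentially \<Longrightarrow> \<forall>\<^sub>F N in sequentially. Q (bsize c N)"
  using filterlim_bsize[of c] unfolding filterlim_iff by blast

text \<open>The variance of the harmonic part is the difference of the two Green functions, about
  \<open>g ln N - g c ln N\<close>. Only the block term needs a site away from the boundary, hence
  the depth condition in the block alone.\<close>

lemma harm_var_asymp:
  assumes c: "0 < c" "c \<le> 1" and e: "0 < e"
  shows "\<forall>\<^sub>F N in sequentially. \<forall>z y. real (bsize c N) / 6 \<le> depth (bsize c N) y \<longrightarrow>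
    greenN N z z - greenN (bsize c N) y y \<le> (g_const * (1 - c) + e) * ln (real N)"
proof -
  have "\<forall>\<^sub>F N in sequentially. \<forall>x y m. real N powr (2 * 0) \<le> real m + 1 \<longrightarrow>
    tailG N m x y \<le> (g_const * (1 - 0) + e / 3) * ln (real N)"
    using e by (intro tailG_upper_asymp) auto
  moreover have "\<forall>\<^sub>F N in sequentially. \<forall>x y m. real (bsize c N) / 6 \<le> depth (bsize c N) x \<longrightarrow>
    sdist x y \<le> real (bsize c N) powr 0 \<longrightarrow> real m \<le> 5 * real (bsize c N) powr (2 * 0) \<longrightarrow>
    (g_const * (1 - 0) - e / 3) * ln (real (bsize c N)) \<le> tailG (bsize c N) m x y"
    using e by (intro eventually_bsize[OF c(1)] tailG_lower_asymp) auto
  moreover have "\<forall>\<^sub>F N in sequentially. g_const * ln 2 \<le> e / 3 * ln (real N)"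
    using e by real_asymp
  moreover have "\<forall>\<^sub>F N in sequentially. (2::nat) \<le> N"
    by (rule eventually_ge_at_top)
  ultimately show ?thesis
  proof eventually_elim
    case (elim N)
    let ?L = "ln (real N)" and ?l = "ln (real (bsize c N))"
    have N: "1 \<le> N" "0 \<le> ?L" using elim(4) by auto
    note bs = bsize_bounds[OF N(1) c(1)]
    show ?case
    proof (intro allI impI)
      fix z y assume y: "real (bsize c N) / 6 \<le> depth (bsize c N) y"
      have u: "greenN N z z \<le> (g_const + e / 3) * ?L"
        using elim(1)[rule_format, of 0 z z] N by (simp add: greenN_tailG)
      have "sdist y y \<le> real (bsize c N) powr 0" using bs(3) by (simp add: sdist_def)
      then have lo: "(g_const - e / 3) * ?l \<le> greenN (bsize c N) y y"
        using elim(2)[rule_format, of y y 0] y by (simp add: greenN_tailG)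
      have "?l \<le> 1 * ?L" using bs(4) c N mult_right_mono[of c 1 ?L] by linarith
      then have "e / 3 * ?l \<le> e / 3 * ?L" using e by (intro mult_left_mono) auto
      moreover have "g_const * (c * ?L - ln 2) \<le> g_const * ?l"
        using bs(5) g_const_pos by (intro mult_left_mono) auto
      ultimately have "g_const * (c * ?L - ln 2) - e / 3 * ?L \<le> greenN (bsize c N) y y"
        using lo by (simp add: left_diff_distrib)
      then show "greenN N z z - greenN (bsize c N) y y \<le> (g_const * (1 - c) + e) * ?L"
        using u elim(3) by (simp add: algebra_simps)
    qed
  qed
qed

lemma deep_int: "0 < n \<Longrightarrow> real n / 6 \<le> depth n y \<Longrightarrow> y \<in> intVN n"
  unfolding depth_def intVN_eq by (cases y) auto

lemma finite_deep: "finite {x. real n / 4 \<le> depth n x}"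
proof (rule finite_subset)
  show "{x. real n / 4 \<le> depth n x} \<subseteq> {1..int n} \<times> {1..int n}"
    unfolding depth_def by auto
qed simp

section \<open>Upper and lower bounds for the plateau size\<close>

text \<open>The distance to the complement of a square is attained along a coordinate axis, so it is
  tested at the four axis projections just outside. Together with the converse below this replaces
  the Euclidean condition by coordinate inequalities.\<close>

lemma VNl_D:
  assumes "x \<in> VNl l N"
  shows "l * real N \<le> real_of_int (fst x)" "l * real N \<le> real N + 1 - real_of_int (fst x)"
    "l * real N \<le> real_of_int (snd x)" "l * real N \<le> real N + 1 - real_of_int (snd x)" "x \<in> VN N"
proof -
  show x: "x \<in> VN N" using assms by (simp add: VNl_def)
  have *: "l * real N \<le> sqrt (real_of_int ((fst x - fst z)\<^sup>2 + (snd x - snd z)\<^sup>2))" if "z \<notin> VN N" for z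
    using assms that unfolding VNl_def by blast
  show "l * real N \<le> real_of_int (fst x)" "l * real N \<le> real N + 1 - real_of_int (fst x)"
    "l * real N \<le> real_of_int (snd x)" "l * real N \<le> real N + 1 - real_of_int (snd x)"
    using *[of "(0, snd x)"] *[of "(int N + 1, snd x)"] *[of "(fst x, 0)"] *[of "(fst x, int N + 1)"] x
    by (auto simp: VN_def abs_if split: if_splits)
qed

lemma VNl_I:
  assumes "l * real N \<le> real_of_int (fst x)" "l * real N \<le> real N + 1 - real_of_int (fst x)"
    "l * real N \<le> real_of_int (snd x)" "l * real N \<le> real N + 1 - real_of_int (snd x)" "x \<in> VN N"
  shows "x \<in> VNl l N"
  unfolding VNl_def
proof (intro CollectI conjI allI impI assms(5))
  fix z assume z: "z \<notin> VN N"
  let ?a = "real_of_int (fst x - fst z)" and ?b = "real_of_int (snd x - snd z)"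
  have "l * real N \<le> \<bar>?a\<bar> \<or> l * real N \<le> \<bar>?b\<bar>"
  proof -
    have "fst z \<le> 0 \<or> int N + 1 \<le> fst z \<or> snd z \<le> 0 \<or> int N + 1 \<le> snd z"
      using z by (cases z) (auto simp: VN_def)
    then have "real_of_int (fst z) \<le> 0 \<or> real N + 1 \<le> real_of_int (fst z)
        \<or> real_of_int (snd z) \<le> 0 \<or> real N + 1 \<le> real_of_int (snd z)"
      by linarith
    then show ?thesis using assms(1-4) by (elim disjE) auto
  qed
  moreover have "\<bar>?a\<bar> \<le> sqrt (?a\<^sup>2 + ?b\<^sup>2)" "\<bar>?b\<bar> \<le> sqrt (?a\<^sup>2 + ?b\<^sup>2)"
    by (rule real_le_rsqrt, simp)+
  ultimately have "l * real N \<le> sqrt (?a\<^sup>2 + ?b\<^sup>2)"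
    by linarith
  then show "l * real N \<le> sqrt (real_of_int ((fst x - fst z)\<^sup>2 + (snd x - snd z)\<^sup>2))"
    by simp
qed

lemma pow_le_exp:
  assumes "p \<le> 1"
  shows "(1 - p) ^ m \<le> exp (- (p * real m))"
proof -
  have "(1 - p) ^ m \<le> exp (- p) ^ m"
    using exp_ge_add_one_self[of "- p"] assms by (intro power_mono) auto
  also have "\<dots> = exp (- (p * real m))"
    by (simp add: mult.commute flip: exp_of_nat_mult)
  finally show ?thesis .
qed

lemma plateau_sets:
  "{w\<in>space (PiM (intVN n) (\<lambda>_. borel :: real measure)). \<exists>x\<in>{x. real n / 4 \<le> depth n x}.
     \<forall>y\<in>intVN n. sdist x y \<le> r \<longrightarrow> c \<le> u * w y} \<in> sets (PiM (intVN n) (\<lambda>_. borel))"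
proof (intro sets.sets_Collect_finite_Ex sets.sets_Collect_finite_All finite_deep finite_intVN)
  fix x y assume y: "y \<in> intVN n"
  show "{w\<in>space (PiM (intVN n) (\<lambda>_. borel :: real measure)). sdist x y \<le> r \<longrightarrow> c \<le> u * w y} \<in> sets (PiM (intVN n) (\<lambda>_. borel))"
    using measurable_component_singleton[OF y, of "\<lambda>_. borel :: real measure"] by measurable
qed

text \<open>Independent trials: each block succeeds with probability at least \<open>p\<close>, so
  all of them fail with probability at most \<open>exp (- p * card V)\<close>. The sign
  \<open>u\<close> selects high or low plateaus.\<close>

lemma block_plateau:
  fixes X :: "site \<Rightarrow> 'a \<Rightarrow> real"
  assumes plat: "\<forall>(M :: 'a measure) X. gfam M (intVN n) X (greenN n) \<longrightarrow>
      p \<le> measure M {\<omega>\<in>space M. \<exists>x. real n / 4 \<le> depth n x \<and> (\<forall>y. sdist x y \<le> r \<longrightarrow> c \<le> X y \<omega>)}"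
    and g: "gfam M (intVN N) X (greenN N)" and V: "finite V"
    and ins: "\<And>v. v \<in> V \<Longrightarrow> inside N n v" and ap: "\<And>v v'. v \<in> V \<Longrightarrow> v' \<in> V \<Longrightarrow> v \<noteq> v' \<Longrightarrow> apart n v v'"
    and u: "u * u = 1" and p: "p \<le> 1"
  shows "measure M {\<omega>\<in>space M. \<forall>v\<in>V. \<not> (\<exists>x\<in>{x. real n / 4 \<le> depth n x}. \<forall>y\<in>intVN n. sdist x y \<le> r \<longrightarrow> c \<le> u * psi N n X v y \<omega>)}
    \<le> exp (- (p * real (card V)))"
proof -
  interpret prob_space M by (rule gfamD(1)[OF g])
  let ?E = "{w\<in>space (PiM (intVN n) (\<lambda>_. borel :: real measure)). \<exists>x\<in>{x. real n / 4 \<le> depth n x}.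
     \<forall>y\<in>intVN n. sdist x y \<le> r \<longrightarrow> c \<le> u * w y}"
  have Ei: "(\<lambda>x\<in>intVN n. psi N n X v x \<omega>) \<in> ?E \<longleftrightarrow>
      (\<exists>x\<in>{x. real n / 4 \<le> depth n x}. \<forall>y\<in>intVN n. sdist x y \<le> r \<longrightarrow> c \<le> u * psi N n X v y \<omega>)" for v \<omega>
    by (simp add: space_PiM)
  have "measure M {\<omega>\<in>space M. \<forall>v\<in>V. (\<lambda>x\<in>intVN n. psi N n X v x \<omega>) \<notin> ?E} \<le> (1 - p) ^ card V"
  proof (rule blocks_fail[OF g V ins ap plateau_sets])
    fix v assume v: "v \<in> V"
    note [measurable] = psi_meas[OF g]
    have res: "(\<lambda>\<omega>. \<lambda>x\<in>intVN n. psi N n X v x \<omega>) \<in> measurable M (PiM (intVN n) (\<lambda>_. borel))"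
      by (rule measurable_restrict) simp
    have "p \<le> measure M {\<omega>\<in>space M. \<exists>x. real n / 4 \<le> depth n x \<and> (\<forall>y. sdist x y \<le> r \<longrightarrow> c \<le> u * psi N n X v y \<omega>)}"
      using plat gfam_psi_single[OF g ins[OF v] u] by blast
    also have "\<dots> \<le> measure M {\<omega>\<in>space M. (\<lambda>x\<in>intVN n. psi N n X v x \<omega>) \<in> ?E}"
    proof (rule finite_measure_mono)
      show "{\<omega>\<in>space M. (\<lambda>x\<in>intVN n. psi N n X v x \<omega>) \<in> ?E} \<in> sets M"
        using res plateau_sets by measurable
    qed (unfold Ei, blast)
    finally show "p \<le> measure M {\<omega>\<in>space M. (\<lambda>x\<in>intVN n. psi N n X v x \<omega>) \<in> ?E}" .
  qed
  also have "\<dots> \<le> exp (- (p * real (card V)))" by (rule pow_le_exp[OF p])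
  finally show ?thesis unfolding Ei .
qed

lemma plateau_fail_sets:
  assumes g: "gfam M (intVN N) X (greenN N)" and V: "finite V"
  shows "{\<omega>\<in>space M. \<forall>v\<in>V. \<not> (\<exists>x\<in>{x. real n / 4 \<le> depth n x}. \<forall>y\<in>intVN n. sdist x y \<le> r \<longrightarrow> c \<le> u * psi N n X v y \<omega>)} \<in> sets M"
  using psi_meas[OF g]
  by (intro sets.sets_Collect_finite_All sets.sets_Collect_neg sets.sets_Collect_finite_Ex finite_deep finite_intVN V) measurable

text \<open>A single row of adjacent blocks: any positive power of \<open>N\<close> many blocks
  beats the factor \<open>n^(-\<epsilon>)\<close>, so one dimension suffices.\<close>

definition vrow :: "nat \<Rightarrow> site \<Rightarrow> nat \<Rightarrow> site set" where
  "vrow n s m = (\<lambda>i. (fst s + int n * int i, snd s)) ` {..<m}"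

lemma finite_vrow: "finite (vrow n s m)" by (simp add: vrow_def)

lemma card_vrow: "0 < n \<Longrightarrow> card (vrow n s m) = m"
  unfolding vrow_def by (subst card_image) (auto simp: inj_on_def)

lemma apart_mult: "i \<noteq> j \<Longrightarrow> int n \<le> \<bar>int n * i - int n * j\<bar>"
proof -
  assume "i \<noteq> j"
  then have "1 \<le> \<bar>i - j\<bar>" by simp
  then have "int n * 1 \<le> int n * \<bar>i - j\<bar>" by (intro mult_left_mono) auto
  then show ?thesis by (simp add: abs_mult flip: right_diff_distrib)
qed

lemma vrow_apart: "v \<in> vrow n s m \<Longrightarrow> v' \<in> vrow n s m \<Longrightarrow> v \<noteq> v' \<Longrightarrow> apart n v v'"
  unfolding vrow_def apart_def using apart_mult[of "int _" "int _" n] by fastforce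

lemma vrow_inside:
  assumes "0 \<le> fst s" "0 \<le> snd s" "fst s + int n * int m \<le> int N" "snd s + int n \<le> int N" "v \<in> vrow n s m"
  shows "inside N n v"
proof -
  obtain i where i: "i < m" "v = (fst s + int n * int i, snd s)" using assms(5) by (auto simp: vrow_def)
  have "int n * (int i + 1) \<le> int n * int m" using i by (intro mult_left_mono) auto
  then show ?thesis using assms i by (simp add: inside_def distrib_left)
qed

text \<open>The conclusion is stated through measurable exceptional sets \<open>B N\<close>, so that
  the plateau event itself needs no measurability at this point.\<close>

lemma plateau_upper:
  fixes M :: "'a measure" and \<Phi> :: "nat \<Rightarrow> site \<Rightarrow> 'a \<Rightarrow> real"
  assumes g: "\<And>N. 1 \<le> N \<Longrightarrow> gfam M (intVN N) (\<Phi> N) (greenN N)"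
    and l: "0 < l" and b: "(1 - \<eta>) / 2 < b" "b < 1" and \<eta>: "\<eta> < 1"
  shows "\<exists>B. (\<forall>N. B N \<in> sets M) \<and> (\<lambda>N. measure M (B N)) \<longlonglongrightarrow> 0 \<and>
    (\<forall>\<^sub>F N in sequentially. \<forall>\<omega>\<in>space M. \<forall>x\<in>VNl l N.
      (\<forall>y\<in>VN N. sdist x y \<le> real N powr b / 2 \<longrightarrow> 2 * \<eta> * sqrt g_const * ln (real N) \<le> \<Phi> N y \<omega>) \<longrightarrow> \<omega> \<in> B N)"
proof -
  interpret prob_space M using gfamD(1)[OF g[of 1]] by simp
  \<comment> \<open>The block exponent lies halfway between the critical value and \<open>b\<close>;
    \<open>\<kappa>\<close> is the margin by which \<open>1 - 2 c\<close> stays below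
    \<open>\<eta>\<close>.\<close>
  define c where "c = ((1 - \<eta>) / 2 + b) / 2"
  define \<kappa> where "\<kappa> = \<eta> - (1 - 2 * c)"
  have c: "0 < c" "c < b" "c < 1" and k: "0 < \<kappa>" "\<kappa> < 2"
    using b \<eta> by (auto simp: c_def \<kappa>_def field_simps)
  define \<epsilon> where "\<epsilon> = (b - c) / 4"
  have e: "0 < \<epsilon>" using c by (simp add: \<epsilon>_def)
  define n where "n = bsize c"
  define m where "m = (\<lambda>N. nat \<lfloor>real N powr b / 2 / real (n N)\<rfloor>)"
  \<comment> \<open>\<open>s N\<close> is the typical maximum of the harmonic part over the blocks,
    with a margin. \<open>lev N\<close> is the depth of a low point of the block field; a single
    point would do, and the tiny exponent \<open>\<kappa> / 16\<close> only meets the positivity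
    demanded by \<open>gff_plateau\<close>.\<close>
  define s where "s = (\<lambda>N. sqrt g_const * (2 * (1 - c) + \<kappa> / 2) * ln (real N))"
  define lev where "lev = (\<lambda>N. 2 * sqrt g_const * (1 - 2 * (\<kappa> / 16) - \<kappa> / 8) * ln (real (n N)))"
  let ?S = "\<lambda>N. {x. real (n N) / 4 \<le> depth (n N) x}"
  \<comment> \<open>The corners are rounded to multiples of the block size, so the rows for all
    \<open>x\<close> draw on one common family \<open>blk N\<close> of order
    \<open>N^(2 (1 - c))\<close> blocks, and the union bound for the harmonic part runs over that
    family.\<close>
  define row where "row = (\<lambda>N (x :: site). vrow (n N) (int (n N) * (fst x div int (n N)), int (n N) * (snd x div int (n N))) (m N))"
  define blk where "blk = (\<lambda>N. (\<lambda>p. (int (n N) * int (fst p), int (n N) * int (snd p))) ` ({..<N div n N} \<times> {..<N div n N}))"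
  \<comment> \<open>\<open>R N x\<close>: no block of a row near \<open>x\<close> contains a low point of its own field;
    \<open>H N v\<close>: the harmonic part is too large at the selected low point of the block \<open>v\<close>.\<close>
  define R where "R = (\<lambda>N x. {\<omega>\<in>space M. \<forall>v\<in>row N x. \<not> (\<exists>x\<in>?S N. \<forall>y\<in>intVN (n N).
    sdist x y \<le> real (n N) powr (\<kappa> / 16) \<longrightarrow> lev N \<le> - 1 * psi N (n N) (\<Phi> N) v y \<omega>)})"
  define H where "H = (\<lambda>N v. {\<omega>\<in>space M. \<exists>x\<in>?S N. (psi N (n N) (\<Phi> N) v x \<omega> \<le> - lev N
      \<and> (\<forall>x'\<in>?S N. psi N (n N) (\<Phi> N) v x' \<omega> \<le> - lev N \<longrightarrow> to_nat x \<le> to_nat x'))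
    \<and> s N \<le> \<Phi> N (v + x) \<omega> - psi N (n N) (\<Phi> N) v x \<omega>})"
  define B where "B = (\<lambda>N. if N = 0 then {} else (\<Union>x\<in>VNl l N. R N x) \<union> (\<Union>v\<in>blk N. H N v))"
  have finV: "finite (VNl l N)" for N
    by (rule finite_subset[of _ "VN N"]) (auto simp: VNl_def VN_def)
  have finb: "finite (blk N)" for N by (simp add: blk_def)
  have Rm: "R N x \<in> sets M" if "1 \<le> N" for N x
    unfolding R_def row_def by (rule plateau_fail_sets[OF g[OF that] finite_vrow])
  have Hm: "H N v \<in> sets M" if "1 \<le> N" for N v
  proof -
    note [measurable] = psi_meas[OF g[OF that]] gfamD(3)[OF g[OF that]]
    show ?thesis
      unfolding H_def
      by (intro sets.sets_Collect_finite_Ex finite_deep sets.sets_Collect_conj sets.sets_Collect_finite_All; measurable)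
  qed
  have Bm: "B N \<in> sets M" for N
    unfolding B_def using Rm Hm finV finb by (auto intro!: sets.finite_UN sets.Un)
  have "\<forall>\<^sub>F N in sequentially. \<forall>(M :: 'a measure) X. gfam M (intVN (n N)) X (greenN (n N)) \<longrightarrow>
    real (n N) powr (- \<epsilon>) \<le> measure M {\<omega>\<in>space M. \<exists>x. real (n N) / 4 \<le> depth (n N) x \<and>
      (\<forall>y. sdist x y \<le> real (n N) powr (\<kappa> / 16) \<longrightarrow> lev N \<le> X y \<omega>)}"
    unfolding lev_def n_def using k c(1) e by (intro eventually_bsize gff_plateau) auto
  moreover have "\<forall>\<^sub>F N in sequentially. \<forall>z y. real (n N) / 6 \<le> depth (n N) y \<longrightarrow>
    greenN N z z - greenN (n N) y y \<le> (g_const * (1 - c) + g_const * \<kappa> / 4) * ln (real N)"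
    unfolding n_def using c k g_const_pos by (intro harm_var_asymp) auto
  moreover have "\<forall>\<^sub>F N in sequentially. real N powr b / 2 \<le> l * real N - 1"
    using b l by real_asymp
  moreover have "\<forall>\<^sub>F N in sequentially. real N powr c \<le> real N powr b / 2"
    using c by real_asymp
  moreover have "\<forall>\<^sub>F N in sequentially. real N powr (2 * \<epsilon>) \<le> real N powr (b - c) / 2 - 1"
    using e c unfolding \<epsilon>_def by real_asymp
  moreover have "\<forall>\<^sub>F N in sequentially. 2 * ln 2 < \<kappa> * ln (real N)"
    using k by real_asymp
  moreover have "\<forall>\<^sub>F N in sequentially. (2::nat) \<le> N"
    by (rule eventually_ge_at_top)
  ultimately have main: "\<forall>\<^sub>F N in sequentially. measure M (B N) \<le> (real N)\<^sup>2 * exp (- (real N powr \<epsilon>)) + 4 * real N powr (- (\<kappa> / 2)) \<and>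
    (\<forall>\<omega>\<in>space M. \<forall>x\<in>VNl l N. (\<forall>y\<in>VN N. sdist x y \<le> real N powr b / 2 \<longrightarrow>
      2 * \<eta> * sqrt g_const * ln (real N) \<le> \<Phi> N y \<omega>) \<longrightarrow> \<omega> \<in> B N)"
  proof eventually_elim
    case (elim N)
    let ?L = "ln (real N)" and ?n = "n N"
    have N: "1 \<le> N" "1 \<le> real N" "0 < ?L" using elim(7) by auto
    note bs = bsize_bounds[OF N(1) c(1), folded n_def]
    have n0: "0 < ?n" "0 < real ?n" using bs(3) by auto
    have gN: "gfam M (intVN N) (\<Phi> N) (greenN N)" by (rule g[OF N(1)])
    have Sint: "x \<in> intVN ?n" if "x \<in> ?S N" for x
      using that n0 by (intro deep_int) auto
    have m1: "real N powr (2 * \<epsilon>) \<le> real (m N)"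
    proof -
      have "real N powr (b - c) / 2 = real N powr b / 2 / real N powr c"
        using N by (simp add: powr_diff)
      also have "\<dots> \<le> real N powr b / 2 / real ?n"
        using bs(1) n0 N by (intro divide_left_mono mult_pos_pos) auto
      finally show ?thesis using elim(5) unfolding m_def by linarith
    qed
    have m2: "real ?n * real (m N) \<le> real N powr b / 2"
    proof -
      have "real (m N) \<le> real N powr b / 2 / real ?n"
        unfolding m_def by simp
      then show ?thesis using n0 by (simp add: le_divide_eq mult.commute)
    qed
    have rowp: "v \<in> row N x \<Longrightarrow> inside N ?n v \<and> v \<in> blk N \<and> (\<forall>y\<in>intVN ?n. sdist x (v + y) \<le> real N powr b / 2)"
      if x: "x \<in> VNl l N" for v x
    proof -
      assume v: "v \<in> row N x"
      note xD = VNl_D[OF x]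
      let ?q1 = "fst x div int ?n" and ?q2 = "snd x div int ?n"
      have x1: "1 \<le> fst x" "1 \<le> snd x" using xD(5) by (auto simp: VN_def)
      have q0: "0 \<le> ?q1" "0 \<le> ?q2" using x1 by (auto intro: pos_imp_zdiv_nonneg_iff[THEN iffD2] simp: n0)
      have q1: "int ?n * ?q1 \<le> fst x" "fst x < int ?n * ?q1 + int ?n" "int ?n * ?q2 \<le> snd x" "snd x < int ?n * ?q2 + int ?n"
        using n0 by (auto simp: mult.commute[of "int ?n"] minus_mod_eq_div_mult[symmetric] intro: pos_mod_bound)
      obtain i where i: "i < m N" "v = (int ?n * ?q1 + int ?n * int i, int ?n * ?q2)"
        using v by (auto simp: row_def vrow_def)
      have nm: "real_of_int (int ?n * int (m N)) \<le> real N powr b / 2" using m2 by simp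
      have nb: "real_of_int (int ?n) \<le> real N powr b / 2" using bs(1) elim(4) by simp
      have im: "int ?n * int i + int ?n \<le> int ?n * int (m N)"
      proof -
        have "int ?n * (int i + 1) \<le> int ?n * int (m N)" using i by (intro mult_left_mono) auto
        then show ?thesis by (simp add: distrib_left)
      qed
      have "real_of_int (int ?n * ?q1 + int ?n * int (m N)) \<le> real N"
        using q1(1) nm xD(2) elim(3) by linarith
      then have t1: "int ?n * ?q1 + int ?n * int (m N) \<le> int N" by linarith
      have "real_of_int (int ?n * ?q2 + int ?n) \<le> real N"
        using q1(3) nb xD(4) elim(3) by linarith
      then have t2: "int ?n * ?q2 + int ?n \<le> int N" by linarith
      have ins: "inside N ?n v"
        using v q0 t1 t2 n0 unfolding row_def by (intro vrow_inside) auto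
      have "v \<in> blk N"
      proof -
        have d1: "int ?n * (?q1 + int i + 1) \<le> int N" using t1 im by (simp add: algebra_simps)
        have d2: "int ?n * (?q2 + 1) \<le> int N" using t2 by (simp add: algebra_simps)
        have "nat (?q1 + int i) < N div ?n"
        proof -
          have "int (?n * (nat (?q1 + int i) + 1)) \<le> int N" using d1 q0 by (simp add: algebra_simps)
          then have "(nat (?q1 + int i) + 1) * ?n \<le> N" by (simp only: of_nat_le_iff mult.commute)
          then have "nat (?q1 + int i) + 1 \<le> N div ?n" using n0 by (simp only: less_eq_div_iff_mult_less_eq)
          then show ?thesis by simp
        qed
        moreover have "nat ?q2 < N div ?n"
        proof -
          have "int (?n * (nat ?q2 + 1)) \<le> int N" using d2 q0 by (simp add: algebra_simps)
          then have "(nat ?q2 + 1) * ?n \<le> N" by (simp only: of_nat_le_iff mult.commute)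
          then have "nat ?q2 + 1 \<le> N div ?n" using n0 by (simp only: less_eq_div_iff_mult_less_eq)
          then show ?thesis by simp
        qed
        moreover have "v = (int ?n * int (nat (?q1 + int i)), int ?n * int (nat ?q2))"
          using q0 i by (simp add: distrib_left)
        ultimately show ?thesis unfolding blk_def by (intro image_eqI[where x = "(nat (?q1 + int i), nat ?q2)"]) auto
      qed
      moreover have "sdist x (v + y) \<le> real N powr b / 2" if y: "y \<in> intVN ?n" for y
      proof -
        have y': "1 \<le> fst y" "fst y \<le> int ?n" "1 \<le> snd y" "snd y \<le> int ?n" using y by (auto simp: intVN_eq)
        have i0: "0 \<le> int ?n * int i" by simp
        have vy: "fst (v + y) = int ?n * ?q1 + int ?n * int i + fst y" "snd (v + y) = int ?n * ?q2 + snd y"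
          by (simp_all add: i(2))
        have "\<bar>fst x - fst (v + y)\<bar> \<le> int ?n * int (m N)" "\<bar>snd x - snd (v + y)\<bar> \<le> int ?n"
          unfolding vy using y' q1 im i0 by linarith+
        then have "real_of_int \<bar>fst x - fst (v + y)\<bar> \<le> real N powr b / 2" "real_of_int \<bar>snd x - snd (v + y)\<bar> \<le> real N powr b / 2"
          using nm nb by linarith+
        then show ?thesis unfolding sdist_def by (simp add: max_def)
      qed
      ultimately show ?thesis using ins by blast
    qed
    have p1: "real ?n powr (- \<epsilon>) \<le> 1"
      using bs(3) e powr_mono[of "- \<epsilon>" 0 "real ?n"] by simp
    have R_le: "measure M (R N x) \<le> exp (- (real N powr \<epsilon>))" if x: "x \<in> VNl l N" for x
    proof -
      have "measure M (R N x) \<le> exp (- (real ?n powr (- \<epsilon>) * real (card (row N x))))"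
        unfolding R_def
      proof (rule block_plateau[OF elim(1) gN])
        show "finite (row N x)" by (simp add: row_def finite_vrow)
        show "inside N ?n v" if "v \<in> row N x" for v using rowp[OF x that] by blast
        show "apart ?n v v'" if "v \<in> row N x" "v' \<in> row N x" "v \<noteq> v'" for v v'
          using that unfolding row_def by (rule vrow_apart)
      qed (use p1 in auto)
      also have "card (row N x) = m N" unfolding row_def by (rule card_vrow[OF n0(1)])
      also have "exp (- (real ?n powr (- \<epsilon>) * real (m N))) \<le> exp (- (real N powr \<epsilon>))"
      proof -
        have "real ?n \<le> real N powr 1"
          using bs(1) c N powr_mono[of c 1 "real N"] by linarith
        \<comment> \<open>A row has at least \<open>N powr (2 * \<epsilon>)\<close> blocks, against
          a success probability of at least \<open>N powr (- \<epsilon>)\<close> each.\<close>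
        then have "real N powr (- \<epsilon>) \<le> real ?n powr (- \<epsilon>)"
          using e n0 N by (intro powr_mono2') auto
        then have "real N powr (- \<epsilon>) * real N powr (2 * \<epsilon>) \<le> real ?n powr (- \<epsilon>) * real (m N)"
          using m1 by (intro mult_mono) auto
        then show ?thesis by (simp flip: powr_add)
      qed
      finally show ?thesis .
    qed
    have blk_ins: "inside N ?n v" if v: "v \<in> blk N" for v
    proof -
      obtain i j where ij: "i < N div ?n" "j < N div ?n" "v = (int ?n * int i, int ?n * int j)"
        using v by (auto simp: blk_def)
      have "int ?n * int i + int ?n \<le> int N" if "i < N div ?n" for i
      proof -
        have "Suc i * ?n \<le> N" using that n0 by (simp only: Suc_le_eq less_eq_div_iff_mult_less_eq flip: Suc_le_eq)
        then have "int (Suc i * ?n) \<le> int N" by (simp only: of_nat_le_iff)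
        then show ?thesis by (simp add: algebra_simps)
      qed
      with ij show ?thesis by (simp add: inside_def)
    qed
    have H_le: "measure M (H N v) \<le> exp (- ((2 * (1 - c) + \<kappa> / 2) * ?L))" if v: "v \<in> blk N" for v
      unfolding H_def
    proof (rule selected_harm_bound[OF gN blk_ins[OF v]])
      show "?S N \<subseteq> intVN ?n" using Sint by blast
      fix x assume x: "x \<in> ?S N"
      let ?V = "(g_const * (1 - c) + g_const * \<kappa> / 4) * ?L"
      have "measure M {\<omega>\<in>space M. s N \<le> \<Phi> N (v + x) \<omega> - psi N ?n (\<Phi> N) v x \<omega>} \<le> exp (gam * gam * ?V / 2 - gam * s N)"
      proof (rule harm_tail(1)[OF gN blk_ins[OF v] Sint[OF x]])
        show "greenN N (v + x) (v + x) - greenN ?n x x \<le> ?V"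
          using x by (intro elim(2)[rule_format]) auto
      qed (use gam_pos in simp)
      \<comment> \<open>With the tilt \<open>gam\<close> the exponent is
        \<open>2 (1 - c) + \<kappa> / 2\<close>: the first part pays for the number of blocks, the
        second is the remaining decay.\<close>
      also have "gam * gam * ?V / 2 - gam * s N = - ((2 * (1 - c) + \<kappa> / 2) * ?L)"
      proof -
        have "gam * sqrt g_const = 2" using g_const_pos by (simp add: gam_def)
        then have 1: "gam * s N = 2 * (2 * (1 - c) + \<kappa> / 2) * ?L"
          unfolding s_def by (metis mult.assoc)
        have "gam * gam * ?V / 2 = (gam * gam * g_const) * ((1 - c) + \<kappa> / 4) * ?L / 2"
          by (simp add: algebra_simps)
        then have "gam * gam * ?V / 2 = 2 * ((1 - c) + \<kappa> / 4) * ?L" unfolding gam_sq_g by simp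
        with 1 show ?thesis by (simp add: algebra_simps)
      qed
      finally show "measure M {\<omega>\<in>space M. s N \<le> \<Phi> N (v + x) \<omega> - psi N ?n (\<Phi> N) v x \<omega>} \<le> exp (- ((2 * (1 - c) + \<kappa> / 2) * ?L))" .
    qed simp
    have "measure M (B N) \<le> measure M (\<Union>x\<in>VNl l N. R N x) + measure M (\<Union>v\<in>blk N. H N v)"
      unfolding B_def using N Rm Hm finV finb by (auto intro!: measure_Un_le sets.finite_UN)
    also have "measure M (\<Union>x\<in>VNl l N. R N x) \<le> (\<Sum>x\<in>VNl l N. measure M (R N x))"
      using Rm N finV by (intro finite_measure_subadditive_finite) auto
    also have "\<dots> \<le> (\<Sum>x\<in>VNl l N. exp (- (real N powr \<epsilon>)))" by (intro sum_mono R_le)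
    also have "\<dots> \<le> (real N)\<^sup>2 * exp (- (real N powr \<epsilon>))"
    proof -
      have "card (VNl l N) \<le> card (VN N)" by (intro card_mono) (auto simp: VNl_def VN_def)
      also have "\<dots> = N\<^sup>2" by (simp add: VN_def card_cartesian_product power2_eq_square)
      finally have "real (card (VNl l N)) \<le> real (N\<^sup>2)" by (rule of_nat_mono)
      then show ?thesis by (simp add: mult_right_mono)
    qed
    also have "measure M (\<Union>v\<in>blk N. H N v) \<le> (\<Sum>v\<in>blk N. measure M (H N v))"
      using Hm N finb by (intro finite_measure_subadditive_finite) auto
    also have "\<dots> \<le> (\<Sum>v\<in>blk N. exp (- ((2 * (1 - c) + \<kappa> / 2) * ?L)))" by (intro sum_mono H_le)
    also have "\<dots> \<le> 4 * real N powr (2 * (1 - c)) * exp (- ((2 * (1 - c) + \<kappa> / 2) * ?L))"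
    proof -
      have "card (blk N) \<le> card ({..<N div ?n} \<times> {..<N div ?n})"
        unfolding blk_def by (rule card_image_le) simp
      also have "\<dots> = (N div ?n)\<^sup>2" by (simp add: card_cartesian_product power2_eq_square)
      finally have "real (card (blk N)) \<le> (real (N div ?n))\<^sup>2"
        using of_nat_mono[of "card (blk N)" "(N div ?n)\<^sup>2", where 'a = real] by simp
      also have "\<dots> \<le> (2 * real N powr (1 - c))\<^sup>2"
      proof (rule power_mono)
        have "real (N div ?n) \<le> real N / real ?n" by (rule of_nat_div_le_of_nat)
        also have "\<dots> \<le> real N / (real N powr c / 2)"
          using bs(2) N n0 by (intro divide_left_mono mult_pos_pos) auto
        also have "\<dots> = 2 * real N powr (1 - c)" using N by (simp add: powr_diff)
        finally show "real (N div ?n) \<le> 2 * real N powr (1 - c)" .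
      qed simp
      also have "\<dots> = 4 * real N powr (2 * (1 - c))"
        by (simp add: power_mult_distrib) (simp add: power2_eq_square algebra_simps flip: powr_add)
      finally show ?thesis by (simp add: mult_right_mono)
    qed
    also have "\<dots> = 4 * real N powr (- (\<kappa> / 2))"
      using N by (simp add: powr_def algebra_simps flip: exp_add)
    finally have 1: "measure M (B N) \<le> (real N)\<^sup>2 * exp (- (real N powr \<epsilon>)) + 4 * real N powr (- (\<kappa> / 2))"
      by simp
    have 2: "\<omega> \<in> B N" if \<omega>: "\<omega> \<in> space M" and x: "x \<in> VNl l N"
      and hi: "\<forall>y\<in>VN N. sdist x y \<le> real N powr b / 2 \<longrightarrow> 2 * \<eta> * sqrt g_const * ?L \<le> \<Phi> N y \<omega>" for \<omega> x
    proof (rule ccontr)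
      assume "\<omega> \<notin> B N"
      then have nR: "\<omega> \<notin> R N x" and nH: "\<And>v. v \<in> blk N \<Longrightarrow> \<omega> \<notin> H N v"
        using N x by (auto simp: B_def)
      from nR \<omega> obtain v z where v: "v \<in> row N x" and z: "z \<in> ?S N"
        and zy: "\<forall>y\<in>intVN ?n. sdist z y \<le> real ?n powr (\<kappa> / 16) \<longrightarrow> lev N \<le> - 1 * psi N ?n (\<Phi> N) v y \<omega>"
        unfolding R_def by blast
      let ?lo = "\<lambda>y. y \<in> ?S N \<and> psi N ?n (\<Phi> N) v y \<omega> \<le> - lev N"
      have "?lo z" using zy Sint[OF z] z by (force simp: sdist_def)
      \<comment> \<open>The point used is the one that \<open>H N v\<close> refers to, the low site
        with the least code, not the plateau centre \<open>z\<close>.\<close>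
      then obtain y where y: "?lo y" "\<forall>y'. ?lo y' \<longrightarrow> to_nat y \<le> to_nat y'"
        using ex_has_least_nat[of ?lo z to_nat] by blast
      have vb: "v \<in> blk N" "inside N ?n v" "sdist x (v + y) \<le> real N powr b / 2"
        using rowp[OF x v] Sint[of y] y(1) by blast+
      have "\<Phi> N (v + y) \<omega> - psi N ?n (\<Phi> N) v y \<omega> < s N"
      proof (rule ccontr)
        assume "\<not> ?thesis"
        then have s: "s N \<le> \<Phi> N (v + y) \<omega> - psi N ?n (\<Phi> N) v y \<omega>" by simp
        have "\<forall>x'\<in>?S N. psi N ?n (\<Phi> N) v x' \<omega> \<le> - lev N \<longrightarrow> to_nat y \<le> to_nat x'"
          using y(2) by blast
        then have "\<omega> \<in> H N v"
          unfolding H_def using s \<omega> y(1) by blast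
        then show False using nH[OF vb(1)] by blast
      qed
      then have up: "\<Phi> N (v + y) \<omega> < s N - lev N" using y(1) by linarith
      have "v + y \<in> VN N"
        using inside_int'[OF vb(2) Sint[of y]] y(1) by (auto simp: intVN_def)
      then have "2 * \<eta> * sqrt g_const * ?L \<le> s N - lev N" using hi vb(3) up by force
      moreover have "s N - lev N < 2 * \<eta> * sqrt g_const * ?L"
      proof -
        \<comment> \<open>To leading order the sum is
          \<open>2 (1 - c) + \<kappa> / 2 - 2 c + \<kappa> c / 2\<close>, at most
          \<open>2 (1 - 2 c) + \<kappa>\<close>, while
          \<open>2 \<eta> = 2 (1 - 2 c) + 2 \<kappa>\<close>; the remaining \<open>\<kappa>\<close>
          absorbs the rounding \<open>ln 2\<close>.\<close>
        have q: "0 \<le> 1 - \<kappa> / 4" using k by simp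
        have "sqrt g_const * (2 * (1 - \<kappa> / 4)) * (c * ?L - ln 2) \<le> sqrt g_const * (2 * (1 - \<kappa> / 4)) * ln (real ?n)"
          using bs(5) q g_const_pos by (intro mult_left_mono mult_nonneg_nonneg) auto
        also have "\<dots> = lev N" by (simp add: lev_def)
        finally have "s N - lev N \<le> sqrt g_const * ((2 * (1 - c) + \<kappa> / 2) * ?L - 2 * (1 - \<kappa> / 4) * (c * ?L - ln 2))"
          unfolding s_def by (simp add: algebra_simps)
        also have "\<dots> < sqrt g_const * (2 * \<eta> * ?L)"
        proof (rule mult_strict_left_mono)
          have "\<kappa> / 2 * c * ?L \<le> \<kappa> / 2 * 1 * ?L" using k c N by (intro mult_right_mono mult_left_mono) auto
          moreover have "0 \<le> \<kappa> / 2 * ln 2" using k by simp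
          moreover have "2 * \<eta> * ?L = 2 * (\<kappa> + 1 - 2 * c) * ?L" by (simp add: \<kappa>_def)
          ultimately show "(2 * (1 - c) + \<kappa> / 2) * ?L - 2 * (1 - \<kappa> / 4) * (c * ?L - ln 2) < 2 * \<eta> * ?L"
            using elim(6) by (simp only:) (simp add: algebra_simps)
        qed (simp add: g_const_pos)
        finally show ?thesis by (simp add: mult_ac)
      qed
      ultimately show False by simp
    qed
    show ?case using 1 2 by blast
  qed
  have "(\<lambda>N. measure M (B N)) \<longlonglongrightarrow> 0"
  proof (rule tendsto_sandwich[OF _ _ tendsto_const])
    show "\<forall>\<^sub>F N in sequentially. 0 \<le> measure M (B N)" by simp
    show "\<forall>\<^sub>F N in sequentially. measure M (B N) \<le> (real N)\<^sup>2 * exp (- (real N powr \<epsilon>)) + 4 * real N powr (- (\<kappa> / 2))"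
      using main by (rule eventually_mono) blast
    show "(\<lambda>N. (real N)\<^sup>2 * exp (- (real N powr \<epsilon>)) + 4 * real N powr (- (\<kappa> / 2))) \<longlonglongrightarrow> 0"
      using e k by (intro tendsto_add_zero; real_asymp)
  qed
  moreover have "\<forall>\<^sub>F N in sequentially. \<forall>\<omega>\<in>space M. \<forall>x\<in>VNl l N. (\<forall>y\<in>VN N. sdist x y \<le> real N powr b / 2 \<longrightarrow>
      2 * \<eta> * sqrt g_const * ln (real N) \<le> \<Phi> N y \<omega>) \<longrightarrow> \<omega> \<in> B N"
    using main by (rule eventually_mono) blast
  ultimately show ?thesis using Bm by blast
qed

text \<open>Blocks of size \<open>N^(1 - \<kappa>)\<close> lose little in the level and leave a
  harmonic part of small variance, while their number is still a power of \<open>N\<close>; this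
  raises the polynomially small probability to one.\<close>

lemma plateau_lower:
  fixes M :: "'a measure" and \<Phi> :: "nat \<Rightarrow> site \<Rightarrow> 'a \<Rightarrow> real"
  assumes g: "\<And>N. 1 \<le> N \<Longrightarrow> gfam M (intVN N) (\<Phi> N) (greenN N)"
    and l: "0 < l" "l < 1 / 2" and b: "0 < b" "b < (1 - \<eta>) / 2" and \<eta>: "-1 < \<eta>" "\<eta> < 1"
  shows "\<exists>B. (\<forall>N. B N \<in> sets M) \<and> (\<lambda>N. measure M (B N)) \<longlonglongrightarrow> 0 \<and>
    (\<forall>\<^sub>F N in sequentially. \<forall>\<omega>\<in>space M. \<omega> \<notin> B N \<longrightarrow> (\<exists>x\<in>VNl l N.
      \<forall>y. sdist x y \<le> real N powr b \<longrightarrow> y \<in> VN N \<and> 2 * \<eta> * sqrt g_const * ln (real N) \<le> \<Phi> N y \<omega>))"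
proof -
  interpret prob_space M using gfamD(1)[OF g[of 1]] by simp
  \<comment> \<open>The gap to the critical exponent. It is shared between enlarging
    \<open>b\<close> to \<open>b'\<close>, shrinking the block, and the drop \<open>d2\<close>
    granted to the harmonic part.\<close>
  define D where "D = 1 - 2 * b - \<eta>"
  have D: "0 < D" "D < 2" using b \<eta> by (auto simp: D_def field_simps)
  define b' where "b' = b + D / 16"
  have b': "b < b'" "0 < b'" "b' < 1" using b D \<eta> by (auto simp: b'_def D_def field_simps)
  define d2 where "d2 = sqrt g_const * D / 2"
  have d2: "0 < d2" using D g_const_pos by (simp add: d2_def)
  \<comment> \<open>The three bounds keep the loss in \<open>ln n\<close> below
    \<open>D / 12\<close>, the harmonic variance \<open>g \<kappa>\<close> below
    \<open>d2^2 / 24\<close>, and \<open>c * b'\<close> above \<open>b\<close>, so that a plateau of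
    the block is wide enough in the large box.\<close>
  define \<kappa> where "\<kappa> = min (D / 12) (min (d2\<^sup>2 / 24) ((1 - b / b') / 2))"
  have k: "0 < \<kappa>" "\<kappa> \<le> D / 12" "\<kappa> \<le> d2\<^sup>2 / 24" "\<kappa> \<le> (1 - b / b') / 2"
  proof -
    show "0 < \<kappa>" unfolding \<kappa>_def using D d2 b b' by simp
    show "\<kappa> \<le> D / 12" "\<kappa> \<le> d2\<^sup>2 / 24" "\<kappa> \<le> (1 - b / b') / 2"
      unfolding \<kappa>_def by linarith+
  qed
  define c where "c = 1 - \<kappa>"
  have c: "0 < c" "c \<le> 1" using k D by (auto simp: c_def)
  have cb: "b < c * b'"
  proof -
    have "\<kappa> * 2 \<le> 1 - b / b'" using k(4) by simp
    then have "b / b' < c" using k(1) unfolding c_def by simp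
    then show ?thesis using b' by (simp add: divide_less_eq)
  qed
  define \<epsilon> where "\<epsilon> = \<kappa> / 4"
  have e: "0 < \<epsilon>" using k by (simp add: \<epsilon>_def)
  define \<theta> where "\<theta> = 1 - 2 * b' - D / 8"
  have th: "\<theta> = \<eta> + 3 / 4 * D" "\<bar>\<theta>\<bar> \<le> 3"
    using D \<eta> by (auto simp: \<theta>_def b'_def D_def field_simps abs_le_iff)
  define n where "n = bsize c"
  define m where "m = (\<lambda>N. nat \<lfloor>(1 / 2 - l) * real N / real (n N)\<rfloor>)"
  define lev where "lev = (\<lambda>N. 2 * sqrt g_const * (1 - 2 * b' - D / 8) * ln (real (n N)))"
  let ?S = "\<lambda>N. {x. real (n N) / 4 \<le> depth (n N) x}"
  \<comment> \<open>The row starts at the centre and has length at most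
    \<open>(1 / 2 - l) * N\<close>, so it stays inside \<open>VNl l N\<close>.\<close>
  define row where "row = (\<lambda>N. vrow (n N) (int (N div 2), int (N div 2)) (m N))"
  define R where "R = (\<lambda>N. {\<omega>\<in>space M. \<forall>v\<in>row N. \<not> (\<exists>x\<in>?S N. \<forall>y\<in>intVN (n N).
    sdist x y \<le> real (n N) powr b' \<longrightarrow> lev N \<le> 1 * psi N (n N) (\<Phi> N) v y \<omega>)})"
  define Q where "Q = (\<lambda>N. row N \<times> {y\<in>intVN (n N). real (n N) / 6 \<le> depth (n N) y})"
  define H where "H = (\<lambda>N p. {\<omega>\<in>space M. \<Phi> N (fst p + snd p) \<omega> - psi N (n N) (\<Phi> N) (fst p) (snd p) \<omega> \<le> - (d2 * ln (real N))})"
  define B where "B = (\<lambda>N. if N = 0 then {} else R N \<union> (\<Union>p\<in>Q N. H N p))"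
  have finQ: "finite (Q N)" for N by (simp add: Q_def row_def finite_vrow)
  have Rm: "R N \<in> sets M" if "1 \<le> N" for N
    unfolding R_def row_def by (rule plateau_fail_sets[OF g[OF that] finite_vrow])
  have Hm: "H N p \<in> sets M" if "1 \<le> N" for N p
  proof -
    note [measurable] = psi_meas[OF g[OF that]] gfamD(3)[OF g[OF that]]
    show ?thesis unfolding H_def by measurable
  qed
  have Bm: "B N \<in> sets M" for N
    unfolding B_def using Rm Hm finQ by (auto intro!: sets.finite_UN sets.Un)
  have "\<forall>\<^sub>F N in sequentially. \<forall>(M :: 'a measure) X. gfam M (intVN (n N)) X (greenN (n N)) \<longrightarrow>
    real (n N) powr (- \<epsilon>) \<le> measure M {\<omega>\<in>space M. \<exists>x. real (n N) / 4 \<le> depth (n N) x \<and>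
      (\<forall>y. sdist x y \<le> real (n N) powr b' \<longrightarrow> lev N \<le> X y \<omega>)}"
    unfolding lev_def n_def using b' c D e by (intro eventually_bsize gff_plateau) auto
  moreover have "\<forall>\<^sub>F N in sequentially. \<forall>z y. real (n N) / 6 \<le> depth (n N) y \<longrightarrow>
    greenN N z z - greenN (n N) y y \<le> (g_const * (1 - c) + d2\<^sup>2 / 24) * ln (real N)"
    unfolding n_def using c d2 by (intro harm_var_asymp) auto
  moreover have "\<forall>\<^sub>F N in sequentially. real (n N) powr b' + real (n N) / 6 \<le> real (n N) / 4"
    unfolding n_def by (rule eventually_bsize[OF c(1)]) (use b' in real_asymp)
  moreover have "\<forall>\<^sub>F N in sequentially. 2 * real N powr b \<le> real N powr (c * b')"
    using cb by real_asymp
  moreover have "\<forall>\<^sub>F N in sequentially. real N powr (2 * \<epsilon>) \<le> (1 / 2 - l) * real N powr \<kappa> - 1"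
  proof -
    define h where "h = 1 / 2 - l"
    have "0 < h" using l(2) by (simp add: h_def)
    then have "\<forall>\<^sub>F N in sequentially. real N powr (2 * \<epsilon>) \<le> h * real N powr \<kappa> - 1"
      using k e unfolding \<epsilon>_def by real_asymp
    then show ?thesis by (simp add: h_def)
  qed
  moreover have "\<forall>\<^sub>F N in sequentially. 12 * ln 2 \<le> D * ln (real N)"
    using D by real_asymp
  moreover have "\<forall>\<^sub>F N in sequentially. (2::nat) \<le> N"
    by (rule eventually_ge_at_top)
  ultimately have main: "\<forall>\<^sub>F N in sequentially. measure M (B N) \<le> exp (- (real N powr \<epsilon>)) + 1 / real N \<and>
    (\<forall>\<omega>\<in>space M. \<omega> \<notin> B N \<longrightarrow> (\<exists>x\<in>VNl l N.
      \<forall>y. sdist x y \<le> real N powr b \<longrightarrow> y \<in> VN N \<and> 2 * \<eta> * sqrt g_const * ln (real N) \<le> \<Phi> N y \<omega>))"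
  proof eventually_elim
    case (elim N)
    let ?L = "ln (real N)" and ?n = "n N" and ?h = "int (N div 2)"
    have N: "1 \<le> N" "1 \<le> real N" "0 < ?L" using elim(7) by auto
    note bs = bsize_bounds[OF N(1) c(1), folded n_def]
    have n0: "0 < ?n" "0 < real ?n" using bs(3) by auto
    have gN: "gfam M (intVN N) (\<Phi> N) (greenN N)" by (rule g[OF N(1)])
    have m1: "real N powr (2 * \<epsilon>) \<le> real (m N)"
    proof -
      have "(1 / 2 - l) * real N powr \<kappa> = (1 / 2 - l) * real N / real N powr c"
        using N by (simp add: c_def powr_diff)
      also have "\<dots> \<le> (1 / 2 - l) * real N / real ?n"
        using bs(1) n0 N l by (intro divide_left_mono mult_pos_pos mult_nonneg_nonneg) auto
      finally show ?thesis using elim(5) unfolding m_def by linarith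
    qed
    have m2: "real ?n * real (m N) \<le> (1 / 2 - l) * real N"
    proof -
      have "0 \<le> (1 / 2 - l) * real N / real ?n" using l by simp
      then have "real (m N) \<le> (1 / 2 - l) * real N / real ?n"
        unfolding m_def by linarith
      then show ?thesis using n0 by (simp add: le_divide_eq mult.commute)
    qed
    have m0: "1 \<le> m N"
    proof -
      have "0 < real N powr (2 * \<epsilon>)" using N by simp
      then have "0 < real (m N)" using m1 by linarith
      then show ?thesis by simp
    qed
    have half: "real_of_int ?h \<le> real N / 2" "real N / 2 - 1 / 2 \<le> real_of_int ?h"
    proof -
      have "N = 2 * (N div 2) + N mod 2" "N mod 2 \<le> 1" by auto
      then have "real N = 2 * real (N div 2) + real (N mod 2)" "real (N mod 2) \<le> 1"
        by (metis of_nat_add of_nat_mult of_nat_numeral, simp)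
      moreover have "real_of_int ?h = real (N div 2)" by simp
      ultimately show "real_of_int ?h \<le> real N / 2" "real N / 2 - 1 / 2 \<le> real_of_int ?h"
        using of_nat_0_le_iff[of "N mod 2", where 'a = real] by linarith+
    qed
    have nm1: "int ?n \<le> int ?n * int (m N)"
      using m0 mult_left_mono[of 1 "int (m N)" "int ?n"] by simp
    have top: "real_of_int (?h + int ?n * int (m N)) \<le> real N - l * real N"
      using m2 half by (simp add: algebra_simps)
    have lN: "0 \<le> l * real N" "l * real N \<le> real N / 2" using l N by auto
    have rm: "?h + int ?n * int (m N) \<le> int N"
      using top lN by linarith
    have ins: "inside N ?n v" if "v \<in> row N" for v
      using that rm nm1 unfolding row_def by (intro vrow_inside) auto
    have rowp: "v + y \<in> VNl l N" if v: "v \<in> row N" and y: "y \<in> intVN ?n" for v y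
    proof -
      obtain i where i: "i < m N" "v = (?h + int ?n * int i, ?h)"
        using v by (auto simp: row_def vrow_def)
      have "int ?n * (int i + 1) \<le> int ?n * int (m N)" using i by (intro mult_left_mono) auto
      then have im: "int ?n * int i + int ?n \<le> int ?n * int (m N)" by (simp add: distrib_left)
      have y': "1 \<le> fst y" "fst y \<le> int ?n" "1 \<le> snd y" "snd y \<le> int ?n" using y by (auto simp: intVN_eq)
      have vy: "fst (v + y) = ?h + int ?n * int i + fst y" "snd (v + y) = ?h + snd y"
        by (simp_all add: i(2))
      have i0: "0 \<le> int ?n * int i" by simp
      have low: "?h + 1 \<le> fst (v + y)" "?h + 1 \<le> snd (v + y)"
        unfolding vy using y' i0 by linarith+
      have up: "fst (v + y) \<le> ?h + int ?n * int (m N)" "snd (v + y) \<le> ?h + int ?n * int (m N)"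
        unfolding vy using y' im nm1 by linarith+
      have h0: "0 \<le> ?h" by simp
      show ?thesis
      proof (rule VNl_I)
        show "v + y \<in> VN N"
          using low up rm h0 by (simp add: VN_def mem_Times_iff)
      qed (use low up top half lN in linarith)+
    qed
    have p1: "real ?n powr (- \<epsilon>) \<le> 1"
      using bs(3) e powr_mono[of "- \<epsilon>" 0 "real ?n"] by simp
    have nN: "real ?n \<le> real N"
      using bs(1) c N powr_mono[of c 1 "real N"] by simp
    have R_le: "measure M (R N) \<le> exp (- (real N powr \<epsilon>))"
    proof -
      have "measure M (R N) \<le> exp (- (real ?n powr (- \<epsilon>) * real (card (row N))))"
        unfolding R_def
      proof (rule block_plateau[OF elim(1) gN])
        show "finite (row N)" by (simp add: row_def finite_vrow)
        show "apart ?n v v'" if "v \<in> row N" "v' \<in> row N" "v \<noteq> v'" for v v'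
          using that unfolding row_def by (rule vrow_apart)
      qed (use p1 ins in auto)
      also have "card (row N) = m N" unfolding row_def by (rule card_vrow[OF n0(1)])
      also have "exp (- (real ?n powr (- \<epsilon>) * real (m N))) \<le> exp (- (real N powr \<epsilon>))"
      proof -
        have "real N powr (- \<epsilon>) \<le> real ?n powr (- \<epsilon>)"
          using e n0 N nN by (intro powr_mono2') auto
        then have "real N powr (- \<epsilon>) * real N powr (2 * \<epsilon>) \<le> real ?n powr (- \<epsilon>) * real (m N)"
          using m1 by (intro mult_mono) auto
        then show ?thesis by (simp flip: powr_add)
      qed
      finally show ?thesis .
    qed
    have H_le: "measure M (H N p) \<le> exp (- (4 * ?L))" if p: "p \<in> Q N" for p
    proof -
      \<comment> \<open>With this tilt the exponent is \<open>(8 / 3 - 8) ln N\<close>, below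
        \<open>- 4 ln N\<close>, which beats the \<open>N^3\<close> pairs.\<close>
      let ?V = "d2\<^sup>2 / 12 * ?L" and ?a = "8 / d2"
      have y: "fst p \<in> row N" "snd p \<in> intVN ?n" "real ?n / 6 \<le> depth ?n (snd p)"
        using p by (auto simp: Q_def)
      have "greenN N (fst p + snd p) (fst p + snd p) - greenN ?n (snd p) (snd p) \<le> (g_const * (1 - c) + d2\<^sup>2 / 24) * ?L"
        by (rule elim(2)[rule_format, OF y(3)])
      also have "\<dots> \<le> ?V"
      proof (rule mult_right_mono)
        have "g_const * \<kappa> \<le> 1 * \<kappa>" using k pi_gt3 by (intro mult_right_mono) (auto simp: g_const_def)
        then show "g_const * (1 - c) + d2\<^sup>2 / 24 \<le> d2\<^sup>2 / 12" using k(3) by (simp add: c_def)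
      qed (use N in simp)
      finally have "measure M (H N p) \<le> exp (?a * ?a * ?V / 2 - ?a * (d2 * ?L))"
        unfolding H_def using d2 by (intro harm_tail(2)[OF gN ins[OF y(1)] y(2)]) auto
      also have "?a * ?a * ?V / 2 - ?a * (d2 * ?L) \<le> - (4 * ?L)"
        using d2 N by (simp add: power2_eq_square field_simps)
      finally show ?thesis by simp
    qed
    have "measure M (B N) \<le> measure M (R N) + measure M (\<Union>p\<in>Q N. H N p)"
      unfolding B_def using N Rm Hm finQ by (auto intro!: measure_Un_le sets.finite_UN)
    also have "measure M (\<Union>p\<in>Q N. H N p) \<le> (\<Sum>p\<in>Q N. measure M (H N p))"
      using Hm N finQ by (intro finite_measure_subadditive_finite) auto
    also have "\<dots> \<le> (\<Sum>p\<in>Q N. exp (- (4 * ?L)))" by (intro sum_mono H_le)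
    also have "\<dots> \<le> real N ^ 3 * exp (- (4 * ?L))"
    proof -
      have "real ?n * real (m N) \<le> real N" using m2 lN by (simp add: algebra_simps)
      moreover have "1 * real (m N) \<le> real ?n * real (m N)" using n0 by (intro mult_right_mono) auto
      ultimately have mN: "m N \<le> N" by simp
      have "card (Q N) = card (row N) * card {y\<in>intVN ?n. real ?n / 6 \<le> depth ?n y}"
        by (simp add: Q_def card_cartesian_product)
      also have "\<dots> \<le> N * card (VN N)"
      proof (rule mult_le_mono)
        show "card (row N) \<le> N" using mN card_vrow[OF n0(1)] by (simp add: row_def)
        show "card {y\<in>intVN ?n. real ?n / 6 \<le> depth ?n y} \<le> card (VN N)"
          using nN by (intro card_mono) (auto simp: VN_def intVN_eq)
      qed
      also have "\<dots> = N ^ 3" by (simp add: VN_def card_cartesian_product power3_eq_cube)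
      finally have "real (card (Q N)) \<le> real (N ^ 3)" by (rule of_nat_mono)
      then show ?thesis by (simp add: mult_right_mono)
    qed
    also have "\<dots> = 1 / real N"
    proof -
      have "exp (- (4 * ?L)) = 1 / real N ^ 4"
        using N by (simp add: exp_minus divide_inverse exp_of_nat_mult[of 4, simplified])
      then show ?thesis using N by (simp add: power_numeral_reduce)
    qed
    finally have 1: "measure M (B N) \<le> exp (- (real N powr \<epsilon>)) + 1 / real N"
      using R_le by simp
    have nb: "real N powr b \<le> real ?n powr b'"
    proof -
      have "(1 / 2) powr 1 \<le> (1 / 2 :: real) powr b'"
        using b' by (intro powr_mono') auto
      then have "real N powr (c * b') * (1 / 2) \<le> real N powr (c * b') * (1 / 2) powr b'"
        by (intro mult_left_mono) auto
      also have "\<dots> = (real N powr c * (1 / 2)) powr b'"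
        by (subst powr_mult) (auto simp: powr_powr)
      also have "\<dots> \<le> real ?n powr b'"
        using bs(2) b' by (intro powr_mono2) auto
      finally show ?thesis using elim(4) by linarith
    qed
    have lev: "2 * \<eta> * sqrt g_const * ?L \<le> lev N - d2 * ?L"
    proof -
      have "\<kappa> * ?L \<le> D / 12 * ?L" using k N by (intro mult_right_mono) auto
      moreover have "c * ?L = ?L - \<kappa> * ?L" by (simp add: c_def algebra_simps)
      moreover have "0 \<le> \<kappa> * ?L" using k N by simp
      ultimately have ln: "\<bar>ln (real ?n) - ?L\<bar> \<le> D / 12 * ?L + ln 2"
        using bs(4,5) ln_ge_zero[of "2::real"] by linarith
      \<comment> \<open>The coefficient of \<open>lev\<close> is \<open>\<eta> + 3 D / 4\<close>.
        Replacing \<open>ln n\<close> by \<open>ln N\<close> costs at most \<open>D / 2\<close>, and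
        the remaining \<open>D / 4\<close>, multiplied by \<open>2 sqrt g\<close>, is exactly
        \<open>d2\<close>.\<close>
      have "\<bar>\<theta> * (ln (real ?n) - ?L)\<bar> \<le> 3 * (D / 12 * ?L + ln 2)"
        unfolding abs_mult using th(2) ln by (intro mult_mono) auto
      moreover have "\<theta> * (ln (real ?n) - ?L) = \<theta> * ln (real ?n) - (\<eta> + 3 / 4 * D) * ?L"
        unfolding th(1) by (simp add: field_simps)
      ultimately have "(\<eta> + D / 4) * ?L \<le> \<theta> * ln (real ?n)"
        using elim(6) by (simp add: algebra_simps abs_le_iff)
      then have "2 * sqrt g_const * ((\<eta> + D / 4) * ?L) \<le> 2 * sqrt g_const * (\<theta> * ln (real ?n))"
        using g_const_pos by (intro mult_left_mono) auto
      then show ?thesis by (simp add: lev_def \<theta>_def d2_def algebra_simps)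
    qed
    have 2: "\<exists>x\<in>VNl l N. \<forall>y. sdist x y \<le> real N powr b \<longrightarrow> y \<in> VN N \<and> 2 * \<eta> * sqrt g_const * ?L \<le> \<Phi> N y \<omega>"
      if \<omega>: "\<omega> \<in> space M" "\<omega> \<notin> B N" for \<omega>
    proof -
      have nR: "\<omega> \<notin> R N" and nH: "\<And>p. p \<in> Q N \<Longrightarrow> \<omega> \<notin> H N p"
        using N \<omega> by (auto simp: B_def)
      from nR \<omega> obtain v z where v: "v \<in> row N" and z: "z \<in> ?S N"
        and zy: "\<forall>y\<in>intVN ?n. sdist z y \<le> real ?n powr b' \<longrightarrow> lev N \<le> 1 * psi N ?n (\<Phi> N) v y \<omega>"
        unfolding R_def by blast
      have zi: "z \<in> intVN ?n" using z n0 by (intro deep_int) auto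
      have "y' \<in> VN N \<and> 2 * \<eta> * sqrt g_const * ?L \<le> \<Phi> N y' \<omega>" if d: "sdist (v + z) y' \<le> real N powr b" for y'
      proof -
        define y where "y = y' - v"
        have y': "y' = v + y" by (simp add: y_def)
        have dz: "sdist z y \<le> real ?n powr b'"
          using d nb unfolding y' by (simp add: sdist_def)
        have dep: "real ?n / 6 \<le> depth ?n y"
        proof -
          have "\<bar>real_of_int (fst z) - real_of_int (fst y)\<bar> \<le> real ?n powr b'" "\<bar>real_of_int (snd z) - real_of_int (snd y)\<bar> \<le> real ?n powr b'"
            using dz unfolding sdist_def by (auto simp: max_def split: if_splits)
          moreover have "real ?n / 4 \<le> depth ?n z" using z by simp
          ultimately show ?thesis using elim(3) unfolding depth_def min.bounded_iff by linarith
        qed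
        have yi: "y \<in> intVN ?n" by (rule deep_int[OF n0(1) dep])
        have "(v, y) \<in> Q N" using v yi dep by (simp add: Q_def)
        then have "- (d2 * ?L) < \<Phi> N y' \<omega> - psi N ?n (\<Phi> N) v y \<omega>"
          using nH[of "(v, y)"] \<omega> by (simp add: H_def y')
        moreover have "lev N \<le> psi N ?n (\<Phi> N) v y \<omega>" using zy yi dz by simp
        ultimately have "2 * \<eta> * sqrt g_const * ?L \<le> \<Phi> N y' \<omega>" using lev by linarith
        moreover have "y' \<in> VN N" using rowp[OF v yi] VNl_D(5) unfolding y' by blast
        ultimately show ?thesis by blast
      qed
      then show ?thesis using rowp[OF v zi] by blast
    qed
    show ?case using 1 2 by blast
  qed
  have "(\<lambda>N. measure M (B N)) \<longlonglongrightarrow> 0"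
  proof (rule tendsto_sandwich[OF _ _ tendsto_const])
    show "\<forall>\<^sub>F N in sequentially. 0 \<le> measure M (B N)" by simp
    show "\<forall>\<^sub>F N in sequentially. measure M (B N) \<le> exp (- (real N powr \<epsilon>)) + 1 / real N"
      using main by (rule eventually_mono) blast
    show "(\<lambda>N. exp (- (real N powr \<epsilon>)) + 1 / real N) \<longlonglongrightarrow> 0"
      using e by (intro tendsto_add_zero; real_asymp)
  qed
  moreover have "\<forall>\<^sub>F N in sequentially. \<forall>\<omega>\<in>space M. \<omega> \<notin> B N \<longrightarrow> (\<exists>x\<in>VNl l N.
      \<forall>y. sdist x y \<le> real N powr b \<longrightarrow> y \<in> VN N \<and> 2 * \<eta> * sqrt g_const * ln (real N) \<le> \<Phi> N y \<omega>)"
    using main by (rule eventually_mono) blast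
  ultimately show ?thesis using Bm by blast
qed

section \<open>From plateau bounds to the supremum\<close>

definition plateau :: "real \<Rightarrow> real \<Rightarrow> nat \<Rightarrow> (site \<Rightarrow> real) \<Rightarrow> nat \<Rightarrow> bool" where
  "plateau l \<eta> N phi a \<longleftrightarrow> (\<exists>x\<in>VNl l N. \<forall>y\<in>box x a.
      (if y \<in> VN N then phi y else 0) \<ge> 2 * \<eta> * sqrt g_const * ln (real N))"

lemma DN_plateau: "DN l \<eta> N phi = Sup {enat a | a. plateau l \<eta> N phi a}"
  by (simp add: DN_def plateau_def)

text \<open>The supremum is resolved into countably many plateau events, which is what measurability
  needs. The alternative \<open>d = 0\<close> reflects that the supremum of the empty set is
  0.\<close>

lemma DN_eq_enat_iff:
  "DN l \<eta> N phi = enat d \<longleftrightarrow> (d = 0 \<or> plateau l \<eta> N phi d) \<and> (\<forall>a>d. \<not> plateau l \<eta> N phi a)"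
  (is "_ \<longleftrightarrow> ?R")
proof
  let ?A = "{enat a | a. plateau l \<eta> N phi a}"
  assume DN: "DN l \<eta> N phi = enat d"
  have le: "a \<le> d" if "plateau l \<eta> N phi a" for a
  proof -
    have "enat a \<le> Sup ?A" using that by (intro Sup_upper) blast
    then show ?thesis using DN by (simp add: DN_plateau)
  qed
  have "plateau l \<eta> N phi d" if "d \<noteq> 0"
  proof (rule ccontr)
    assume n: "\<not> ?thesis"
    have "Sup ?A \<le> enat (d - 1)"
    proof (rule Sup_least)
      fix e assume "e \<in> ?A"
      then obtain a where a: "e = enat a" "plateau l \<eta> N phi a" by blast
      then have "a \<noteq> d" using n by blast
      then show "e \<le> enat (d - 1)" using le[OF a(2)] a(1) by simp
    qed
    then show False using DN that by (simp add: DN_plateau)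
  qed
  then show ?R using le by (meson not_le)
next
  let ?A = "{enat a | a. plateau l \<eta> N phi a}"
  assume R: ?R
  have "Sup ?A \<le> enat d"
    using R by (intro Sup_least) (auto simp: not_less[symmetric])
  moreover have "enat d \<le> Sup ?A"
    using R by (cases "d = 0") (auto simp: zero_enat_def[symmetric] intro!: Sup_upper)
  ultimately show "DN l \<eta> N phi = enat d" by (simp add: DN_plateau)
qed

lemma box_sdist: "y \<in> box x a \<longleftrightarrow> sdist x y \<le> real a / 2"
  unfolding box_def sdist_def of_int_max max.bounded_iff of_int_abs
  by (simp add: abs_minus_commute)

lemma finite_box: "finite (box x a)"
proof -
  have "box x a = {y. sdist x y \<le> real a / 2}" using box_sdist by blast
  then show ?thesis by (simp only: finite_sball)
qed

lemma finite_VNl: "finite (VNl l N)"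
  by (rule finite_subset[of _ "VN N"]) (auto simp: VNl_def VN_def)

lemma plateau_event_sets:
  assumes "\<And>x. (\<lambda>\<omega>. Phi \<omega> x) \<in> borel_measurable M"
  shows "{\<omega>\<in>space M. plateau l \<eta> N (Phi \<omega>) a} \<in> sets M"
proof -
  note [measurable] = assms
  have "{\<omega>\<in>space M. 2 * \<eta> * sqrt g_const * ln (real N) \<le> (if y \<in> VN N then Phi \<omega> y else 0)} \<in> sets M" for y
    by (cases "y \<in> VN N") simp_all
  then show ?thesis
    unfolding plateau_def
    by (intro sets.sets_Collect_finite_Ex sets.sets_Collect_finite_All finite_VNl finite_box)
qed

lemma DN_event_sets:
  assumes "\<And>x. (\<lambda>\<omega>. Phi \<omega> x) \<in> borel_measurable M"
  shows "{\<omega>\<in>space M. \<exists>d. DN l \<eta> N (Phi \<omega>) = enat d \<and> Q d} \<in> sets M"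
proof -
  note [measurable] = plateau_event_sets[OF assms]
  show ?thesis unfolding DN_eq_enat_iff by measurable
qed

theorem theorem1p7:
  fixes M :: "'a measure" and Phi :: "nat \<Rightarrow> 'a \<Rightarrow> site \<Rightarrow> real"
    and l \<eta> :: real
  assumes "prob_space M"
    and "\<And>N. N \<ge> 1 \<Longrightarrow> is_dgff M N (Phi N)"
    and "0 < l" "l < 1/2"
    and "-1 < \<eta>" "\<eta> < 1"
  shows "\<forall>\<epsilon>>0. (\<lambda>N. measure M {\<omega> \<in> space M. \<exists>d::nat.
            DN l \<eta> N (Phi N \<omega>) = enat d \<and> 0 < d \<and>
            \<bar>ln (real d) / ln (real N) - (1/2 - \<eta>/2)\<bar> \<le> \<epsilon>}) \<longlonglongrightarrow> 1"
proof (intro allI impI)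
  fix \<epsilon> :: real assume "0 < \<epsilon>"
  interpret prob_space M by fact
  \<comment> \<open>Besides \<open>e \<le> \<epsilon>\<close>, the two quarters keep
    \<open>b\<close> positive and \<open>b'\<close> below 1. \<open>b\<close> uses only half of
    \<open>e\<close>; the other half is spent on rounding \<open>N^b\<close> down.\<close>
  define e where "e = min \<epsilon> (min ((1 - \<eta>) / 4) ((1 + \<eta>) / 4))"
  have e: "0 < e" "e \<le> \<epsilon>" "e \<le> (1 - \<eta>) / 4" "e \<le> (1 + \<eta>) / 4"
  proof -
    show "0 < e" unfolding e_def using \<open>0 < \<epsilon>\<close> assms(5,6) by simp
    show "e \<le> \<epsilon>" "e \<le> (1 - \<eta>) / 4" "e \<le> (1 + \<eta>) / 4"
      unfolding e_def by linarith+
  qed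
  define b where "b = (1 - \<eta>) / 2 - e / 2"
  define b' where "b' = (1 - \<eta>) / 2 + e"
  have b: "0 < b" "b < (1 - \<eta>) / 2" "(1 - \<eta>) / 2 < b'" "b' < 1" "b < 1"
    using e assms(5,6) by (auto simp: b_def b'_def field_simps)
  have meas: "(\<lambda>\<omega>. Phi N \<omega> x) \<in> borel_measurable M" if "1 \<le> N" for N x
    using assms(2)[OF that] unfolding is_dgff_def by blast
  have g: "gfam M (intVN N) (\<lambda>x \<omega>. Phi N \<omega> x) (greenN N)" if "1 \<le> N" for N
    by (rule is_dgff_gfam[OF assms(1) assms(2)[OF that]])
  obtain U where U: "\<And>N. U N \<in> sets M" "(\<lambda>N. measure M (U N)) \<longlonglongrightarrow> 0"
    and Ue: "\<forall>\<^sub>F N in sequentially. \<forall>\<omega>\<in>space M. \<forall>x\<in>VNl l N.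
      (\<forall>y\<in>VN N. sdist x y \<le> real N powr b' / 2 \<longrightarrow> 2 * \<eta> * sqrt g_const * ln (real N) \<le> Phi N \<omega> y) \<longrightarrow> \<omega> \<in> U N"
    using plateau_upper[OF g assms(3) b(3,4) assms(6)] by blast
  obtain W where W: "\<And>N. W N \<in> sets M" "(\<lambda>N. measure M (W N)) \<longlonglongrightarrow> 0"
    and We: "\<forall>\<^sub>F N in sequentially. \<forall>\<omega>\<in>space M. \<omega> \<notin> W N \<longrightarrow> (\<exists>x\<in>VNl l N.
      \<forall>y. sdist x y \<le> real N powr b \<longrightarrow> y \<in> VN N \<and> 2 * \<eta> * sqrt g_const * ln (real N) \<le> Phi N \<omega> y)"
    using plateau_lower[OF g assms(3,4) b(1,2) assms(5,6)] by blast
  let ?E = "\<lambda>N. {\<omega> \<in> space M. \<exists>d::nat. DN l \<eta> N (Phi N \<omega>) = enat d \<and> 0 < d \<and>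
            \<bar>ln (real d) / ln (real N) - (1/2 - \<eta>/2)\<bar> \<le> \<epsilon>}"
  have "\<forall>\<^sub>F N in sequentially. ln 2 \<le> e / 2 * ln (real N)"
    using e(1) by real_asymp
  moreover have "\<forall>\<^sub>F N in sequentially. (2::nat) \<le> N"
    by (rule eventually_ge_at_top)
  moreover note Ue We
  ultimately have main: "\<forall>\<^sub>F N in sequentially. 1 - (measure M (U N) + measure M (W N)) \<le> measure M (?E N)"
  proof eventually_elim
    case (elim N)
    let ?L = "ln (real N)"
    have N: "1 \<le> N" "0 < ?L" using elim(2) by auto
    note bs = bsize_bounds[OF N(1) b(1)]
    have "\<omega> \<in> ?E N" if \<omega>: "\<omega> \<in> space M - (U N \<union> W N)" for \<omega>
    proof -
      obtain x where x: "x \<in> VNl l N" "\<And>y. sdist x y \<le> real N powr b \<Longrightarrow> y \<in> VN N \<and> 2 * \<eta> * sqrt g_const * ?L \<le> Phi N \<omega> y"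
        using elim(4) \<omega> by blast
      have lo: "plateau l \<eta> N (Phi N \<omega>) (bsize b N)"
        unfolding plateau_def
      proof (intro bexI[OF _ x(1)] ballI)
        fix y assume "y \<in> box x (bsize b N)"
        then have "sdist x y \<le> real N powr b"
          using bs(1) by (simp add: box_sdist)
        from x(2)[OF this] show "2 * \<eta> * sqrt g_const * ?L \<le> (if y \<in> VN N then Phi N \<omega> y else 0)"
          by simp
      qed
      \<comment> \<open>A box of edge length \<open>a \<ge> N^b'\<close> contains the sup-norm ball
        of radius \<open>N^b' / 2\<close>, so a plateau of that size forces \<open>\<omega>\<close>
        into \<open>U N\<close>. This also makes the set of plateau sizes finite, and its supremum a
        maximum.\<close>
      have up: "real a < real N powr b'" if "plateau l \<eta> N (Phi N \<omega>) a" for a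
      proof (rule ccontr)
        assume n: "\<not> ?thesis"
        obtain x where x: "x \<in> VNl l N" and
          y: "\<forall>y\<in>box x a. 2 * \<eta> * sqrt g_const * ?L \<le> (if y \<in> VN N then Phi N \<omega> y else 0)"
          using \<open>plateau l \<eta> N (Phi N \<omega>) a\<close> unfolding plateau_def by blast
        have "2 * \<eta> * sqrt g_const * ?L \<le> Phi N \<omega> y" if "y \<in> VN N" "sdist x y \<le> real N powr b' / 2" for y
        proof -
          have "y \<in> box x a" using that n by (simp add: box_sdist)
          then show ?thesis using y that(1) by force
        qed
        then have "\<omega> \<in> U N" using elim(3) \<omega> x by blast
        then show False using \<omega> by blast
      qed
      let ?A = "{a. plateau l \<eta> N (Phi N \<omega>) a}"
      have fin: "finite ?A"
      proof (rule finite_subset)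
        show "?A \<subseteq> {..nat \<lceil>real N powr b'\<rceil>}"
        proof
          fix a assume "a \<in> ?A"
          then have "real a < real N powr b'" using up by blast
          then show "a \<in> {..nat \<lceil>real N powr b'\<rceil>}" by simp linarith
        qed
      qed simp
      define d where "d = Max ?A"
      have dA: "plateau l \<eta> N (Phi N \<omega>) d" using Max_in[OF fin] lo unfolding d_def by blast
      have dge: "a \<le> d" if "plateau l \<eta> N (Phi N \<omega>) a" for a
        unfolding d_def using that fin by simp
      have "DN l \<eta> N (Phi N \<omega>) = enat d"
        unfolding DN_eq_enat_iff using dA dge by (meson not_le)
      moreover have d1: "bsize b N \<le> d" using dge[OF lo] .
      moreover have "0 < d" using d1 bs(3) by simp
      moreover have "\<bar>ln (real d) / ?L - (1/2 - \<eta>/2)\<bar> \<le> \<epsilon>"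
      proof -
        have "ln (real d) \<le> ln (real N powr b')"
          using up[OF dA] \<open>0 < d\<close> by (intro ln_mono) auto
        then have "ln (real d) \<le> b' * ?L" by simp
        then have u: "ln (real d) / ?L \<le> b'" using N by (simp add: divide_le_eq)
        have "ln (real (bsize b N)) \<le> ln (real d)" using d1 bs(3) by (intro ln_mono) auto
        then have "(b - e / 2) * ?L \<le> ln (real d)"
          using bs(5) elim(1) by (simp add: algebra_simps)
        then have "b - e / 2 \<le> ln (real d) / ?L" using N by (simp add: le_divide_eq)
        moreover have "b - e / 2 = (1/2 - \<eta>/2) - e" "b' = (1/2 - \<eta>/2) + e"
          by (simp_all add: b_def b'_def field_simps)
        ultimately show ?thesis using u e(2) unfolding abs_le_iff by linarith
      qed
      ultimately show ?thesis using \<omega> by blast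
    qed
    then have sub: "space M - (U N \<union> W N) \<subseteq> ?E N" by blast
    have Em: "?E N \<in> sets M" by (rule DN_event_sets[OF meas[OF N(1)]])
    have "1 - (measure M (U N) + measure M (W N)) \<le> 1 - measure M (U N \<union> W N)"
      using measure_Un_le[OF U(1)[of N] W(1)[of N]] by simp
    also have "\<dots> = measure M (space M - (U N \<union> W N))"
      using U(1) W(1) by (intro prob_compl[symmetric]) auto
    also have "\<dots> \<le> measure M (?E N)" by (rule finite_measure_mono[OF sub Em])
    finally show ?case .
  qed
  show "(\<lambda>N. measure M (?E N)) \<longlonglongrightarrow> 1"
  proof (rule tendsto_sandwich[OF main _ _ tendsto_const])
    show "\<forall>\<^sub>F N in sequentially. measure M (?E N) \<le> 1" by simp
    show "(\<lambda>N. 1 - (measure M (U N) + measure M (W N))) \<longlonglongrightarrow> 1"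
      using tendsto_diff[OF tendsto_const[of 1] tendsto_add[OF U(2) W(2)]] by simp
  qed
qed

end
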